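(* Let $G$ be a finite abelian group and let $p$ be the smallest prime divisor of $|G|$. Assume that either $p=2$ and $|G|\geq 36$, or $\frac{|G|}{p}$ is a prime number with $\frac{|G|}{p}\geq 2p+3$. Let $A\subseteq G\setminus\{0\}$ be a subset of cardinality $\mathrm{cr}(G)-1$ such that $\sum(A)\neq G$. Then there exists a subgroup $H$ of $G$ with $|H|=\frac{|G|}{p}$ such that: (i) if $p=2$, then $A=H\setminus\{0\}$; (ii) if $p\geq 3$, then there is an element $g\in G\setminus H$ such that $A\subseteq H\cup(g+H)\cup(-g+H)$ and $H\setminus\{0\}\subseteq A$.
   Context: For a subset $A$ of a finite abelian group $G$, $\sum(A)=\{\sum_{g\in B} g:\emptyset\neq B\subseteq A\}$ is the set of nonempty subset sums of distinct elements of $A$. The critical number $\mathrm{cr}(G)$ is the least positive integer $\ell$ such that every subset $A\subseteq G\setminus\{0\}$ with $|A|\geq \ell$ satisfies $\sum(A)=G$.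
   Formalization: The case |G| = 14 is excluded: for G = Z_14 (p = 2, |G|/p = 7, cr(G) = 7) the set A = {1,2,3,-1,-2,-3} has cr(G)-1 = 6 elements and its subset sums miss 7, but A is not H\{0} for the subgroup H of order 7. *)

theory Defs
  imports "HOL-Algebra.Algebra"
begin

text \<open>
  Abelian groups are written multiplicatively, following \<open>HOL-Algebra\<close>: the sum of the elements
  of \<open>B\<close> is \<open>finprod\<close> over \<open>B\<close>, zero is \<open>\<one>\<close>, and the coset \<open>g + H\<close> is \<open>g <# H\<close>.
  Both definitions are meant for finite groups; \<open>finprod\<close> over an infinite set is \<open>\<one>\<close>.
\<close>

definition subset_sums :: "('a, 'b) monoid_scheme \<Rightarrow> 'a set \<Rightarrow> 'a set" where
  "subset_sums G A = {finprod G (\<lambda>x. x) B | B. B \<noteq> {} \<and> B \<subseteq> A}"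

text \<open>For finite \<open>G\<close> the minimum exists, as the condition is vacuous for \<open>l = order G\<close>.\<close>

definition critical_number :: "('a, 'b) monoid_scheme \<Rightarrow> nat" where
  "critical_number G = (LEAST l. 0 < l \<and>
     (\<forall>A. A \<subseteq> carrier G - {\<one>\<^bsub>G\<^esub>} \<and> l \<le> card A \<longrightarrow> subset_sums G A = carrier G))"

text \<open>
  Order \<open>14\<close> is excluded in the theorem: for the cyclic group of order \<open>14\<close> the critical number
  is \<open>7\<close>, and the \<open>6\<close>-element set \<open>{1, 2, 3, -1, -2, -3}\<close> has subset sums \<open>-6, \<dots>, 6\<close>, which miss
  \<open>7\<close>, although it is not contained in the subgroup of order \<open>7\<close>.
\<close>

end

theory Submission imports Defs begin

text \<open>
  Let \<open>m = |G| / p\<close>. For a subgroup \<open>H\<close> of order \<open>m\<close>, the set \<open>H - {0}\<close> together with \<open>p - 2\<close> elements of one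
  further coset of \<open>H\<close> is incomplete, so \<open>|A| \<ge> m + p - 3\<close>. It suffices to show that an incomplete set of exactly this
  size contains \<open>H - {0}\<close> for some \<open>H\<close>.

  All lower bounds for sumsets come from two sources: the Cauchy--Davenport inequality, and the double count
  \<open>\<Sum>d\<in>D. |T \<inter> (T + d)| \<le> |T|\<^sup>2\<close>, which says that a small set \<open>T\<close> cannot be almost invariant under many translations.

  For \<open>p = 2\<close> let \<open>H\<close> have index \<open>2\<close>, \<open>A\<^sub>0 = A \<inter> H\<close> and \<open>A\<^sub>1 = A - H\<close>. If \<open>2 |A\<^sub>0| > |H|\<close>, then \<open>A\<^sub>0\<close> has all of \<open>H\<close> as sums.
  Otherwise pigeonhole gives all of \<open>G\<close>, unless \<open>A\<^sub>1\<close> has at most \<open>|A\<^sub>1|\<close> sums of an even, or of an odd, number of elements;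
  then the differences of \<open>A\<^sub>1\<close> form a subgroup \<open>K\<close> with \<open>A\<^sub>1\<close> nearly a coset \<open>v + K\<close>, and either all of \<open>G\<close> is
  reached or \<open>K \<union> (v + K)\<close> is the subgroup sought.

  If \<open>|G| = pq\<close>, let \<open>H\<close> and \<open>K\<close> be the subgroups of orders \<open>q\<close> and \<open>p\<close>. From the \<open>a\<close> elements of \<open>A\<close> in a coset \<open>c + H\<close>
  one uses the \<open>j\<close>-fold sums with \<open>l \<le> j \<le> a - l\<close>: a larger \<open>l\<close> gives more sums in each coset \<open>jc + H\<close>, but fewer
  such cosets. The task is to choose \<open>l\<close> for every coset so that Cauchy--Davenport, applied in \<open>H\<close> and in \<open>K\<close>,
  yields all of \<open>G\<close>.
\<close>

text \<open>The constants come from a balance sheet. For two primes let \<open>A\<close> have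
  \<open>h\<close> elements in \<open>H\<close> and n(c) elements in another coset c. A choice l(c)
  >= 1 contributes n(c) - 2 + l(c) to the q - 1 needed in \<open>H\<close>, and n(c) - 2 l(c) to the
  p - 1 needed in \<open>K\<close>. Since |A| = p + q - 3, taking l = 1 everywhere gives, together
  with the h from \<open>A \<inter> H\<close>, exactly q - 2 in \<open>H\<close>: one too few.
  Raising one l(c) to 2 repairs this at a price of 2 in \<open>K\<close>, which is affordable when q
  >= 2p + 2 + h. If h >= 3, the set \<open>A \<inter> H\<close> has about 2h sums, and l = 0 or 1 is
  enough. If h <= 2, the bound q >= 2p + 3 leaves the single exception h = 2, q = 2p + 3, where the
  distribution of \<open>A\<close> over the cosets must make up for the missing unit. For p = 2 the
  balance is m = h + a + 1 with \<open>a\<close> elements outside \<open>H\<close>. As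
  \<open>A \<inter> H\<close> has at least h + 1 sums, a parity class can only be missed if the sums
  of that parity outside number at most \<open>a\<close>, which is close to the trivial lower
  bound.\<close>

context comm_group begin

definition rsums :: "nat \<Rightarrow> 'a set \<Rightarrow> 'a set" where
  "rsums j S = (\<lambda>B. finprod G (\<lambda>x. x) B) ` {B. B \<subseteq> S \<and> card B = j}"

definition sums0 :: "'a set \<Rightarrow> 'a set" where
  "sums0 S = (\<lambda>B. finprod G (\<lambda>x. x) B) ` Pow S"

subsection \<open>Subset sums\<close>

lemma inv_mult_cancel [simp]:
  assumes "x \<in> carrier G" "y \<in> carrier G"
  shows "inv x \<otimes> (x \<otimes> y) = y" "x \<otimes> (inv x \<otimes> y) = y"
  using assms by (simp_all add: m_assoc[symmetric])

lemma finprod_id_closed [simp]: "B \<subseteq> carrier G \<Longrightarrow> finprod G (\<lambda>x. x) B \<in> carrier G"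
  by (rule finprod_closed) auto

lemma rsums_carrier: "S \<subseteq> carrier G \<Longrightarrow> rsums j S \<subseteq> carrier G"
  unfolding rsums_def by auto

lemma sums0_carrier: "S \<subseteq> carrier G \<Longrightarrow> sums0 S \<subseteq> carrier G"
  unfolding sums0_def by auto

lemma subset_sums_carrier: "S \<subseteq> carrier G \<Longrightarrow> subset_sums G S \<subseteq> carrier G"
  unfolding subset_sums_def by auto

lemma finite_rsums: "finite S \<Longrightarrow> finite (rsums j S)"
  unfolding rsums_def by auto

lemma finite_sums0: "finite S \<Longrightarrow> finite (sums0 S)"
  unfolding sums0_def by auto

lemma rsums_mono: "S \<subseteq> Y \<Longrightarrow> rsums j S \<subseteq> rsums j Y"
  unfolding rsums_def by auto

lemma sums0_mono: "S \<subseteq> Y \<Longrightarrow> sums0 S \<subseteq> sums0 Y"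
  unfolding sums0_def by auto

lemma subset_sums_mono: "S \<subseteq> Y \<Longrightarrow> subset_sums G S \<subseteq> subset_sums G Y"
  unfolding subset_sums_def by blast

lemma rsums_sums0: "rsums j S \<subseteq> sums0 S"
  unfolding rsums_def sums0_def by auto

lemma rsums_subset_sums: "j \<ge> 1 \<Longrightarrow> rsums j S \<subseteq> subset_sums G S"
  unfolding rsums_def subset_sums_def by force

lemma subset_sums_sums0: "subset_sums G S \<subseteq> sums0 S"
  unfolding sums0_def subset_sums_def by auto

lemma one_sums0: "\<one> \<in> sums0 S"
  unfolding sums0_def using finprod_empty by (metis Pow_bottom image_eqI)

lemma sums0_eq: "sums0 S = insert \<one> (subset_sums G S)"
proof -
  have "sums0 S \<subseteq> insert \<one> (subset_sums G S)"
    unfolding sums0_def subset_sums_def by (auto simp: finprod_empty)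
  then show ?thesis using one_sums0 subset_sums_sums0 by blast
qed

lemma rsums_1: "S \<subseteq> carrier G \<Longrightarrow> rsums 1 S = S"
proof -
  assume S: "S \<subseteq> carrier G"
  have "finprod G (\<lambda>x. x) {x} = x" if "x \<in> S" for x
    using S that by (subst finprod_insert) auto
  moreover have "{B. B \<subseteq> S \<and> card B = 1} = (\<lambda>x. {x}) ` S" by (auto simp: card_1_singleton_iff)
  ultimately show ?thesis unfolding rsums_def by (simp add: image_image)
qed

lemma subset_subset_sums: "S \<subseteq> carrier G \<Longrightarrow> S \<subseteq> subset_sums G S"
  using rsums_1 rsums_subset_sums[of 1 S] by auto

lemma rsums_step:
  assumes "S \<subseteq> carrier G" "finite S" "x \<in> S" "y \<in> rsums j (S - {x})"
  shows "x \<otimes> y \<in> rsums (Suc j) S"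
proof -
  obtain B where B: "B \<subseteq> S - {x}" "card B = j" "y = finprod G (\<lambda>x. x) B"
    using assms(4) unfolding rsums_def by auto
  have fB: "finite B" "x \<notin> B" using B assms(2) finite_subset by auto
  have "finprod G (\<lambda>x. x) (insert x B) = x \<otimes> y"
    using fB B assms by (subst finprod_insert) auto
  moreover have "insert x B \<subseteq> S" "card (insert x B) = Suc j" using B fB assms by auto
  ultimately show ?thesis unfolding rsums_def by (metis (mono_tags, lifting) CollectI image_eqI)
qed

lemma sums0_mult:
  assumes "S \<subseteq> carrier G" "Y \<subseteq> carrier G" "finite S" "finite Y" "S \<inter> Y = {}" "x \<in> sums0 S" "y \<in> sums0 Y"
  shows "x \<otimes> y \<in> sums0 (S \<union> Y)"
proof -
  obtain B C where B: "B \<subseteq> S" "x = finprod G (\<lambda>x. x) B" "C \<subseteq> Y" "y = finprod G (\<lambda>x. x) C"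
    using assms unfolding sums0_def by auto
  have "finprod G (\<lambda>x. x) (B \<union> C) = x \<otimes> y"
    unfolding B by (rule finprod_Un_disjoint) (use B assms finite_subset in blast)+
  moreover have "B \<union> C \<in> Pow (S \<union> Y)" using B by auto
  ultimately show ?thesis unfolding sums0_def by (metis image_eqI)
qed

lemma subset_sums_mult:
  assumes "S \<subseteq> carrier G" "Y \<subseteq> carrier G" "finite S" "finite Y" "S \<inter> Y = {}" "x \<in> subset_sums G S" "y \<in> sums0 Y"
  shows "x \<otimes> y \<in> subset_sums G (S \<union> Y)"
proof -
  obtain B C where B: "B \<noteq> {}" "B \<subseteq> S" "x = finprod G (\<lambda>x. x) B" "C \<subseteq> Y" "y = finprod G (\<lambda>x. x) C"
    using assms unfolding sums0_def subset_sums_def by auto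
  have "finprod G (\<lambda>x. x) (B \<union> C) = x \<otimes> y"
    unfolding B by (rule finprod_Un_disjoint) (use B assms finite_subset in blast)+
  moreover have "B \<union> C \<subseteq> S \<union> Y" "B \<union> C \<noteq> {}" using B by auto
  ultimately show ?thesis unfolding subset_sums_def by (metis (mono_tags, lifting) CollectI)
qed

text \<open>Complementation \<open>B \<mapsto> S - B\<close> reflects a sum in the total of
  \<open>S\<close>. This settles the end \<open>j = card S - 1\<close> of a later induction.\<close>

lemma rsums_compl:
  assumes "S \<subseteq> carrier G" "finite S" "j \<le> card S"
  shows "card (rsums (card S - j) S) = card (rsums j S)"
proof -
  let ?s = "finprod G (\<lambda>x. x) S"
  have *: "finprod G (\<lambda>x. x) (S - B) = ?s \<otimes> inv (finprod G (\<lambda>x. x) B)" if "B \<subseteq> S" for B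
  proof -
    have "?s = finprod G (\<lambda>x. x) (B \<union> (S - B))" using that by (simp add: Un_absorb1)
    also have "\<dots> = finprod G (\<lambda>x. x) B \<otimes> finprod G (\<lambda>x. x) (S - B)"
      by (rule finprod_Un_disjoint) (use that assms finite_subset in blast)+
    finally have s: "?s = finprod G (\<lambda>x. x) B \<otimes> finprod G (\<lambda>x. x) (S - B)" .
    have c: "finprod G (\<lambda>x. x) B \<in> carrier G" "finprod G (\<lambda>x. x) (S - B) \<in> carrier G"
      using that assms by (intro finprod_id_closed; blast)+
    show ?thesis unfolding s using c by (simp add: m_comm inv_solve_right')
  qed
  have "rsums (card S - j) S = (\<lambda>t. ?s \<otimes> inv t) ` rsums j S"
  proof
    show "rsums (card S - j) S \<subseteq> (\<lambda>t. ?s \<otimes> inv t) ` rsums j S"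
    proof
      fix t assume "t \<in> rsums (card S - j) S"
      then obtain B where B: "B \<subseteq> S" "card B = card S - j" "t = finprod G (\<lambda>x. x) B"
        unfolding rsums_def by auto
      have "t = ?s \<otimes> inv (finprod G (\<lambda>x. x) (S - B))"
        using *[of "S - B"] B by (simp add: double_diff)
      moreover have "card (S - B) = j" using B assms by (metis card_Diff_subset diff_diff_cancel finite_subset)
      ultimately show "t \<in> (\<lambda>t. ?s \<otimes> inv t) ` rsums j S" unfolding rsums_def by auto
    qed
    show "(\<lambda>t. ?s \<otimes> inv t) ` rsums j S \<subseteq> rsums (card S - j) S"
    proof
      fix t assume "t \<in> (\<lambda>t. ?s \<otimes> inv t) ` rsums j S"
      then obtain B where B: "B \<subseteq> S" "card B = j" "t = ?s \<otimes> inv (finprod G (\<lambda>x. x) B)"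
        unfolding rsums_def by auto
      then have "t = finprod G (\<lambda>x. x) (S - B)" using * by simp
      moreover have "card (S - B) = card S - j" using B assms by (metis card_Diff_subset finite_subset)
      ultimately show "t \<in> rsums (card S - j) S" unfolding rsums_def by auto
    qed
  qed
  moreover have "inj_on (\<lambda>t. ?s \<otimes> inv t) (rsums j S)"
    using rsums_carrier[OF assms(1), of j] assms(1)
    by (intro inj_onI) (metis finprod_id_closed inv_closed inv_inv l_cancel subsetD)
  ultimately show ?thesis by (simp add: card_image)
qed

subsection \<open>Overlaps of translates and the Cauchy--Davenport inequality\<close>

lemma inj_on_mult: "a \<in> carrier G \<Longrightarrow> S \<subseteq> carrier G \<Longrightarrow> inj_on (\<lambda>x. a \<otimes> x) S"
  by (intro inj_onI) (metis l_cancel subsetD)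

lemma card_translate: "a \<in> carrier G \<Longrightarrow> S \<subseteq> carrier G \<Longrightarrow> card ((\<lambda>x. a \<otimes> x) ` S) = card S"
  by (simp add: card_image inj_on_mult)

lemma mem_coset: "v \<in> carrier G \<Longrightarrow> H \<subseteq> carrier G \<Longrightarrow> x \<in> v <# H \<longleftrightarrow> x \<in> carrier G \<and> inv v \<otimes> x \<in> H"
proof
  assume "v \<in> carrier G" "H \<subseteq> carrier G" "x \<in> v <# H"
  then obtain h where "h \<in> H" "x = v \<otimes> h" "h \<in> carrier G" unfolding l_coset_def by auto
  then show "x \<in> carrier G \<and> inv v \<otimes> x \<in> H" using \<open>v \<in> carrier G\<close> by (simp add: m_assoc[symmetric])
next
  assume "v \<in> carrier G" "H \<subseteq> carrier G" "x \<in> carrier G \<and> inv v \<otimes> x \<in> H"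
  then show "x \<in> v <# H" unfolding l_coset_def
    by (auto intro!: bexI[of _ "inv v \<otimes> x"] simp: m_assoc[symmetric])
qed

lemma coset_card: "v \<in> carrier G \<Longrightarrow> H \<subseteq> carrier G \<Longrightarrow> card (v <# H) = card H"
proof -
  assume "v \<in> carrier G" "H \<subseteq> carrier G"
  moreover have "v <# H = (\<lambda>x. v \<otimes> x) ` H" unfolding l_coset_def by auto
  ultimately show ?thesis by (simp add: card_translate)
qed

text \<open>An ordered pair of points of \<open>T\<close> determines the translation that joins
  them, so over all of \<open>D\<close> it is counted at most once.\<close>

lemma overlap_sum:
  assumes "T \<subseteq> carrier G" "finite T" "D \<subseteq> carrier G" "finite D"
  shows "(\<Sum>d\<in>D. card (T \<inter> (\<lambda>x. d \<otimes> x) ` T)) \<le> card T * card T"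
proof -
  have "(\<Sum>d\<in>D. card (T \<inter> (\<lambda>x. d \<otimes> x) ` T)) = card (SIGMA d:D. T \<inter> (\<lambda>x. d \<otimes> x) ` T)"
    using assms by simp
  also have "\<dots> \<le> card (T \<times> T)"
  proof (rule card_inj_on_le[where f = "\<lambda>(d,t). (t, inv d \<otimes> t)"])
    show "inj_on (\<lambda>(d,t). (t, inv d \<otimes> t)) (SIGMA d:D. T \<inter> (\<lambda>x. d \<otimes> x) ` T)"
    proof (rule inj_onI, clarsimp)
      fix d d' x y assume "d \<in> D" "d' \<in> D" "x \<in> T" "inv d \<otimes> (d' \<otimes> y) = inv d' \<otimes> (d' \<otimes> y)" "y \<in> T" "d' \<otimes> y \<in> T"
      then show "d = d'" using assms by (metis inv_closed inv_inv r_cancel subsetD)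
    qed
    show "(\<lambda>(d,t). (t, inv d \<otimes> t)) ` (SIGMA d:D. T \<inter> (\<lambda>x. d \<otimes> x) ` T) \<subseteq> T \<times> T"
      using assms by (auto simp: m_assoc[symmetric] subset_iff)
  qed (use assms in auto)
  finally show ?thesis by (simp add: card_cartesian_product)
qed

text \<open>The neutral translation overlaps in all of \<open>T\<close>. Splitting it off gives an
  extra \<open>card T\<close>, on which the later contradictions rely.\<close>

lemma overlap_bound:
  assumes "T \<subseteq> carrier G" "finite T" "D \<subseteq> carrier G" "finite D" "\<one> \<in> D"
    and "\<And>d. d \<in> D \<Longrightarrow> d \<noteq> \<one> \<Longrightarrow> r \<le> card (T \<inter> (\<lambda>x. d \<otimes> x) ` T)"
  shows "card T + (card D - 1) * r \<le> card T * card T"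
proof -
  have 1: "(\<lambda>x. \<one> \<otimes> x) ` T = T" using assms(1) by force
  have "(card D - 1) * r = (\<Sum>d\<in>D - {\<one>}. r)" using assms by simp
  also have "\<dots> \<le> (\<Sum>d\<in>D - {\<one>}. card (T \<inter> (\<lambda>x. d \<otimes> x) ` T))"
    by (rule sum_mono) (use assms in auto)
  finally have "card T + (card D - 1) * r \<le> card T + (\<Sum>d\<in>D - {\<one>}. card (T \<inter> (\<lambda>x. d \<otimes> x) ` T))"
    by simp
  also have "\<dots> = (\<Sum>d\<in>D. card (T \<inter> (\<lambda>x. d \<otimes> x) ` T))"
    using sum.remove[OF assms(4,5), of "\<lambda>d. card (T \<inter> (\<lambda>x. d \<otimes> x) ` T)"] by (simp only: 1 Int_absorb)
  also have "\<dots> \<le> card T * card T" using overlap_sum[OF assms(1-4)] .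
  finally show ?thesis .
qed

lemma subgroup_card_dvd:
  assumes "finite (carrier G)" "subgroup J G" "subgroup H G" "J \<subseteq> H"
  shows "card J dvd card H"
proof -
  interpret GH: group "G\<lparr>carrier := H\<rparr>" using assms(3) subgroup_imp_group by blast
  have "subgroup J (G\<lparr>carrier := H\<rparr>)" using assms subgroup_incl by blast
  then have "card (rcosets\<^bsub>G\<lparr>carrier := H\<rparr>\<^esub> J) * card J = order (G\<lparr>carrier := H\<rparr>)"
    by (rule GH.lagrange)
  also have "\<dots> = card H" by (simp add: order_def)
  finally show ?thesis by (metis dvd_triv_right)
qed

text \<open>Only \<open>Y\<close> has to lie in \<open>H\<close>: the Dyson transform at a point \<open>x\<close> of \<open>S\<close> moves elements from \<open>Y\<close> to \<open>S\<close>, and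
  it is stuck only if \<open>S\<close> is invariant under \<open>Y\<close>, hence under \<open>H\<close>.\<close>

lemma cauchy_davenport_normalized:
  assumes fin: "finite (carrier G)" and H: "subgroup H G" and q: "Factorial_Ring.prime (card H)"
  shows "S \<subseteq> carrier G \<Longrightarrow> S \<noteq> {} \<Longrightarrow> Y \<subseteq> H \<Longrightarrow> \<one> \<in> Y \<Longrightarrow>
    min (card H) (card S + card Y - 1) \<le> card (S <#> Y)"
proof (induction "card Y" arbitrary: S Y rule: less_induct)
  case less
  have Hc: "H \<subseteq> carrier G" using H subgroup.subset by blast
  have fX: "finite S" and fY: "finite Y" using less.prems fin Hc by (meson finite_subset subset_trans)+
  have Yc: "Y \<subseteq> carrier G" using less.prems Hc by auto
  have XYc: "S <#> Y \<subseteq> carrier G" using less.prems Yc set_mult_closed by blast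
  have fXY: "finite (S <#> Y)" using XYc fin finite_subset by blast
  have XXY: "S \<subseteq> S <#> Y" using less.prems unfolding set_mult_def by force
  show ?case
  proof (cases "\<exists>x\<in>S. \<exists>d\<in>Y. x \<otimes> d \<notin> S")
    case True
    then obtain x d where xd: "x \<in> S" "d \<in> Y" "x \<otimes> d \<notin> S" by auto
    define S' where "S' = S \<union> (\<lambda>y. x \<otimes> y) ` Y"
    define Y' where "Y' = {y\<in>Y. x \<otimes> y \<in> S}"
    have "Y' \<subset> Y" unfolding Y'_def using xd by auto
    then have lt: "card Y' < card Y" using fY psubset_card_mono by blast
    have 1: "\<one> \<in> Y'" unfolding Y'_def using less.prems xd by (auto simp: subset_iff)
    have "S' \<subseteq> carrier G" unfolding S'_def using less.prems xd Yc by auto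
    moreover have "S' \<noteq> {}" using xd S'_def by auto
    moreover have "Y' \<subseteq> H" using less.prems Y'_def by auto
    ultimately have IH: "min (card H) (card S' + card Y' - 1) \<le> card (S' <#> Y')"
      using less.hyps[OF lt] 1 by blast
    have "S' <#> Y' \<subseteq> S <#> Y"
    proof
      fix t assume "t \<in> S' <#> Y'"
      then obtain u v where uv: "u \<in> S'" "v \<in> Y'" "t = u \<otimes> v" unfolding set_mult_def by auto
      show "t \<in> S <#> Y"
      proof (cases "u \<in> S")
        case True
        then show ?thesis using uv unfolding set_mult_def Y'_def by auto
      next
        case False
        then obtain y where y: "y \<in> Y" "u = x \<otimes> y" using uv S'_def by auto
        have "t = (x \<otimes> v) \<otimes> y" using y uv xd less.prems Yc unfolding Y'_def
          by (metis (no_types, lifting) m_assoc m_comm mem_Collect_eq subsetD)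
        then show ?thesis using y uv unfolding set_mult_def Y'_def by auto
      qed
    qed
    then have le: "card (S' <#> Y') \<le> card (S <#> Y)" using fXY card_mono by blast
    have "card S' + card Y' = card S + card Y"
    proof -
      have "card S' + card (S \<inter> (\<lambda>y. x \<otimes> y) ` Y) = card S + card ((\<lambda>y. x \<otimes> y) ` Y)"
        unfolding S'_def using fX fY by (simp add: card_Un_Int[symmetric])
      moreover have "S \<inter> (\<lambda>y. x \<otimes> y) ` Y = (\<lambda>y. x \<otimes> y) ` Y'" unfolding Y'_def by auto
      moreover have "card ((\<lambda>y. x \<otimes> y) ` Y') = card Y'"
        using xd less.prems Yc Y'_def by (intro card_translate) auto
      moreover have "card ((\<lambda>y. x \<otimes> y) ` Y) = card Y"
        using xd less.prems Yc by (intro card_translate) auto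
      ultimately show ?thesis by simp
    qed
    then show ?thesis using IH le by simp
  next
    case False
    then have inv: "x \<otimes> d \<in> S" if "x \<in> S" "d \<in> Y" for x d using that by auto
    show ?thesis
    proof (cases "Y = {\<one>}")
      case True
      then show ?thesis using card_mono[OF fXY XXY] by simp
    next
      case F: False
      then obtain e where e: "e \<in> Y" "e \<noteq> \<one>" using less.prems by auto
      \<comment> \<open>The stabilizer of \<open>S\<close> in \<open>H\<close>. It contains
        \<open>e\<close>, so its order exceeds one and divides a prime.\<close>
      define J where "J = {d \<in> H. \<forall>x\<in>S. x \<otimes> d \<in> S}"
      have Jc: "J \<subseteq> carrier G" using J_def Hc by auto
      have fJ: "finite J" using Jc fin finite_subset by blast
      have J: "subgroup J G"
      proof (rule subgroupI)
        show "J \<subseteq> carrier G" by fact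
        show "J \<noteq> {}" using e inv less.prems J_def by auto
        fix d assume d: "d \<in> J"
        have dc: "d \<in> carrier G" using d Jc by auto
        have "(\<lambda>x. d \<otimes> x) ` S \<subseteq> S" using d less.prems dc unfolding J_def by (auto simp: m_comm subset_iff)
        moreover have "card ((\<lambda>x. d \<otimes> x) ` S) = card S" using card_translate dc less.prems by auto
        ultimately have eq: "(\<lambda>x. d \<otimes> x) ` S = S" using fX card_subset_eq by blast
        show "inv d \<in> J" unfolding J_def
        proof (intro CollectI conjI ballI)
          show "inv d \<in> H" using d J_def H subgroup.m_inv_closed by auto
          fix x assume "x \<in> S"
          then obtain y where y: "y \<in> S" "x = d \<otimes> y" using eq by auto
          have yc: "y \<in> carrier G" using y less.prems by auto
          have "x \<otimes> inv d = y" unfolding y using dc yc by (metis inv_closed m_assoc m_comm r_inv r_one)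
          then show "x \<otimes> inv d \<in> S" using y by simp
        qed
      next
        fix d e assume "d \<in> J" "e \<in> J"
        then show "d \<otimes> e \<in> J" using less.prems Hc H subgroup.m_closed unfolding J_def
          by (smt (verit, ccfv_SIG) m_assoc mem_Collect_eq subsetD)
      qed
      have "card J dvd card H" using subgroup_card_dvd[OF fin J H] J_def by auto
      moreover have "{\<one>, e} \<subseteq> J" using e inv less.prems unfolding J_def by auto
      then have "card {\<one>, e} \<le> card J" using fJ card_mono by blast
      then have "card J \<ge> 2" using e by simp
      ultimately have "card J = card H" using q by (metis One_nat_def Suc_1 not_less_eq_eq order_refl prime_nat_iff)
      then have JH: "J = H" using J_def by (intro card_subset_eq) (use fin Hc finite_subset in auto)
      obtain x where x: "x \<in> S" using less.prems by auto
      have "(\<lambda>d. x \<otimes> d) ` H \<subseteq> S" using x JH J_def by auto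
      then have "card H \<le> card S" using card_translate[of x H] x less.prems Hc fX
        by (metis card_mono subsetD)
      then show ?thesis using XXY fXY card_mono by (meson le_trans min.coboundedI1)
    qed
  qed
qed

text \<open>Dividing \<open>Y\<close> by one of its points puts it inside \<open>H\<close> with
  \<open>\<one>\<close> in it, and merely translates the product set.\<close>

lemma cauchy_davenport:
  assumes fin: "finite (carrier G)" and H: "subgroup H G" and q: "Factorial_Ring.prime (card H)"
    and S: "S \<subseteq> carrier G" "S \<noteq> {}" and v: "v \<in> carrier G" and Y: "Y \<subseteq> v <# H" "Y \<noteq> {}"
  shows "min (card H) (card S + card Y - 1) \<le> card (S <#> Y)"
proof -
  have Hc: "H \<subseteq> carrier G" using H subgroup.subset by blast
  have Yc: "Y \<subseteq> carrier G" using Y v Hc mem_coset by auto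
  obtain w where w: "w \<in> Y" using Y by auto
  have wc: "w \<in> carrier G" using w Yc by auto
  define Z where "Z = (\<lambda>y. inv w \<otimes> y) ` Y"
  have "Z \<subseteq> H"
  proof
    fix z assume "z \<in> Z"
    then obtain y where y: "y \<in> Y" "z = inv w \<otimes> y" using Z_def by auto
    have yc: "y \<in> carrier G" using y Yc by auto
    have "inv v \<otimes> y \<in> H" "inv v \<otimes> w \<in> H" using y w Y v Hc mem_coset by auto
    then have "inv (inv v \<otimes> w) \<otimes> (inv v \<otimes> y) \<in> H" using H by (simp add: subgroup_def)
    moreover have "inv (inv v \<otimes> w) \<otimes> (inv v \<otimes> y) = z" unfolding y
      using v wc yc by (metis inv_closed inv_mult_group inv_solve_left m_assoc m_closed inv_inv)
    ultimately show "z \<in> H" by simp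
  qed
  moreover have "\<one> \<in> Z" unfolding Z_def using w wc by (metis image_eqI l_inv)
  ultimately have "min (card H) (card S + card Z - 1) \<le> card (S <#> Z)"
    using cauchy_davenport_normalized[OF fin H q S] by blast
  moreover have "card Z = card Y" unfolding Z_def using card_translate wc Yc by auto
  moreover have "S <#> Z = (\<lambda>t. inv w \<otimes> t) ` (S <#> Y)"
  proof -
    have "x \<otimes> (inv w \<otimes> y) = inv w \<otimes> (x \<otimes> y)" if "x \<in> S" "y \<in> Y" for x y
      using that S Yc wc m_lcomm by (metis inv_closed subsetD)
    then show ?thesis unfolding Z_def set_mult_def by (force simp: image_iff)
  qed
  moreover have "S <#> Y \<subseteq> carrier G" using S Yc set_mult_closed by blast
  ultimately show ?thesis using card_translate[of "inv w" "S <#> Y"] wc by auto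
qed


subsection \<open>Sums of elements of one coset\<close>

lemma coset_subset: "v \<in> carrier G \<Longrightarrow> H \<subseteq> carrier G \<Longrightarrow> v <# H \<subseteq> carrier G"
  by (auto simp: mem_coset)

lemma coset_elem: "k \<in> H \<Longrightarrow> v \<otimes> k \<in> v <# H"
  unfolding l_coset_def by auto

lemma coset_mult:
  assumes "subgroup H G" "v \<in> carrier G" "w \<in> carrier G" "x \<in> v <# H" "y \<in> w <# H"
  shows "x \<otimes> y \<in> (v \<otimes> w) <# H"
proof -
  have Hc: "H \<subseteq> carrier G" using assms(1) subgroup.subset by blast
  obtain k l where k: "k \<in> H" "x = v \<otimes> k" "l \<in> H" "y = w \<otimes> l" using assms unfolding l_coset_def by auto
  have "x \<otimes> y = (v \<otimes> w) \<otimes> (k \<otimes> l)" unfolding k using k assms Hc by (simp add: m_ac subset_iff)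
  then show ?thesis using k assms(1) subgroup.m_closed[OF assms(1)] coset_elem by auto
qed

lemma coset_div:
  assumes "subgroup H G" "v \<in> carrier G" "w \<in> carrier G" "x \<in> (v \<otimes> w) <# H" "y \<in> w <# H"
  shows "x \<otimes> inv y \<in> v <# H"
proof -
  have Hc: "H \<subseteq> carrier G" using assms(1) subgroup.subset by blast
  obtain k l where k: "k \<in> H" "x = (v \<otimes> w) \<otimes> k" "l \<in> H" "y = w \<otimes> l"
    using assms unfolding l_coset_def by auto
  have c: "k \<in> carrier G" "l \<in> carrier G" using k Hc by auto
  have "x \<otimes> inv y = v \<otimes> (k \<otimes> inv l)" unfolding k using c assms(2,3) by (simp add: m_ac inv_mult)
  moreover have "k \<otimes> inv l \<in> H" using k assms(1) by (simp add: subgroup_def)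
  ultimately show ?thesis using coset_elem by auto
qed

lemma coset_one: "subgroup H G \<Longrightarrow> \<one> <# H = H"
proof -
  assume "subgroup H G"
  then have "H \<subseteq> carrier G" by (rule subgroup.subset)
  then show ?thesis by (auto simp: mem_coset subset_iff)
qed

lemma coset_diff:
  assumes "subgroup H G" "v \<in> carrier G" "x \<in> v <# H" "y \<in> v <# H"
  shows "x \<otimes> inv y \<in> H"
proof -
  have "x \<otimes> inv y \<in> \<one> <# H" using coset_div[of H \<one> v x y] assms by simp
  then show ?thesis using coset_one assms(1) by simp
qed

lemma coset_self: "subgroup H G \<Longrightarrow> v \<in> carrier G \<Longrightarrow> v \<in> v <# H"
  using coset_elem[of \<one> H v] subgroup.one_closed by fastforce

lemma coset_absorb: "subgroup H G \<Longrightarrow> v \<in> H \<Longrightarrow> v <# H = H"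
proof -
  assume H: "subgroup H G" "v \<in> H"
  have "x \<in> v <# H \<longleftrightarrow> x \<in> H" for x
  proof
    assume "x \<in> v <# H" then show "x \<in> H" using H by (auto simp: l_coset_def subgroup_def)
  next
    assume x: "x \<in> H"
    have "x = v \<otimes> (inv v \<otimes> x)" using x H subgroup.subset by (metis inv_mult_cancel(2) subsetD)
    moreover have "inv v \<otimes> x \<in> H" using x H by (simp add: subgroup_def)
    ultimately show "x \<in> v <# H" using coset_elem by metis
  qed
  then show ?thesis by auto
qed

lemma coset_eq:
  assumes "subgroup H G" "v \<in> carrier G" "w \<in> v <# H"
  shows "w <# H = v <# H"
proof -
  have Hc: "H \<subseteq> carrier G" using assms(1) subgroup.subset by blast
  obtain k where k: "k \<in> H" "w = v \<otimes> k" using assms unfolding l_coset_def by auto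
  have "w <# H = v <# (k <# H)" unfolding k using k Hc assms by (simp add: lcos_m_assoc subset_iff)
  then show ?thesis using coset_absorb[OF assms(1)] k by simp
qed

lemma finprod_coset:
  assumes "subgroup H G" "v \<in> carrier G"
  shows "finite B \<Longrightarrow> B \<subseteq> v <# H \<Longrightarrow> finprod G (\<lambda>x. x) B \<in> (v [^] card B) <# H"
proof (induction B rule: finite_induct)
  case empty
  then show ?case using coset_one[OF assms(1)] assms(1) subgroup.one_closed by fastforce
next
  case (insert x F)
  have Hc: "H \<subseteq> carrier G" using assms(1) subgroup.subset by blast
  have xF: "x \<in> carrier G" "F \<subseteq> carrier G" using insert.prems coset_subset[OF assms(2) Hc] by auto
  have "finprod G (\<lambda>x. x) (insert x F) = finprod G (\<lambda>x. x) F \<otimes> x"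
    using insert xF by (subst finprod_insert) (auto simp: m_comm)
  moreover have "finprod G (\<lambda>x. x) F \<otimes> x \<in> (v [^] card F \<otimes> v) <# H"
    using insert assms by (intro coset_mult) auto
  ultimately show ?case using insert by simp
qed

lemma rsums_coset:
  assumes "subgroup H G" "v \<in> carrier G" "finite S" "S \<subseteq> v <# H"
  shows "rsums j S \<subseteq> (v [^] j) <# H"
proof
  fix t assume "t \<in> rsums j S"
  then obtain B where B: "B \<subseteq> S" "card B = j" "t = finprod G (\<lambda>x. x) B" unfolding rsums_def by auto
  then have "finite B" "B \<subseteq> v <# H" using assms finite_subset by auto
  then show "t \<in> (v [^] j) <# H" using finprod_coset[OF assms(1,2)] B by auto
qed

lemma subset_sums_subgroup:
  assumes "subgroup H G" "finite S" "S \<subseteq> H"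
  shows "subset_sums G S \<subseteq> H"
proof -
  have "finprod G (\<lambda>x. x) B \<in> H" if "B \<subseteq> S" for B
  proof -
    have "finprod G (\<lambda>x. x) B \<in> (\<one> [^] card B) <# H"
      using that assms coset_one by (intro finprod_coset) (auto intro: finite_subset)
    then show ?thesis using coset_one assms by simp
  qed
  then show ?thesis unfolding subset_sums_def by auto
qed

text \<open>Keep one element \<open>x\<close> in every sum and pass to \<open>S - {x}\<close>: the
  difference \<open>card S - j\<close> stays the same.\<close>

lemma rsums_lower:
  assumes "finite S" "S \<subseteq> carrier G" "1 \<le> j" "j \<le> card S"
  shows "card S + 1 \<le> card (rsums j S) + j"
  using assms(3,1,2,4)
proof (induction j arbitrary: S rule: dec_induct)
  case base
  then show ?case using rsums_1[of S] by simp
next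
  case (step j)
  then obtain x where x: "x \<in> S" by fastforce
  have "card (S - {x}) + 1 \<le> card (rsums j (S - {x})) + j"
    by (rule step.IH) (use step x in auto)
  moreover have "(\<lambda>y. x \<otimes> y) ` rsums j (S - {x}) \<subseteq> rsums (Suc j) S"
    using rsums_step x step by auto
  then have "card ((\<lambda>y. x \<otimes> y) ` rsums j (S - {x})) \<le> card (rsums (Suc j) S)"
    using card_mono finite_rsums step by metis
  moreover have "card ((\<lambda>y. x \<otimes> y) ` rsums j (S - {x})) = card (rsums j (S - {x}))"
    using x step rsums_carrier[of "S - {x}" j] by (intro card_translate) auto
  ultimately show ?case using x step by simp
qed

text \<open>The reflection \<open>x \<mapsto> s - x\<close> preserves the coset, and the only points of \<open>S\<close> it may send into \<open>S\<close> are its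
  fixed points.\<close>

lemma square_fibre_bound:
  assumes K: "subgroup K G" "finite K" and v: "v \<in> carrier G" and S: "finite S" "S \<subseteq> v <# K"
    and s: "s \<in> (v \<otimes> v) <# K" "s \<notin> rsums 2 S"
  shows "2 * card S \<le> card K + card {x \<in> S. x \<otimes> x = s}"
proof -
  have Kc: "K \<subseteq> carrier G" using K subgroup.subset by blast
  have sc: "s \<in> carrier G" using s v Kc coset_subset by blast
  have Sc: "S \<subseteq> carrier G" using S v Kc coset_subset by blast
  define R where "R = (\<lambda>x. s \<otimes> inv x) ` S"
  have R: "R \<subseteq> v <# K" unfolding R_def using coset_div[OF K(1) v v s(1)] S by auto
  have "inj_on (\<lambda>x. s \<otimes> inv x) S"
    using Sc sc by (intro inj_onI) (metis inv_closed inv_inv l_cancel subsetD)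
  then have cR: "card R = card S" unfolding R_def by (rule card_image)
  have fK: "finite (v <# K)" unfolding l_coset_def using K by auto
  have "card (S \<union> R) \<le> card (v <# K)" using fK S R by (intro card_mono) auto
  then have "card (S \<union> R) \<le> card K" using coset_card[OF v Kc] by simp
  moreover have "card S + card R = card (S \<union> R) + card (S \<inter> R)"
    using S R_def by (intro card_Un_Int) auto
  moreover have "S \<inter> R \<subseteq> {x \<in> S. x \<otimes> x = s}"
  proof
    fix x assume x: "x \<in> S \<inter> R"
    then obtain y where y: "y \<in> S" "x = s \<otimes> inv y" using R_def by auto
    have xyc: "x \<in> carrier G" "y \<in> carrier G" using x y Sc by auto
    have sxy: "s = x \<otimes> y" unfolding y using sc xyc by (simp add: m_assoc)
    have "x = y"
    proof (rule ccontr)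
      assume "x \<noteq> y"
      then have "y \<in> rsums 1 (S - {x})" using rsums_1[of "S - {x}"] Sc y(1) by (metis Diff_iff singletonD Diff_subset subset_trans)
      then have "s \<in> rsums (Suc 1) S" using rsums_step[OF Sc S(1), of x y 1] x sxy by auto
      then show False using s by (simp add: numeral_2_eq_2)
    qed
    then show "x \<in> {x \<in> S. x \<otimes> x = s}" using sxy x by auto
  qed
  then have "card (S \<inter> R) \<le> card {x \<in> S. x \<otimes> x = s}" using S by (intro card_mono) auto
  ultimately show ?thesis using cR by linarith
qed

lemma square_fibre_sum:
  assumes "finite S" "finite Q"
  shows "(\<Sum>s\<in>Q. card {x \<in> S. x \<otimes> x = s}) \<le> card S"
proof -
  have "(\<Sum>s\<in>Q. card {x \<in> S. x \<otimes> x = s}) = card (\<Union>s\<in>Q. {x \<in> S. x \<otimes> x = s})"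
    using assms by (intro card_UN_disjoint[symmetric]) auto
  also have "\<dots> \<le> card S" using assms by (intro card_mono) auto
  finally show ?thesis .
qed

text \<open>If \<open>t\<close> is missed, then so is \<open>t - z\<close> as a sum of two elements other than \<open>z\<close>, for each of the \<open>card S\<close> choices
  of \<open>z\<close>; the resulting fibres of \<open>x \<mapsto> 2x\<close> are disjoint and together too large for \<open>S\<close>.\<close>

lemma rsums_3_full:
  assumes K: "subgroup K G" "finite K" and v: "v \<in> carrier G" and S: "finite S" "S \<subseteq> v <# K"
    and a: "card K + 4 \<le> 2 * card S" and t: "t \<in> (v \<otimes> v \<otimes> v) <# K"
  shows "t \<in> rsums 3 S"
proof (rule ccontr)
  assume n: "t \<notin> rsums 3 S"
  have Kc: "K \<subseteq> carrier G" using K subgroup.subset by blast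
  have tc: "t \<in> carrier G" using t v Kc coset_subset[of "v \<otimes> v \<otimes> v" K] by auto
  have Sc: "S \<subseteq> carrier G" using S v Kc coset_subset by blast
  \<comment> \<open>Removing \<open>z\<close> costs 2 in \<open>square_fibre_bound\<close>; of the 4
    in the hypothesis, 2 remain for the fibre at each of \<open>card S\<close> points, against a
    total of at most \<open>card S\<close>.\<close>
  have 2: "2 \<le> card {x \<in> S. x \<otimes> x = t \<otimes> inv z}" if z: "z \<in> S" for z
  proof -
    have zc: "z \<in> carrier G" using z Sc by auto
    have "t = z \<otimes> (t \<otimes> inv z)" using zc tc by (simp add: m_lcomm)
    then have "t \<otimes> inv z \<notin> rsums 2 (S - {z})" using rsums_step[OF Sc S(1) z, of "t \<otimes> inv z" 2] n by auto
    moreover have "t \<otimes> inv z \<in> (v \<otimes> v) <# K" using coset_div[OF K(1) _ v t] z S v by auto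
    ultimately have "2 * card (S - {z}) \<le> card K + card {x \<in> S - {z}. x \<otimes> x = t \<otimes> inv z}"
      using S by (intro square_fibre_bound[OF K v]) auto
    also have "card {x \<in> S - {z}. x \<otimes> x = t \<otimes> inv z} \<le> card {x \<in> S. x \<otimes> x = t \<otimes> inv z}"
      using S by (intro card_mono) auto
    finally show ?thesis using a z S by simp
  qed
  have inj: "inj_on (\<lambda>z. t \<otimes> inv z) S"
    using Sc tc by (intro inj_onI) (metis inv_closed inv_inv l_cancel subsetD)
  have "2 * card S \<le> (\<Sum>z\<in>S. card {x \<in> S. x \<otimes> x = t \<otimes> inv z})"
    using sum_mono[of S "\<lambda>_. 2", OF 2] by (simp add: mult.commute)
  also have "\<dots> = (\<Sum>s\<in>(\<lambda>z. t \<otimes> inv z) ` S. card {x \<in> S. x \<otimes> x = s})"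
    using inj by (simp add: sum.reindex)
  also have "\<dots> \<le> card S" using S by (intro square_fibre_sum) auto
  finally have "card S = 0" by simp
  then show False using a by simp
qed

text \<open>If \<open>t\<close> is missed, its own fibre under squaring has at least
  \<open>2 * card S - card K\<close> points, and dividing \<open>t\<close> by any two-element sum
  gives another point with a nonempty fibre. These disjoint fibres are together too large for
  \<open>S\<close>.\<close>

lemma rsums_2_4_full:
  assumes K: "subgroup K G" "finite K" and v: "v \<in> carrier G" and S: "finite S" "S \<subseteq> v <# K"
    and vv: "v \<otimes> v \<in> K" and a: "card K \<le> card S + 2" "9 \<le> card K" and t: "t \<in> K"
  shows "t \<in> rsums 2 S \<union> rsums 4 S"
proof (rule ccontr)
  assume n: "t \<notin> rsums 2 S \<union> rsums 4 S"
  have Kc: "K \<subseteq> carrier G" using K subgroup.subset by blast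
  have tc: "t \<in> carrier G" using t Kc by auto
  have Sc: "S \<subseteq> carrier G" using S v Kc coset_subset by blast
  have vvK: "(v \<otimes> v) <# K = K" using coset_absorb[OF K(1) vv] .
  have R2: "rsums 2 S \<subseteq> K" using rsums_coset[OF K(1) v S, of 2] v vvK by (simp add: numeral_2_eq_2)
  \<comment> \<open>Leaving out \<open>\<one>\<close> keeps the points
    \<open>t \<otimes> inv u\<close> distinct from \<open>t\<close>, whose larger fibre is counted
    separately.\<close>
  define U where "U = rsums 2 S - {\<one>}"
  have f2: "finite (rsums 2 S)" using S finite_rsums by auto
  have "card S + 1 \<le> card (rsums 2 S) + 2" using rsums_lower[OF S(1) Sc, of 2] a by simp
  moreover have "card (rsums 2 S) \<le> card U + 1" unfolding U_def using f2
    by (simp add: card_Diff_singleton_if) linarith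
  ultimately have cU: "card S \<le> card U + 2" by linarith
  have Uc: "U \<subseteq> carrier G" using U_def R2 Kc by auto
  \<comment> \<open>After two removals the bound leaves \<open>2 * card S - 4 - card K\<close>, at
    least \<open>card S - 6\<close>. This is positive because \<open>9 \<le> card K\<close> makes
    \<open>card S\<close> at least 7.\<close>
  have 1: "1 \<le> card {x \<in> S. x \<otimes> x = t \<otimes> inv u}" if u: "u \<in> U" for u
  proof -
    obtain B where B: "B \<subseteq> S" "card B = 2" "u = finprod G (\<lambda>x. x) B"
      using u unfolding U_def rsums_def by auto
    obtain z w where zw: "B = {z,w}" "z \<noteq> w" using B by (meson card_2_iff)
    have zwc: "z \<in> carrier G" "w \<in> carrier G" "z \<in> S" "w \<in> S" using zw B Sc by auto
    have uu: "u = z \<otimes> w" unfolding B zw using zw zwc by (subst finprod_insert) auto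
    have "t = z \<otimes> (w \<otimes> (t \<otimes> inv u))" unfolding uu using zwc tc by (simp add: m_ac inv_mult)
    then have "t \<otimes> inv u \<notin> rsums 2 (S - {z} - {w})"
      using rsums_step[of "S - {z}" w "t \<otimes> inv u" 2] rsums_step[OF Sc S(1), of z "w \<otimes> (t \<otimes> inv u)" 3] Sc S zwc zw n
      by (auto simp: numeral_eq_Suc)
    moreover have "t \<otimes> inv u \<in> K" using t u R2 U_def K by (auto simp: subgroup_def)
    ultimately have "2 * card (S - {z} - {w}) \<le> card K + card {x \<in> S - {z} - {w}. x \<otimes> x = t \<otimes> inv u}"
      using S vvK by (intro square_fibre_bound[OF K v]) auto
    also have "card {x \<in> S - {z} - {w}. x \<otimes> x = t \<otimes> inv u} \<le> card {x \<in> S. x \<otimes> x = t \<otimes> inv u}"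
      using S by (intro card_mono) auto
    finally show ?thesis using a S zwc zw by (simp add: card_Diff_singleton)
  qed
  have 2: "2 * card S \<le> card K + card {x \<in> S. x \<otimes> x = t}"
    using S t vvK n by (intro square_fibre_bound[OF K v]) auto
  have inj: "inj_on (\<lambda>z. t \<otimes> inv z) U"
    using Uc tc by (intro inj_onI) (metis inv_closed inv_inv l_cancel subsetD)
  have tn: "t \<notin> (\<lambda>u. t \<otimes> inv u) ` U"
  proof
    assume "t \<in> (\<lambda>u. t \<otimes> inv u) ` U"
    then obtain u where u: "u \<in> U" "t = t \<otimes> inv u" by auto
    have uc: "u \<in> carrier G" using u Uc by auto
    have "t \<otimes> inv u = t \<otimes> \<one>" using u tc by simp
    then have "inv u = \<one>" using tc uc by (metis inv_closed l_cancel one_closed)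
    then have "u = \<one>" using uc by (metis inv_inv inv_one)
    then show False using u U_def by auto
  qed
  have "card U \<le> (\<Sum>u\<in>U. card {x \<in> S. x \<otimes> x = t \<otimes> inv u})"
    using sum_mono[of U "\<lambda>_. 1", OF 1] by simp
  also have "\<dots> = (\<Sum>s\<in>(\<lambda>u. t \<otimes> inv u) ` U. card {x \<in> S. x \<otimes> x = s})"
    using inj by (simp add: sum.reindex)
  finally have "card U + card {x \<in> S. x \<otimes> x = t} \<le> (\<Sum>s\<in>insert t ((\<lambda>u. t \<otimes> inv u) ` U). card {x \<in> S. x \<otimes> x = s})"
    using tn f2 U_def by (subst sum.insert) auto
  also have "\<dots> \<le> card S" using S f2 U_def by (intro square_fibre_sum) auto
  finally show False using 2 cU a by linarith
qed

lemma square_one_odd: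
  assumes "finite (carrier G)" "subgroup H G" "odd (card H)" "d \<in> H" "d \<otimes> d = \<one>"
  shows "d = \<one>"
proof (rule ccontr)
  assume d: "d \<noteq> \<one>"
  have dc: "d \<in> carrier G" using assms(2,4) subgroup.subset by blast
  have "inv d = d" using dc assms(5) by (metis inv_equality)
  then have "subgroup {\<one>, d} G" using dc assms(5) by (intro subgroupI) auto
  then have "card {\<one>, d} dvd card H" using assms by (intro subgroup_card_dvd) (auto simp: subgroup_def)
  then have "2 dvd card H" using d by (simp add: numeral_2_eq_2)
  then show False using assms(3) by simp
qed

lemma square_inj_odd:
  assumes "finite (carrier G)" "subgroup H G" "odd (card H)" "v \<in> carrier G" "x \<in> v <# H" "y \<in> v <# H" "x \<otimes> x = y \<otimes> y"
  shows "x = y"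
proof -
  have c: "x \<in> carrier G" "y \<in> carrier G"
    using assms(5,6) coset_subset[OF assms(4) subgroup.subset[OF assms(2)]] by auto
  have "(x \<otimes> inv y) \<otimes> (x \<otimes> inv y) = (x \<otimes> x) \<otimes> inv (y \<otimes> y)" using c by (simp add: m_ac inv_mult)
  also have "\<dots> = \<one>" using assms(7) c by simp
  finally have "x \<otimes> inv y = \<one>"
    using square_one_odd[OF assms(1-3)] coset_diff[OF assms(2,4,5,6)] by simp
  then show ?thesis using c by (metis inv_closed inv_equality inv_inv)
qed

text \<open>For odd order, squaring is injective on a coset, so the fibre in
  \<open>square_fibre_bound\<close> has at most one point.\<close>

lemma rsums_2_full_odd:
  assumes fin: "finite (carrier G)" and H: "subgroup H G" "odd (card H)" and v: "v \<in> carrier G"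
    and S: "S \<subseteq> v <# H" "card H + 2 \<le> 2 * card S" and t: "t \<in> (v \<otimes> v) <# H"
  shows "t \<in> rsums 2 S"
proof (rule ccontr)
  assume n: "t \<notin> rsums 2 S"
  have Hc: "H \<subseteq> carrier G" using H subgroup.subset by blast
  have fH: "finite H" using fin Hc finite_subset by blast
  have fS: "finite S" using S coset_subset[OF v Hc] fin finite_subset by (meson subset_trans)
  have "2 * card S \<le> card H + card {x \<in> S. x \<otimes> x = t}"
    using square_fibre_bound[OF H(1) fH v fS S(1) t n] .
  moreover have "card {x \<in> S. x \<otimes> x = t} \<le> Suc 0"
    using fS square_inj_odd[OF fin H v] S by (subst card_le_Suc0_iff_eq) auto
  ultimately show False using S by linarith
qed

text \<open>With at least two summands, deleting \<open>\<one>\<close> leaves a nonempty sum of the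
  same value. So a set without \<open>\<one>\<close> may be enlarged by it before a size condition
  is tested.\<close>

lemma rsums_insert_one:
  assumes "finite S" "S \<subseteq> carrier G" "2 \<le> j"
  shows "rsums j (insert \<one> S) \<subseteq> subset_sums G S"
proof
  fix t assume "t \<in> rsums j (insert \<one> S)"
  then obtain B where B: "B \<subseteq> insert \<one> S" "card B = j" "t = finprod G (\<lambda>x. x) B"
    unfolding rsums_def by auto
  have fB: "finite B" using B assms finite_subset by (metis finite_insert)
  have Bc: "B \<subseteq> carrier G" using B assms by auto
  have "card (B - {\<one>}) \<ge> 1" using B assms fB
    by (metis card_Diff_singleton_if diff_le_mono numeral_2_eq_2 One_nat_def diff_Suc_1 le_trans one_le_numeral)
  then have ne: "B - {\<one>} \<noteq> {}" by (metis card.empty not_one_le_zero)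
  have "finprod G (\<lambda>x. x) (B - {\<one>}) = t"
  proof (cases "\<one> \<in> B")
    case True
    then have "B = insert \<one> (B - {\<one>})" by auto
    then have "t = \<one> \<otimes> finprod G (\<lambda>x. x) (B - {\<one>})"
      unfolding B using fB Bc by (metis (no_types, lifting) Diff_iff Pi_I finite_Diff finprod_insert insertI1 one_closed subsetD)
    also have "\<dots> = finprod G (\<lambda>x. x) (B - {\<one>})" using Bc by (intro l_one finprod_id_closed) auto
    finally show ?thesis by simp
  next
    case False
    then show ?thesis using B by simp
  qed
  moreover have "B - {\<one>} \<subseteq> S" using B by auto
  ultimately show "t \<in> subset_sums G S" using ne unfolding subset_sums_def by blast
qed

text \<open>Adding \<open>\<one>\<close> gains one element. For odd order two-element sums then
  suffice; for even order parity sharpens the size hypothesis enough for three-element sums.\<close>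

lemma subset_sums_full:
  assumes fin: "finite (carrier G)" and H: "subgroup H G" and S: "S \<subseteq> H - {\<one>}" "card H < 2 * card S"
  shows "subset_sums G S = H"
proof
  have Hc: "H \<subseteq> carrier G" using H subgroup.subset by blast
  have fH: "finite H" using fin Hc finite_subset by blast
  have fS: "finite S" using S fH finite_subset by blast
  show "subset_sums G S \<subseteq> H" using S by (intro subset_sums_subgroup[OF H fS]) auto
  have W: "insert \<one> S \<subseteq> \<one> <# H" using S coset_one[OF H] H subgroup.one_closed by auto
  have "\<one> \<notin> S" using S by auto
  then have cW: "card (insert \<one> S) = card S + 1" using fS by simp
  have "t \<in> rsums 2 (insert \<one> S) \<union> rsums 3 (insert \<one> S)" if t: "t \<in> H" for t
  proof (cases "odd (card H)")
    case True
    then have "card H + 2 \<le> 2 * card (insert \<one> S)" using cW S by presburger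
    moreover have "t \<in> (\<one> \<otimes> \<one>) <# H" using t coset_one[OF H] by simp
    ultimately show ?thesis using rsums_2_full_odd[OF fin H True one_closed W] by blast
  next
    case False
    then have "card H + 4 \<le> 2 * card (insert \<one> S)" using cW S by presburger
    moreover have "t \<in> (\<one> \<otimes> \<one> \<otimes> \<one>) <# H" using t coset_one[OF H] by simp
    moreover have "finite (insert \<one> S)" using fS by simp
    ultimately show ?thesis using rsums_3_full[OF H fH one_closed _ W] by blast
  qed
  moreover have "rsums 2 (insert \<one> S) \<union> rsums 3 (insert \<one> S) \<subseteq> subset_sums G S"
    using S Hc by (intro Un_least rsums_insert_one[OF fS]) auto
  ultimately show "H \<subseteq> subset_sums G S" by blast
qed


subsection \<open>Groups of even order\<close>

lemma subgroup_adjoin: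
  assumes K: "subgroup K G" and v: "v \<in> carrier G" "v \<otimes> v \<in> K"
  shows "subgroup (K \<union> (v <# K)) G"
proof (rule subgroupI)
  have Kc: "K \<subseteq> carrier G" using K subgroup.subset by blast
  have vv: "(v \<otimes> v) <# K = K" using coset_absorb[OF K v(2)] .
  show "K \<union> (v <# K) \<subseteq> carrier G" using Kc coset_subset[OF v(1) Kc] by auto
  show "K \<union> (v <# K) \<noteq> {}" using subgroup.one_closed[OF K] by auto
  fix a assume a: "a \<in> K \<union> (v <# K)"
  then show "inv a \<in> K \<union> (v <# K)"
  proof
    assume "a \<in> K" then show ?thesis using subgroup.m_inv_closed[OF K] by auto
  next
    assume a: "a \<in> v <# K"
    have "\<one> \<in> (v \<otimes> v) <# K" using vv subgroup.one_closed[OF K] by simp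
    then have "\<one> \<otimes> inv a \<in> v <# K" using coset_div[OF K v(1) v(1) _ a] by blast
    moreover have "a \<in> carrier G" using a coset_subset[OF v(1) Kc] by auto
    ultimately show ?thesis by simp
  qed
  fix b assume b: "b \<in> K \<union> (v <# K)"
  have K1: "\<one> <# K = K" using coset_one[OF K] .
  show "a \<otimes> b \<in> K \<union> (v <# K)"
    using a b coset_mult[OF K v(1) one_closed, of a b] coset_mult[OF K one_closed v(1), of a b]
      coset_mult[OF K v(1) v(1), of a b] subgroup.m_closed[OF K, of a b]
    unfolding K1 vv using v by auto
qed

lemma coset_disjoint:
  assumes K: "subgroup K G" and v: "v \<in> carrier G" "v \<notin> K"
  shows "K \<inter> (v <# K) = {}"
proof (rule ccontr)
  assume "K \<inter> (v <# K) \<noteq> {}"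
  then obtain k where k: "k \<in> K" "k \<in> v <# K" by auto
  then have "k <# K = v <# K" "k <# K = K" using coset_eq[OF K v(1)] coset_absorb[OF K] by auto
  then show False using coset_self[OF K v(1)] v by simp
qed

lemma coset_union_full:
  assumes K: "subgroup K G" and H: "subgroup H G" "finite H" "K \<subseteq> H" and v: "v \<in> H" "v \<notin> K"
    and c: "card H = 2 * card K"
  shows "H = K \<union> (v <# K)"
proof (rule card_subset_eq[symmetric])
  have vc: "v \<in> carrier G" using v H subgroup.subset by blast
  have Kc: "K \<subseteq> carrier G" using K subgroup.subset by blast
  show "K \<union> (v <# K) \<subseteq> H" using H v subgroup.m_closed[OF H(1)] by (auto simp: l_coset_def)
  have "finite K" "finite (v <# K)" using H finite_subset by (auto simp: l_coset_def)
  then have "card (K \<union> (v <# K)) = card K + card (v <# K)"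
    using coset_disjoint[OF K vc v(2)] by (intro card_Un_disjoint) auto
  then show "card (K \<union> (v <# K)) = card H" using c coset_card[OF vc Kc] by simp
qed (use H in auto)

lemma sylow_prime_subgroup:
  assumes "finite (carrier G)" "Factorial_Ring.prime p" "p dvd order G"
  shows "\<exists>H. subgroup H G \<and> card H = p"
proof -
  obtain m where "order G = p ^ 1 * m" using assms by auto
  then show ?thesis using sylow_thm[OF assms(2) is_group _ assms(1), of 1] by auto
qed

text \<open>The squares form a proper subgroup. Let \<open>M\<close> be a largest proper subgroup
  containing them: adjoining any outside \<open>x\<close> doubles \<open>M\<close>, since
  \<open>x \<otimes> x\<close> lies in \<open>M\<close>, and so gives the whole group.\<close>

lemma index_two_subgroup:
  assumes fin: "finite (carrier G)" and ev: "even (order G)"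
  shows "\<exists>H. subgroup H G \<and> order G = 2 * card H"
proof -
  define Q where "Q = (\<lambda>x. x \<otimes> x) ` carrier G"
  define F where "F = {M. subgroup M G \<and> Q \<subseteq> M \<and> M \<noteq> carrier G}"
  have "subgroup Q G"
  proof (rule subgroupI)
    show "Q \<subseteq> carrier G" "Q \<noteq> {}" unfolding Q_def by auto
    fix a assume "a \<in> Q"
    then obtain x where x: "x \<in> carrier G" "a = x \<otimes> x" unfolding Q_def by auto
    have "inv a = inv x \<otimes> inv x" using x by (simp add: inv_mult)
    then show "inv a \<in> Q" using x unfolding Q_def by auto
    fix b assume "b \<in> Q"
    then obtain y where y: "y \<in> carrier G" "b = y \<otimes> y" unfolding Q_def by auto
    have "a \<otimes> b = (x \<otimes> y) \<otimes> (x \<otimes> y)" using x y by (simp add: m_ac)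
    then show "a \<otimes> b \<in> Q" using x y unfolding Q_def by auto
  qed
  \<comment> \<open>An element of order two shows that squaring is not injective, hence on a finite
    group not onto.\<close>
  moreover have "Q \<noteq> carrier G"
  proof
    assume "Q = carrier G"
    then have inj: "inj_on (\<lambda>x. x \<otimes> x) (carrier G)" using fin eq_card_imp_inj_on unfolding Q_def by metis
    obtain J where J: "subgroup J G" "card J = 2" using sylow_prime_subgroup[OF fin two_is_prime_nat] ev by auto
    have "\<one> \<in> J" using J subgroup.one_closed by auto
    then obtain d where d: "J = {\<one>, d}" "d \<noteq> \<one>" using J(2)
      by (metis card_2_iff doubleton_eq_iff insertE singletonD)
    have dc: "d \<in> carrier G" using d J subgroup.subset by blast
    have "d \<otimes> d \<in> J" using J d subgroup.m_closed by (metis insertCI)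
    then have "d \<otimes> d = \<one>" using d dc by (metis insertE l_cancel_one' singletonD)
    then have "d \<otimes> d = \<one> \<otimes> \<one>" by simp
    then have "d = \<one>" using inj_onD[OF inj, of d \<one>] dc by simp
    then show False using d by simp
  qed
  ultimately have "Q \<in> F" unfolding F_def by auto
  moreover have finF: "finite F"
    by (rule finite_subset[of _ "Pow (carrier G)"]) (use fin subgroup.subset F_def in auto)
  ultimately have "Max (card ` F) \<in> card ` F" by (intro Max_in) auto
  then obtain M where M0: "M \<in> F" "card M = Max (card ` F)" by auto
  then have M: "M \<in> F" "\<And>N. N \<in> F \<Longrightarrow> card N \<le> card M" using finF by auto
  have Ms: "subgroup M G" "Q \<subseteq> M" "M \<noteq> carrier G" using M F_def by auto
  have Mc: "M \<subseteq> carrier G" using Ms subgroup.subset by blast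
  then obtain x where x: "x \<in> carrier G" "x \<notin> M" using Ms by auto
  have fM: "finite M" "finite (x <# M)" using Mc fin coset_subset[OF x(1) Mc] finite_subset by auto
  let ?N = "M \<union> (x <# M)"
  have cN: "card ?N = 2 * card M"
    using card_Un_disjoint[OF fM coset_disjoint[OF Ms(1) x]] coset_card[OF x(1) Mc] by simp
  have "card M > 0" using fM Ms subgroup.one_closed card_gt_0_iff by blast
  then have "?N \<notin> F" using M(2)[of ?N] cN by linarith
  moreover have "x \<otimes> x \<in> M" using Ms x Q_def by auto
  then have "subgroup ?N G" using subgroup_adjoin[OF Ms(1) x(1)] by blast
  ultimately have "?N = carrier G" using Ms unfolding F_def by auto
  then show ?thesis using cN Ms unfolding order_def by metis
qed

section \<open>Difference sets and the subgroups they form\<close>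

definition diffs :: "'a set \<Rightarrow> 'a set" where
  "diffs S = (\<lambda>(x,y). x \<otimes> inv y) ` (S \<times> S)"

lemma diffs_carrier: "S \<subseteq> carrier G \<Longrightarrow> diffs S \<subseteq> carrier G"
  unfolding diffs_def by auto

lemma diffs_one: "S \<subseteq> carrier G \<Longrightarrow> S \<noteq> {} \<Longrightarrow> \<one> \<in> diffs S"
proof -
  assume S: "S \<subseteq> carrier G" "S \<noteq> {}"
  then obtain x where x: "x \<in> S" by auto
  have "x \<otimes> inv x = \<one>" using x S by auto
  then show ?thesis unfolding diffs_def using x by force
qed

lemma diffs_inv: "S \<subseteq> carrier G \<Longrightarrow> d \<in> diffs S \<Longrightarrow> inv d \<in> diffs S"
proof -
  assume S: "S \<subseteq> carrier G" "d \<in> diffs S"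
  then obtain x y where x: "x \<in> S" "y \<in> S" "d = x \<otimes> inv y" unfolding diffs_def by auto
  have "x \<in> carrier G" "y \<in> carrier G" using x S by auto
  then have "inv d = y \<otimes> inv x" using x by (simp add: inv_mult m_comm)
  then show ?thesis unfolding diffs_def using x by force
qed

text \<open>Two differences with more than \<open>card S / 2\<close> representations each have representations that can be
  composed.\<close>

lemma diffs_subgroup:
  assumes S: "S \<subseteq> carrier G" "finite S" "S \<noteq> {}"
    and r: "\<And>d. d \<in> diffs S \<Longrightarrow> r \<le> card (S \<inter> (\<lambda>x. d \<otimes> x) ` S)" and a: "card S < 2 * r"
  shows "subgroup (diffs S) G" "card S + (card (diffs S) - 1) * r \<le> card S * card S"
proof -
  show "subgroup (diffs S) G"
  proof (rule subgroupI)
    show "diffs S \<subseteq> carrier G" using diffs_carrier S by auto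
    show "diffs S \<noteq> {}" using S unfolding diffs_def by auto
    show "inv d \<in> diffs S" if "d \<in> diffs S" for d using that diffs_inv S by auto
    fix d e assume d: "d \<in> diffs S" and e: "e \<in> diffs S"
    have e': "inv e \<in> diffs S" using e diffs_inv S by auto
    have dec: "d \<in> carrier G" "e \<in> carrier G" using d e diffs_carrier S by auto
    let ?P = "S \<inter> (\<lambda>x. d \<otimes> x) ` S" and ?Q = "S \<inter> (\<lambda>x. inv e \<otimes> x) ` S"
    have "?P \<inter> ?Q \<noteq> {}"
    proof
      assume "?P \<inter> ?Q = {}"
      then have "card ?P + card ?Q = card (?P \<union> ?Q)" using S by (intro card_Un_disjoint[symmetric]) auto
      also have "\<dots> \<le> card S" using S by (intro card_mono) auto
      finally show False using r[OF d] r[OF e'] a by linarith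
    qed
    then obtain u where "u \<in> ?P" "u \<in> ?Q" by blast
    then obtain x y where u: "u \<in> S" "x \<in> S" "u = d \<otimes> x" "y \<in> S" "u = inv e \<otimes> y" by auto
    have c: "u \<in> carrier G" "x \<in> carrier G" "y \<in> carrier G" using u S by auto
    have "e \<otimes> (d \<otimes> x) = y" using u c dec by (metis inv_mult_cancel(2))
    then have "y \<otimes> inv x = e \<otimes> (d \<otimes> (x \<otimes> inv x))" using c dec by (metis inv_closed m_assoc m_closed)
    then have "d \<otimes> e = y \<otimes> inv x" using c dec by (simp add: m_comm)
    then show "d \<otimes> e \<in> diffs S" unfolding diffs_def using u by force
  qed
  have "finite (diffs S)" using S diffs_def by auto
  then show "card S + (card (diffs S) - 1) * r \<le> card S * card S"
    using overlap_bound[OF S(1,2) diffs_carrier[OF S(1)] _ diffs_one[OF S(1,3)]] r by blast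
qed

lemma diffs_coset: "S \<subseteq> carrier G \<Longrightarrow> v \<in> S \<Longrightarrow> S \<subseteq> v <# diffs S"
proof
  fix x assume S: "S \<subseteq> carrier G" "v \<in> S" "x \<in> S"
  have "inv v \<otimes> x = x \<otimes> inv v" using S by (auto intro: m_comm)
  then have "inv v \<otimes> x \<in> diffs S" using S unfolding diffs_def by force
  moreover have "v \<in> carrier G" "x \<in> carrier G" using S by auto
  ultimately show "x \<in> v <# diffs S" using mem_coset[OF _ diffs_carrier[OF S(1)]] by simp
qed

text \<open>The two translates lie in \<open>T\<close> and so share at least
  \<open>card P + card R - card T\<close> points. A common point
  \<open>x \<otimes> u = y \<otimes> w\<close> shows that \<open>w\<close> lies in \<open>S\<close>
  and in its translate by \<open>x \<otimes> inv y\<close>.\<close>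

lemma diff_representations:
  assumes "x \<in> carrier G" "y \<in> carrier G" "S \<subseteq> carrier G" "finite S" "P \<subseteq> S" "R \<subseteq> S" "finite T"
    "(\<lambda>u. x \<otimes> u) ` P \<subseteq> T" "(\<lambda>u. y \<otimes> u) ` R \<subseteq> T"
  shows "card P + card R \<le> card T + card (S \<inter> (\<lambda>u. (x \<otimes> inv y) \<otimes> u) ` S)"
proof -
  let ?P = "(\<lambda>u. x \<otimes> u) ` P" and ?R = "(\<lambda>u. y \<otimes> u) ` R"
  have f: "finite ?P" "finite ?R" using assms finite_subset by blast+
  have "card P = card ?P" "card R = card ?R" using assms by (auto intro!: card_translate[symmetric])
  then have "card P + card R = card (?P \<union> ?R) + card (?P \<inter> ?R)" using card_Un_Int[OF f] by simp
  moreover have "card (?P \<union> ?R) \<le> card T" using assms by (intro card_mono) auto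
  moreover have "card (?P \<inter> ?R) \<le> card (S \<inter> (\<lambda>u. (x \<otimes> inv y) \<otimes> u) ` S)"
  proof (rule card_inj_on_le[where f = "\<lambda>t. inv y \<otimes> t"])
    show "inj_on (\<lambda>t. inv y \<otimes> t) (?P \<inter> ?R)" using assms by (intro inj_on_mult) auto
    show "(\<lambda>t. inv y \<otimes> t) ` (?P \<inter> ?R) \<subseteq> S \<inter> (\<lambda>u. (x \<otimes> inv y) \<otimes> u) ` S"
    proof
      fix s assume "s \<in> (\<lambda>t. inv y \<otimes> t) ` (?P \<inter> ?R)"
      then obtain u w where u: "u \<in> P" "w \<in> R" "x \<otimes> u = y \<otimes> w" "s = inv y \<otimes> (x \<otimes> u)" by auto
      have c: "u \<in> carrier G" "w \<in> carrier G" using u assms by auto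
      have "s = w" using u c assms by simp
      moreover have "s = (x \<otimes> inv y) \<otimes> u" unfolding u(4) using c assms(1,2) by (simp add: m_ac)
      ultimately show "s \<in> S \<inter> (\<lambda>u. (x \<otimes> inv y) \<otimes> u) ` S" using u assms by auto
    qed
  qed (use assms in auto)
  ultimately show ?thesis by linarith
qed

text \<open>The reflection of \<open>U\<close> in \<open>t\<close> and the set \<open>W\<close> lie
  in one coset and are together too large for it.\<close>

lemma pigeonhole_coset:
  assumes H: "subgroup H G" "finite H" and v: "v \<in> carrier G" and U: "U \<subseteq> H" and W: "W \<subseteq> v <# H"
    and c: "card H < card U + card W" and t: "t \<in> v <# H"
  shows "\<exists>u\<in>U. \<exists>w\<in>W. t = w \<otimes> u"
proof -
  have Hc: "H \<subseteq> carrier G" using H subgroup.subset by blast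
  have vHc: "v <# H \<subseteq> carrier G" using coset_subset[OF v Hc] .
  have fv: "finite (v <# H)" using H by (auto simp: l_coset_def)
  let ?R = "(\<lambda>u. t \<otimes> inv u) ` U"
  have R: "?R \<subseteq> v <# H"
  proof
    fix r assume "r \<in> ?R"
    then obtain u where u: "u \<in> U" "r = t \<otimes> inv u" by auto
    have "u \<in> \<one> <# H" using u U coset_one[OF H(1)] by auto
    then show "r \<in> v <# H" using coset_div[OF H(1) v one_closed, of t u] t v u by simp
  qed
  have tc: "t \<in> carrier G" using t vHc by auto
  have "inj_on (\<lambda>u. t \<otimes> inv u) U"
    using U Hc tc by (intro inj_onI) (metis inv_closed inv_inv l_cancel subsetD)
  then have cR: "card ?R = card U" by (rule card_image)
  have "?R \<inter> W \<noteq> {}"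
  proof
    assume "?R \<inter> W = {}"
    then have "card ?R + card W = card (?R \<union> W)"
      using R W fv finite_subset by (intro card_Un_disjoint[symmetric]) blast+
    also have "\<dots> \<le> card (v <# H)" using R W fv by (intro card_mono) auto
    finally show False using c cR coset_card[OF v Hc] by simp
  qed
  then obtain u where u: "u \<in> U" "t \<otimes> inv u \<in> W" by auto
  have "t = (t \<otimes> inv u) \<otimes> u" using u U Hc tc by (auto simp: m_assoc subset_iff)
  then show ?thesis using u by blast
qed

text \<open>Sums of two or four elements of \<open>A - H\<close> fill \<open>K\<close>, sums of
  three fill \<open>v <# K\<close>. An element of \<open>A \<inter> H\<close> outside
  \<open>K\<close> would carry these to the remaining cosets. Without one, \<open>A\<close> lies in
  \<open>K \<union> (v <# K)\<close>, which is either the whole group, already reached, or the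
  subgroup sought.\<close>

lemma index_two_conclusion:
  assumes fin: "finite (carrier G)" and H: "subgroup H G" "order G = 2 * card H"
    and A: "A \<subseteq> carrier G - {\<one>}" "card A = card H - 1" "subset_sums G A \<noteq> carrier G"
    and K: "subgroup K G" "K \<subseteq> H" "card K = card H \<or> 2 * card K = card H" "9 \<le> card K"
    and v: "v \<in> carrier G - H" "v \<otimes> v \<in> K" "A - H \<subseteq> v <# K" "card K \<le> card (A - H) + 2"
  shows "\<exists>K. subgroup K G \<and> card K = card H \<and> A = K - {\<one>}"
proof -
  have Hc: "H \<subseteq> carrier G" and Kc: "K \<subseteq> carrier G" using H K subgroup.subset by blast+
  have fH: "finite H" and fK: "finite K" using Hc Kc fin finite_subset by auto
  have Ac: "A \<subseteq> carrier G" using A by auto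
  have fA: "finite A" using Ac fin finite_subset by auto
  have vc: "v \<in> carrier G" "v \<notin> H" using v by auto
  have GH: "carrier G = H \<union> (v <# H)"
    using coset_union_full[OF H(1) subgroup_self fin Hc _ vc(2)] vc H(2) unfolding order_def by auto
  have f1: "finite (A - H)" using fA by auto
  have S1: "subset_sums G (A - H) \<subseteq> subset_sums G A" by (rule subset_sums_mono) auto
  have "rsums 2 (A - H) \<union> rsums 4 (A - H) \<subseteq> subset_sums G (A - H)" using rsums_subset_sums by auto
  then have KS: "K \<subseteq> subset_sums G (A - H)"
    using rsums_2_4_full[OF K(1) fK vc(1) f1 v(3) v(2) v(4) K(4)] by blast
  have "card K + 4 \<le> 2 * card (A - H)" using v(4) K(4) by linarith
  moreover have "(v \<otimes> v \<otimes> v) <# K = v <# K"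
    using coset_eq[OF K(1) vc(1), of "v \<otimes> v \<otimes> v"] v(2) coset_elem[OF v(2), of v] vc by (simp add: m_assoc)
  ultimately have "v <# K \<subseteq> rsums 3 (A - H)" using rsums_3_full[OF K(1) fK vc(1) f1 v(3)] by auto
  then have vKS: "v <# K \<subseteq> subset_sums G (A - H)" using rsums_subset_sums[of 3 "A - H"] by auto
  show ?thesis
  proof (cases "A \<inter> H \<subseteq> K")
    case True
    show ?thesis
    proof (cases "card K = card H")
      case c: True
      then have "K = H" using card_subset_eq[OF fH K(2)] by simp
      then have "carrier G \<subseteq> subset_sums G A" using GH KS vKS S1 by auto
      then show ?thesis using A subset_sums_carrier[OF Ac] by auto
    next
      case False
      then have c: "2 * card K = card H" using K by simp
      let ?L = "K \<union> (v <# K)"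
      have L: "subgroup ?L G" using subgroup_adjoin[OF K(1) vc(1) v(2)] .
      have vK: "v \<notin> K" using K vc by auto
      have fv: "finite (v <# K)" using fK by (auto simp: l_coset_def)
      have cL: "card ?L = card H"
        using card_Un_disjoint[OF fK fv coset_disjoint[OF K(1) vc(1) vK]] coset_card[OF vc(1) Kc] c by simp
      have "A \<subseteq> ?L - {\<one>}" using True v(3) A by auto
      moreover have "card (?L - {\<one>}) = card A" using A(2) cL subgroup.one_closed[OF L] by simp
      moreover have "finite (?L - {\<one>})" using fK fv by auto
      ultimately have "A = ?L - {\<one>}" using card_subset_eq by metis
      then show ?thesis using L cL by blast
    qed
  next
    case False
    then obtain u where u: "u \<in> A" "u \<in> H" "u \<notin> K" by auto
    have uc: "u \<in> carrier G" using u Ac by auto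
    have "card K \<noteq> card H" using u K fH card_subset_eq by metis
    then have c: "card H = 2 * card K" using K by simp
    have HK: "H = K \<union> (u <# K)" using coset_union_full[OF K(1) H(1) fH K(2) u(2,3) c] .
    have us: "u \<in> sums0 {u}" using subset_subset_sums[of "{u}"] subset_sums_sums0[of "{u}"] uc by auto
    have uS: "u \<otimes> t \<in> subset_sums G A" if t: "t \<in> subset_sums G (A - H)" for t
    proof -
      have tc: "t \<in> carrier G" using t subset_sums_carrier[of "A - H"] Ac by auto
      have "t \<otimes> u \<in> subset_sums G ((A - H) \<union> {u})"
        using t u us uc Ac fA by (intro subset_sums_mult) auto
      also have "\<dots> \<subseteq> subset_sums G A" using u by (intro subset_sums_mono) auto
      finally show ?thesis using tc uc by (simp add: m_comm)
    qed
    have "carrier G \<subseteq> subset_sums G A"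
    proof
      fix x assume "x \<in> carrier G"
      then consider "x \<in> K" | "x \<in> u <# K" | "x \<in> v <# H" using GH HK by auto
      then show "x \<in> subset_sums G A"
      proof cases
        case 1 then show ?thesis using KS S1 by auto
      next
        case 2 then show ?thesis using uS KS unfolding l_coset_def by auto
      next
        case 3
        then obtain h where h: "h \<in> H" "x = v \<otimes> h" unfolding l_coset_def by auto
        then consider "h \<in> K" | "h \<in> u <# K" using HK by auto
        then show ?thesis
        proof cases
          case 1
          then show ?thesis using h vKS S1 coset_elem[of h K v] by auto
        next
          case 2
          then obtain k where k: "k \<in> K" "h = u \<otimes> k" unfolding l_coset_def by auto
          have "x = u \<otimes> (v \<otimes> k)" using h k uc vc Kc by (auto simp: m_lcomm subset_iff)
          then show ?thesis using uS vKS coset_elem[OF k(1), of v] by auto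
        qed
      qed
    qed
    then show ?thesis using A subset_sums_carrier[OF Ac] by auto
  qed
qed

lemma coset_cancel:
  assumes K: "subgroup K G" and b: "b \<in> carrier G" "c \<in> carrier G" and w: "w \<in> (b \<otimes> c) <# K" "w \<in> c <# K"
  shows "b \<in> K"
proof -
  have Kc: "K \<subseteq> carrier G" using K subgroup.subset by blast
  have "w \<in> carrier G" using w(2) coset_subset[OF b(2) Kc] by auto
  then have "\<one> \<in> b <# K" using coset_div[OF K b w] by simp
  then have "inv b \<in> K" using b by (simp add: mem_coset[OF b(1) Kc])
  then show ?thesis using subgroup.m_inv_closed[OF K] b by fastforce
qed

lemma even_case:
  assumes fin: "finite (carrier G)" and H: "subgroup H G" "order G = 2 * card H" "18 \<le> card H"
    and A: "A \<subseteq> carrier G - {\<one>}" "card A = card H - 1" "subset_sums G A \<noteq> carrier G"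
  shows "\<exists>K. subgroup K G \<and> card K = card H \<and> A = K - {\<one>}"
proof -
  define m h a where "m = card H" and "h = card (A \<inter> H)" and "a = card (A - H)"
  have Hc: "H \<subseteq> carrier G" using H subgroup.subset by blast
  have fH: "finite H" using Hc fin finite_subset by auto
  have Ac: "A \<subseteq> carrier G" using A by auto
  have fA: "finite A" using Ac fin finite_subset by auto
  have nsub: "\<not> carrier G \<subseteq> subset_sums G A" using A subset_sums_carrier[OF Ac] by auto
  have ha: "h + a = m - 1"
    using card_Int_Diff[OF fA, of H] A(2) unfolding h_def a_def m_def by simp
  have m18: "18 \<le> m" using H m_def by simp
  have GH: "carrier G = H \<union> (v <# H)" if "v \<in> carrier G" "v \<notin> H" for v
    using coset_union_full[OF H(1) subgroup_self fin Hc _ that(2)] that H(2) unfolding order_def by auto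
  have AS: "t \<otimes> u \<in> subset_sums G A" if "t \<in> subset_sums G P" "u \<in> sums0 R" "P \<inter> R = {}" "P \<union> R \<subseteq> A" for t u P R
    using subset_sums_mult[of P R t u] subset_sums_mono[of "P \<union> R" A] that Ac fA finite_subset[OF _ fA] by blast
  show ?thesis
  proof (cases "m < 2 * h")
    case True
    have full: "subset_sums G (A \<inter> H) = H"
      using True A unfolding m_def h_def by (intro subset_sums_full[OF fin H(1)]) auto
    have "A - H = {}"
    proof (rule ccontr)
      assume "A - H \<noteq> {}"
      then obtain v where v: "v \<in> A" "v \<notin> H" by auto
      have vc: "v \<in> carrier G" using v Ac by auto
      have vs: "v \<in> sums0 {v}" using subset_subset_sums[of "{v}"] subset_sums_sums0[of "{v}"] vc by auto
      have "carrier G \<subseteq> subset_sums G A"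
      proof
        fix x assume "x \<in> carrier G"
        then consider "x \<in> H" | "x \<in> v <# H" using GH[OF vc v(2)] by auto
        then show "x \<in> subset_sums G A"
        proof cases
          case 1 then show ?thesis using full subset_sums_mono[of "A \<inter> H" A] by auto
        next
          case 2
          then obtain k where k: "k \<in> H" "x = v \<otimes> k" unfolding l_coset_def by auto
          then have "x = k \<otimes> v" using vc Hc by (auto simp: m_comm)
          then show ?thesis using AS[of k "A \<inter> H" v "{v}"] vs v k full by auto
        qed
      qed
      then show False using nsub by simp
    qed
    then have "A \<subseteq> H - {\<one>}" using A by auto
    moreover have "card (H - {\<one>}) = card A" using A subgroup.one_closed[OF H(1)] by simp
    ultimately have "A = H - {\<one>}" using fH by (intro card_subset_eq) auto
    then show ?thesis using H by blast
  next
    case False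
    have a8: "8 \<le> a" "m \<le> 2 * a + 2" using False ha m18 by linarith+
    then have "A - H \<noteq> {}" unfolding a_def by (metis card.empty not_numeral_le_zero)
    then obtain v where v: "v \<in> A" "v \<notin> H" by auto
    define B where "B = A - H"
    have vB: "v \<in> B" using v B_def by auto
    have vc: "v \<in> carrier G" using v Ac by auto
    have Bc: "B \<subseteq> carrier G" and fB: "finite B" using Ac fA B_def by auto
    have cB: "card B = a" using a_def B_def by simp
    have BH: "B \<subseteq> v <# H" using GH[OF vc v(2)] Bc B_def by auto
    have vv: "v \<otimes> v \<in> H"
    proof (rule ccontr)
      assume "v \<otimes> v \<notin> H"
      then have "v \<otimes> v \<in> v <# H" using GH[OF vc v(2)] vc by auto
      then have "v \<in> H" by (simp add: mem_coset[OF vc Hc] vc)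
      then show False using v by simp
    qed
    have p2: "v [^] (2::nat) = v \<otimes> v" "v [^] (3::nat) = v \<otimes> v \<otimes> v" "v [^] (4::nat) = (v \<otimes> v) \<otimes> (v \<otimes> v)"
      using vc by (simp_all add: numeral_eq_Suc m_assoc)
    have R2: "rsums 2 B \<subseteq> H" and R4: "rsums 4 B \<subseteq> H" and R3: "rsums 3 B \<subseteq> v <# H"
    proof -
      have "(v \<otimes> v) \<otimes> (v \<otimes> v) \<in> H" using vv subgroup.m_closed[OF H(1)] by auto
      then have "(v [^] (4::nat)) <# H = H" "(v [^] (2::nat)) <# H = H"
        using coset_absorb[OF H(1)] vv unfolding p2 by auto
      then show "rsums 2 B \<subseteq> H" "rsums 4 B \<subseteq> H"
        using rsums_coset[OF H(1) vc fB BH, of 2] rsums_coset[OF H(1) vc fB BH, of 4] by auto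
      have "(v \<otimes> v \<otimes> v) <# H = v <# H"
        using coset_eq[OF H(1) vc, of "v \<otimes> v \<otimes> v"] vv coset_elem[OF vv, of v] vc by (simp add: m_assoc)
      then show "rsums 3 B \<subseteq> v <# H" using rsums_coset[OF H(1) vc fB BH, of 3] p2 by simp
    qed
    \<comment> \<open>At least \<open>h + 1\<close> sums, namely \<open>\<one>\<close> and the
      elements themselves. Since \<open>m = h + a + 1\<close>, the pigeonhole fails only if a parity
      class of sums of \<open>B\<close> has at most \<open>a\<close> members.\<close>
    define U where "U = sums0 (A \<inter> H)"
    have UH: "U \<subseteq> H" unfolding U_def sums0_eq
      using subset_sums_subgroup[OF H(1), of "A \<inter> H"] fA subgroup.one_closed[OF H(1)] by auto
    have fU: "finite U" using UH fH finite_subset by auto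
    have W: "insert \<one> (A \<inter> H) \<subseteq> U" unfolding U_def sums0_eq using subset_subset_sums[of "A \<inter> H"] Ac by auto
    have "\<one> \<notin> A \<inter> H" using A by auto
    then have cW: "card (insert \<one> (A \<inter> H)) = h + 1" using fA h_def by simp
    have cU: "h + 1 \<le> card U" using card_mono[OF fU W] cW by simp
    define K where "K = diffs B"
    have KH: "K \<subseteq> H" unfolding K_def diffs_def using coset_diff[OF H(1) vc] BH by auto
    have BK: "B \<subseteq> v <# K" unfolding K_def using diffs_coset[OF Bc vB] .
    have fK: "finite K" using KH fH finite_subset by auto
    have Kc: "K \<subseteq> carrier G" using KH Hc by auto
    have "card B \<le> card (v <# K)" using BK fK by (intro card_mono) (auto simp: l_coset_def)
    then have aK: "a \<le> card K" using cB coset_card[OF vc Kc] by simp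
    \<comment> \<open>\<open>B\<close> fits into a coset of \<open>K\<close>, so
      \<open>card K\<close> is at least \<open>a\<close>, which is at least
      \<open>m / 2 - 1\<close>; this leaves only index 1 or 2 in \<open>H\<close>.\<close>
    have Kcard: "card K = m \<or> 2 * card K = m" if K: "subgroup K G"
    proof -
      have "card K dvd m" unfolding m_def using subgroup_card_dvd[OF fin K H(1) KH] .
      then obtain c where c: "m = card K * c" by auto
      have "c < 3"
      proof (rule ccontr)
        assume "\<not> c < 3"
        then have "card K * 3 \<le> m" unfolding c by simp
        then show False using aK a8 m18 by linarith
      qed
      moreover have "c \<noteq> 0" using c m18 by (intro notI) simp
      ultimately have "c = 1 \<or> c = 2" by auto
      then show ?thesis using c by auto
    qed
    have concl: ?thesis if "subgroup K G" "v \<otimes> v \<in> K" "card K \<le> a + 2"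
    proof (rule index_two_conclusion[OF fin H(1,2) A that(1) KH])
      show "card K = card H \<or> 2 * card K = card H" using Kcard that m_def by auto
      show "9 \<le> card K" using Kcard[OF that(1)] m18 by linarith
      show "v \<in> carrier G - H" using v vc by auto
      show "v \<otimes> v \<in> K" by fact
      show "A - H \<subseteq> v <# K" using BK B_def by auto
      show "card K \<le> card (A - H) + 2" using that a_def by simp
    qed
    have evn: "t \<in> subset_sums G A" if t: "t \<in> H" and c: "m < card U + card (rsums 2 B \<union> rsums 4 B)" for t
    proof -
      have "rsums 2 B \<union> rsums 4 B \<subseteq> \<one> <# H" "t \<in> \<one> <# H" using coset_one[OF H(1)] R2 R4 t by auto
      then obtain u w where u: "u \<in> U" "w \<in> rsums 2 B \<union> rsums 4 B" "t = w \<otimes> u"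
        using pigeonhole_coset[OF H(1) fH one_closed UH, of "rsums 2 B \<union> rsums 4 B" t] c m_def by blast
      have "w \<in> subset_sums G B" using u rsums_subset_sums[of 2 B] rsums_subset_sums[of 4 B] by auto
      then show ?thesis using AS[of w B u "A \<inter> H"] u U_def B_def by auto
    qed
    have odd: "t \<in> subset_sums G A" if t: "t \<in> v <# H" and c: "m < card U + card (B \<union> rsums 3 B)" for t
    proof -
      have "B \<union> rsums 3 B \<subseteq> v <# H" using R3 BH by auto
      then obtain u w where u: "u \<in> U" "w \<in> B \<union> rsums 3 B" "t = w \<otimes> u"
        using pigeonhole_coset[OF H(1) fH vc UH, of "B \<union> rsums 3 B" t] c m_def t by blast
      have "w \<in> subset_sums G B" using u rsums_subset_sums[of 3 B] subset_subset_sums[OF Bc] by auto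
      then show ?thesis using AS[of w B u "A \<inter> H"] u U_def B_def by auto
    qed
    have ne: "B \<noteq> {}" using vB by auto
    have "card U + card (rsums 2 B \<union> rsums 4 B) \<le> m \<or> card U + card (B \<union> rsums 3 B) \<le> m"
      using evn odd GH[OF vc v(2)] nsub by (metis Un_iff linorder_not_le subsetI)
    then show ?thesis
    proof
      assume c: "card U + card (rsums 2 B \<union> rsums 4 B) \<le> m"
      have f24: "finite (rsums 2 B)" "finite (rsums 4 B)" using fB finite_rsums by auto
      have c24: "card (rsums 2 B \<union> rsums 4 B) \<le> a" using c cU ha by linarith
      have c2: "card (rsums 2 B) \<le> a" using c24 card_mono[of "rsums 2 B \<union> rsums 4 B" "rsums 2 B"] f24 by auto
      \<comment> \<open>Two translates of sets of size \<open>a - 1\<close> among at most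
        \<open>a\<close> two-element sums share at least \<open>2 * (a - 1) - a\<close>
        points.\<close>
      have rep: "a - 2 \<le> card (B \<inter> (\<lambda>x. d \<otimes> x) ` B)" if "d \<in> diffs B" for d
      proof -
        obtain x y where d: "x \<in> B" "y \<in> B" "d = x \<otimes> inv y" using \<open>d \<in> diffs B\<close> unfolding diffs_def by auto
        have im: "(\<lambda>u. z \<otimes> u) ` (B - {z}) \<subseteq> rsums 2 B" if "z \<in> B" for z
        proof -
          have "rsums 1 (B - {z}) = B - {z}" using Bc by (intro rsums_1) auto
          then show ?thesis using rsums_step[OF Bc fB that, of _ 1] by (auto simp: numeral_2_eq_2)
        qed
        have "card (B - {x}) + card (B - {y}) \<le> card (rsums 2 B) + card (B \<inter> (\<lambda>u. (x \<otimes> inv y) \<otimes> u) ` B)"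
          using d Bc fB f24 im by (intro diff_representations) auto
        then show ?thesis using c2 d cB fB by simp
      qed
      have lt: "card B < 2 * (a - 2)" using cB a8 by linarith
      have K: "subgroup K G" "card B + (card K - 1) * (a - 2) \<le> card B * card B"
        unfolding K_def by (rule diffs_subgroup[OF Bc fB ne _ lt]; fact rep)+
      \<comment> \<open>Otherwise sums of two and of four elements lie in different cosets of
        \<open>K\<close> and add up to at least \<open>(a - 1) + (a - 3)\<close>, more than
        \<open>a\<close>.\<close>
      have vvK: "v \<otimes> v \<in> K"
      proof (rule ccontr)
        assume n: "v \<otimes> v \<notin> K"
        have "rsums 2 B \<inter> rsums 4 B = {}"
        proof (rule ccontr)
          assume "rsums 2 B \<inter> rsums 4 B \<noteq> {}"
          then obtain w where "w \<in> (v [^] (2::nat)) <# K" "w \<in> (v [^] (4::nat)) <# K"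
            using rsums_coset[OF K(1) vc fB BK] by blast
          then have "v \<otimes> v \<in> K" using coset_cancel[OF K(1), of "v \<otimes> v" "v \<otimes> v" w] vc p2 by auto
          then show False using n by simp
        qed
        then have "card (rsums 2 B) + card (rsums 4 B) \<le> a" using c24 card_Un_disjoint[OF f24] by simp
        moreover have "a + 1 \<le> card (rsums 2 B) + 2" "a + 1 \<le> card (rsums 4 B) + 4"
          using rsums_lower[OF fB Bc, of 2] rsums_lower[OF fB Bc, of 4] cB a8 by simp_all
        ultimately show False using a8 by linarith
      qed
      \<comment> \<open>A larger \<open>K\<close> would violate the overlap count, since
        \<open>a + (a + 2) * (a - 2)\<close> exceeds \<open>a * a\<close>.\<close>
      have "card K \<le> a + 2"
      proof (rule ccontr)
        assume "\<not> card K \<le> a + 2"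
        then have "(a + 2) * (a - 2) \<le> (card K - 1) * (a - 2)" by (intro mult_right_mono) auto
        then have "a + (a + 2) * (a - 2) \<le> a * a" using K(2) unfolding cB by linarith
        moreover obtain c where "a = c + 8" using a8 by (metis add.commute le_iff_add)
        ultimately show False by (simp add: algebra_simps)
      qed
      then show ?thesis using concl K vvK by blast
    next
      assume c: "card U + card (B \<union> rsums 3 B) \<le> m"
      have f3: "finite (B \<union> rsums 3 B)" using fB finite_rsums by auto
      \<comment> \<open>The count leaves no room: all three-element sums fall back into
        \<open>B\<close>, and \<open>A \<inter> H\<close> together with \<open>\<one>\<close>
        exhausts its own subset sums.\<close>
      have "card (B \<union> rsums 3 B) \<le> card B" using c cU ha cB by linarith
      then have "B = B \<union> rsums 3 B" using card_seteq[OF f3, of B] by auto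
      then have R3B: "rsums 3 B \<subseteq> B" by auto
      then have "card B + card U \<le> m" using c by (simp add: Un_absorb2 add.commute)
      then have "card U \<le> card (insert \<one> (A \<inter> H))" using cW ha cB m18 by linarith
      then have UW: "U = insert \<one> (A \<inter> H)" using card_seteq[OF fU W] by simp
      \<comment> \<open>The boundary case \<open>2 * h = m\<close> only gives
        \<open>a \<ge> 8\<close>, while the overlap \<open>a - 4\<close> found below exceeds half of
        \<open>a\<close> from 9 on. In that case \<open>U\<close> contains its own two-element sums,
        so every point of \<open>H\<close> outside \<open>U\<close> has a fibre of size at least 2
        under squaring, too many for \<open>U\<close>.\<close>
      have hm: "2 * h < m"
      proof (rule ccontr)
        assume "\<not> 2 * h < m"
        then have hm: "2 * h = m" using False by linarith
        have s2: "2 \<le> card {x \<in> U. x \<otimes> x = s}" if s: "s \<in> H - U" for s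
        proof -
          have "rsums 2 U \<subseteq> U" using rsums_insert_one[of "A \<inter> H" 2] fA Ac UW subset_sums_sums0[of "A \<inter> H"] U_def by auto
          then have "s \<notin> rsums 2 U" using s by auto
          moreover have "s \<in> (\<one> \<otimes> \<one>) <# H" "U \<subseteq> \<one> <# H" using s UH coset_one[OF H(1)] by auto
          ultimately have "2 * card U \<le> card H + card {x \<in> U. x \<otimes> x = s}"
            using fU by (intro square_fibre_bound[OF H(1) fH one_closed]) auto
          then show ?thesis using UW cW hm m_def by simp
        qed
        have "2 * card (H - U) \<le> (\<Sum>s\<in>H - U. card {x \<in> U. x \<otimes> x = s})"
          using sum_mono[of "H - U" "\<lambda>_. 2", OF s2] by (simp add: mult.commute)
        also have "\<dots> \<le> card U" using fU fH by (intro square_fibre_sum) auto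
        finally have "2 * (m - (h + 1)) \<le> h + 1" using card_Diff_subset[OF fU UH] UW cW m_def by simp
        then show False using hm m18 by linarith
      qed
      then have a9: "9 \<le> a" "m \<le> 2 * a + 1" using ha m18 by linarith+
      have rep: "a - 4 \<le> card (B \<inter> (\<lambda>x. d \<otimes> x) ` B)" if "d \<in> diffs B" for d
      proof -
        obtain x y where d: "x \<in> B" "y \<in> B" "d = x \<otimes> inv y" using \<open>d \<in> diffs B\<close> unfolding diffs_def by auto
        \<comment> \<open>A common summand \<open>z\<close> turns three-element sums into translates
          by \<open>x\<close> and by \<open>y\<close> up to the same shift. Each family keeps
          \<open>a - 2\<close> elements and lies in \<open>B\<close>, hence the overlap
          \<open>2 * (a - 2) - a\<close>.\<close>
        have "card {x,y} \<le> 2" by (simp add: card_insert_if)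
        then have "\<not> B \<subseteq> {x,y}" using card_mono[of "{x,y}" B] cB a9 by auto
        then obtain z where z: "z \<in> B" "z \<noteq> x" "z \<noteq> y" by auto
        have im: "(\<lambda>u. (w \<otimes> z) \<otimes> u) ` (B - {w} - {z}) \<subseteq> B" if w: "w \<in> B" "w \<noteq> z" for w
        proof
          fix t assume "t \<in> (\<lambda>u. (w \<otimes> z) \<otimes> u) ` (B - {w} - {z})"
          then obtain u where u: "u \<in> B - {w} - {z}" "t = (w \<otimes> z) \<otimes> u" by auto
          have "u \<in> rsums 1 (B - {w} - {z})" using u rsums_1[of "B - {w} - {z}"] Bc by auto
          then have "z \<otimes> u \<in> rsums 2 (B - {w})"
            using rsums_step[of "B - {w}" z u 1] Bc fB z w by (auto simp: numeral_2_eq_2)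
          then have "w \<otimes> (z \<otimes> u) \<in> rsums 3 B" using rsums_step[OF Bc fB w(1), of "z \<otimes> u" 2] by (auto simp: numeral_eq_Suc)
          moreover have "t = w \<otimes> (z \<otimes> u)" unfolding u(2) using u w z Bc by (auto simp: m_assoc subset_iff)
          ultimately show "t \<in> B" using R3B by auto
        qed
        have xyz: "x \<in> carrier G" "y \<in> carrier G" "z \<in> carrier G" using d z Bc by auto
        have "card (B - {x} - {z}) + card (B - {y} - {z})
            \<le> card B + card (B \<inter> (\<lambda>u. ((x \<otimes> z) \<otimes> inv (y \<otimes> z)) \<otimes> u) ` B)"
          using d(1,2) z Bc fB im xyz by (intro diff_representations) auto
        moreover have "(x \<otimes> z) \<otimes> inv (y \<otimes> z) = d" unfolding d using xyz by (simp add: m_ac inv_mult)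
        ultimately show ?thesis using d z cB fB by (simp add: card_Diff_singleton_if)
      qed
      have lt: "card B < 2 * (a - 4)" using cB a9 by linarith
      have K: "subgroup K G" "card B + (card K - 1) * (a - 4) \<le> card B * card B"
        unfolding K_def by (rule diffs_subgroup[OF Bc fB ne _ lt]; fact rep)+
      have "a + 1 \<le> card (rsums 3 B) + 3" using rsums_lower[OF fB Bc, of 3] cB a9 by auto
      then have "rsums 3 B \<noteq> {}" using a9 by auto
      then obtain w where w: "w \<in> rsums 3 B" by auto
      then have "w \<in> (v [^] (3::nat)) <# K" "w \<in> v <# K" using rsums_coset[OF K(1) vc fB BK] R3B BK by auto
      then have vvK: "v \<otimes> v \<in> K" using coset_cancel[OF K(1), of "v \<otimes> v" v w] vc p2 by auto
      show ?thesis
      proof (cases "2 * card K = m")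
        case True
        then have "card K \<le> a + 2" using a9 by linarith
        then show ?thesis using concl K vvK by blast
      next
        case False
        then have Km: "card K = m" using Kcard[OF K(1)] by simp
        show ?thesis
        \<comment> \<open>Now \<open>K = H\<close>. If \<open>B\<close> exceeds half of its coset by
          2, then three-element sums fill a whole coset, yet they all lie in \<open>B\<close>, which
          has fewer than \<open>m\<close> elements.\<close>
        proof (cases "m + 4 \<le> 2 * a")
          case True
          then have "card K + 4 \<le> 2 * card B" using Km cB by simp
          then have "(v \<otimes> v \<otimes> v) <# K \<subseteq> B" using rsums_3_full[OF K(1) fK vc fB BK] R3B by auto
          then have "card ((v \<otimes> v \<otimes> v) <# K) \<le> card B" using fB by (intro card_mono)
          then have "m \<le> a" using coset_card[of "v \<otimes> v \<otimes> v" K] vc Kc Km cB by simp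
          then show ?thesis using ha m18 by linarith
        next
          case F: False
          have le: "a + (m - 1) * (a - 4) \<le> a * a" using K(2) cB Km by simp
          obtain c where c: "a = c + 9" using a9 by (metis add.commute le_iff_add)
          \<comment> \<open>Here \<open>m\<close> is at least 18 and at least
            \<open>2 * a - 3\<close>. The second bound leaves only \<open>a = 9\<close> in the
            overlap count, and the first excludes it, because
            \<open>9 + 17 * 5 > 81\<close>.\<close>
          have "17 \<le> m - 1" "2 * c + 14 \<le> m - 1" using m18 F c by linarith+
          then have "17 * (a - 4) \<le> (m - 1) * (a - 4)" "(2 * c + 14) * (a - 4) \<le> (m - 1) * (a - 4)"
            by (intro mult_right_mono; simp)+
          then have l: "a + 17 * (a - 4) \<le> a * a" "a + (2 * c + 14) * (a - 4) \<le> a * a" using le by linarith+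
          have "c = 0"
          proof (rule ccontr)
            assume "c \<noteq> 0"
            then show False using l(2) unfolding c by (simp add: algebra_simps)
          qed
          then show ?thesis using l(1) c by simp
        qed
      qed
    qed
  qed
qed


subsection \<open>Cosets of subgroups of prime order\<close>

text \<open>Cauchy--Davenport for \<open>S\<close> and the set of its inverses, which lies in the
  inverse coset.\<close>

lemma card_diffs:
  assumes fin: "finite (carrier G)" and H: "subgroup H G" "Factorial_Ring.prime (card H)"
    and v: "v \<in> carrier G" and S: "S \<subseteq> v <# H" "S \<noteq> {}"
  shows "min (card H) (2 * card S - 1) \<le> card (diffs S)"
proof -
  have Hc: "H \<subseteq> carrier G" using H subgroup.subset by blast
  have Sc: "S \<subseteq> carrier G" using S coset_subset[OF v Hc] by auto
  define R where "R = (\<lambda>y. inv y) ` S"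
  have "inj_on (\<lambda>y. inv y) S" using Sc by (intro inj_onI) (metis inv_inv subsetD)
  then have cR: "card R = card S" unfolding R_def by (rule card_image)
  have "R \<subseteq> inv v <# H"
  proof
    fix r assume "r \<in> R"
    then obtain y where y: "y \<in> S" "r = inv y" unfolding R_def by auto
    have "\<one> \<in> (inv v \<otimes> v) <# H" using coset_one[OF H(1)] subgroup.one_closed[OF H(1)] v by simp
    then have "\<one> \<otimes> inv y \<in> inv v <# H" using coset_div[OF H(1) _ v, of "inv v" \<one> y] y S v by auto
    then show "r \<in> inv v <# H" using y Sc by auto
  qed
  moreover have "R \<noteq> {}" using S R_def by auto
  ultimately have "min (card H) (card S + card R - 1) \<le> card (S <#> R)"
    using cauchy_davenport[OF fin H Sc S(2)] v by (metis inv_closed)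
  moreover have "S <#> R = diffs S" unfolding set_mult_def diffs_def R_def by auto
  ultimately show ?thesis using cR by (simp add: mult_2)
qed

text \<open>A sum that avoids both \<open>x\<close> and \<open>y\<close> can be extended by either
  one; the two extensions differ by \<open>x \<otimes> inv y\<close>.\<close>

lemma rsums_overlap:
  assumes "S \<subseteq> carrier G" "finite S" "x \<in> S" "y \<in> S" "x \<noteq> y"
  shows "card (rsums j (S - {x,y})) \<le> card (rsums (Suc j) S \<inter> (\<lambda>t. (x \<otimes> inv y) \<otimes> t) ` rsums (Suc j) S)"
proof (rule card_inj_on_le[where f = "\<lambda>t. x \<otimes> t"])
  have c: "x \<in> carrier G" "y \<in> carrier G" "rsums j (S - {x,y}) \<subseteq> carrier G"
    using assms rsums_carrier[of "S - {x,y}" j] by auto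
  show "inj_on (\<lambda>t. x \<otimes> t) (rsums j (S - {x,y}))" using c by (intro inj_on_mult)
  show "(\<lambda>t. x \<otimes> t) ` rsums j (S - {x,y}) \<subseteq> rsums (Suc j) S \<inter> (\<lambda>t. (x \<otimes> inv y) \<otimes> t) ` rsums (Suc j) S"
  proof
    fix s assume "s \<in> (\<lambda>t. x \<otimes> t) ` rsums j (S - {x,y})"
    then obtain t where t: "t \<in> rsums j (S - {x,y})" "s = x \<otimes> t" by auto
    have tc: "t \<in> carrier G" using t c by auto
    have "t \<in> rsums j (S - {x})" "t \<in> rsums j (S - {y})"
      using t rsums_mono[of "S - {x,y}" "S - {x}" j] rsums_mono[of "S - {x,y}" "S - {y}" j] by auto
    then have "x \<otimes> t \<in> rsums (Suc j) S" "y \<otimes> t \<in> rsums (Suc j) S" using rsums_step assms by auto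
    moreover have "s = (x \<otimes> inv y) \<otimes> (y \<otimes> t)" using t tc c by (simp add: m_assoc)
    ultimately show "s \<in> rsums (Suc j) S \<inter> (\<lambda>t. (x \<otimes> inv y) \<otimes> t) ` rsums (Suc j) S" using t by auto
  qed
  show "finite (rsums (Suc j) S \<inter> (\<lambda>t. (x \<otimes> inv y) \<otimes> t) ` rsums (Suc j) S)" using assms finite_rsums by auto
qed

text \<open>Cauchy--Davenport supplies at least \<open>n\<close> nontrivial differences, each with
  an overlap of at least \<open>r\<close> by \<open>rsums_overlap\<close>. The double count then
  bounds the number of sums below by about the square root of \<open>n * r\<close>.\<close>

lemma rsums_growth:
  assumes fin: "finite (carrier G)" and H: "subgroup H G" "Factorial_Ring.prime (card H)"
    and v: "v \<in> carrier G" and S: "S \<subseteq> v <# H" "S \<noteq> {}"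
    and r: "\<And>x y. x \<in> S \<Longrightarrow> y \<in> S \<Longrightarrow> x \<noteq> y \<Longrightarrow> r \<le> card (rsums j (S - {x,y}))"
    and n: "n + 1 \<le> card H" "n + 2 \<le> 2 * card S"
  shows "card (rsums (Suc j) S) + n * r \<le> card (rsums (Suc j) S) * card (rsums (Suc j) S)"
proof -
  have Hc: "H \<subseteq> carrier G" using H subgroup.subset by blast
  have Sc: "S \<subseteq> carrier G" using S coset_subset[OF v Hc] by auto
  have fS: "finite S" using Sc fin finite_subset by auto
  let ?T = "rsums (Suc j) S" and ?D = "diffs S"
  have "r \<le> card (?T \<inter> (\<lambda>x. d \<otimes> x) ` ?T)" if d: "d \<in> ?D" "d \<noteq> \<one>" for d
  proof -
    obtain x y where xy: "x \<in> S" "y \<in> S" "d = x \<otimes> inv y" using d unfolding diffs_def by auto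
    have "x \<noteq> y" using xy d Sc by auto
    then show ?thesis using rsums_overlap[OF Sc fS xy(1,2), of j] r[OF xy(1,2)] xy(3) by force
  qed
  moreover have "finite ?D" using fS unfolding diffs_def by auto
  ultimately have "card ?T + (card ?D - 1) * r \<le> card ?T * card ?T"
    using rsums_carrier[OF Sc] finite_rsums[OF fS] diffs_carrier[OF Sc] diffs_one[OF Sc S(2)]
    by (intro overlap_bound) auto
  moreover have "n \<le> card ?D - 1" using card_diffs[OF fin H v S] n by linarith
  then have "n * r \<le> (card ?D - 1) * r" by (intro mult_right_mono) auto
  ultimately show ?thesis by linarith
qed

lemma card_remove_two: "finite S \<Longrightarrow> x \<in> S \<Longrightarrow> y \<in> S \<Longrightarrow> x \<noteq> y \<Longrightarrow> card (S - {x,y}) = card S - 2"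
  by (simp add: card_Diff_subset)

text \<open>This and the next two bounds are the cases of the Dias da Silva--Hamidoune inequality
  \<open>|rsums j S| \<ge> min q (j (|S| - j) + 1)\<close> that are needed, in weakened form. Removing two elements \<open>x\<close>, \<open>y\<close> shows by
  induction that \<open>rsums j S\<close> is almost invariant under \<open>x - y\<close>, and by Cauchy--Davenport there are many such
  differences.\<close>

lemma rsums_card_ge:
  assumes fin: "finite (carrier G)" and H: "subgroup H G" "Factorial_Ring.prime (card H)" and v: "v \<in> carrier G"
  shows "S \<subseteq> v <# H \<Longrightarrow> card S < card H \<Longrightarrow> 1 \<le> j \<Longrightarrow> j < card S \<Longrightarrow> card S \<le> card (rsums j S)"
proof (induction "card S" arbitrary: S j rule: less_induct)
  case less
  have Hc: "H \<subseteq> carrier G" using H subgroup.subset by blast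
  have Sc: "S \<subseteq> carrier G" using less.prems coset_subset[OF v Hc] by auto
  have fS: "finite S" using Sc fin finite_subset by auto
  consider "j = 1" | "j = card S - 1" | "2 \<le> j" "j + 2 \<le> card S" using less.prems by linarith
  then show ?case
  proof cases
    case 1 then show ?thesis using rsums_1[OF Sc] by simp
  next
    case 2 then show ?thesis using rsums_compl[OF Sc fS, of 1] rsums_1[OF Sc] less.prems by simp
  next
    case 3
    then obtain i where i: "j = Suc i" "1 \<le> i" by (cases j) auto
    define c where "c = card S - 2"
    have c: "card S = c + 2" "2 \<le> c" using 3 unfolding c_def by linarith+
    have IH: "c \<le> card (rsums i (S - {x,y}))" if "x \<in> S" "y \<in> S" "x \<noteq> y" for x y
    proof -
      have cc: "card (S - {x,y}) = c" using card_remove_two[OF fS that] c by simp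
      have "card (S - {x,y}) \<le> card (rsums i (S - {x,y}))"
        by (rule less.hyps) (use cc c i 3 less.prems in auto)
      then show ?thesis using cc by simp
    qed
    have ne: "S \<noteq> {}" using c by auto
    \<comment> \<open>\<open>card S < card H\<close> provides \<open>c + 2\<close> differences. If
      there were at most \<open>c + 1\<close> sums, the inequality would already force
      \<open>c + 2\<close> of them.\<close>
    have g: "card (rsums j S) + (c + 2) * c \<le> card (rsums j S) * card (rsums j S)"
      unfolding i(1) by (rule rsums_growth[OF fin H v less.prems(1) ne IH]) (use c less.prems in auto)
    show ?thesis
    proof (rule ccontr)
      assume "\<not> ?thesis"
      then have t: "card (rsums j S) \<le> c + 1" using c by simp
      then have "card (rsums j S) * card (rsums j S) \<le> card (rsums j S) * (c + 1)" by (intro mult_left_mono) auto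
      then have "(c + 2) * c \<le> card (rsums j S) * c" using g by simp
      then have "c + 2 \<le> card (rsums j S)" using c by (simp only: mult_le_cancel2)
      then show False using t by simp
    qed
  qed
qed

text \<open>Pair sums can agree only for complementary pairs, and two such coincidences would give
  two elements the same square; so at least five of the six sums are distinct. For four elements
  Cauchy--Davenport guarantees only six nontrivial differences, one too few for the argument of
  \<open>rsums_card_ge_Suc\<close>.\<close>

lemma rsums_2_of_4:
  assumes fin: "finite (carrier G)" and H: "subgroup H G" "odd (card H)" and v: "v \<in> carrier G"
    and S: "S \<subseteq> v <# H" "card S = 4"
  shows "5 \<le> card (rsums 2 S)"
proof -
  have Hc: "H \<subseteq> carrier G" using H subgroup.subset by blast
  have Sc: "S \<subseteq> carrier G" using S coset_subset[OF v Hc] by auto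
  have fS: "finite S" using Sc fin finite_subset by auto
  obtain x T where T: "S = insert x T" "x \<notin> T" "card T = 3"
    using S(2) card_Suc_eq[of S 3] by auto
  obtain y z w where yzw: "T = {y,z,w}" "y \<noteq> z" "y \<noteq> w" "z \<noteq> w" using T(3) card_3_iff by metis
  have d: "x \<noteq> y" "x \<noteq> z" "x \<noteq> w" using T yzw by auto
  have c: "x \<in> carrier G" "y \<in> carrier G" "z \<in> carrier G" "w \<in> carrier G" using T yzw Sc by auto
  have p: "s \<otimes> t \<in> rsums 2 S" if "s \<in> S" "t \<in> S" "s \<noteq> t" for s t
  proof -
    have "t \<in> rsums 1 (S - {s})" using rsums_1[of "S - {s}"] Sc that by auto
    then show ?thesis using rsums_step[OF Sc fS that(1), of t 1] by (simp add: numeral_2_eq_2)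
  qed
  have key: False if "s1 \<otimes> s2 = x \<otimes> s3" "s1 \<otimes> s3 = x \<otimes> s2" "s2 \<noteq> s3" "{s1,s2,s3} \<subseteq> S" for s1 s2 s3
  proof -
    have cc: "s1 \<in> carrier G" "s2 \<in> carrier G" "s3 \<in> carrier G" using that Sc by auto
    have "(s1 \<otimes> x) \<otimes> (s2 \<otimes> s2) = (s1 \<otimes> s2) \<otimes> (x \<otimes> s2)" using cc c by (simp add: m_ac)
    also have "\<dots> = (x \<otimes> s3) \<otimes> (s1 \<otimes> s3)" using that by simp
    also have "\<dots> = (s1 \<otimes> x) \<otimes> (s3 \<otimes> s3)" using cc c by (simp add: m_ac)
    finally have "s2 \<otimes> s2 = s3 \<otimes> s3" using cc c by simp
    then show False using square_inj_odd[OF fin H v, of s2 s3] that S by auto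
  qed
  have mem: "x \<in> S" "y \<in> S" "z \<in> S" "w \<in> S" using T yzw by auto
  have k1: "\<not> (y \<otimes> z = x \<otimes> w \<and> y \<otimes> w = x \<otimes> z)" using key[of y z w] mem yzw by auto
  have k2: "\<not> (y \<otimes> z = x \<otimes> w \<and> z \<otimes> w = x \<otimes> y)" using key[of z y w] mem yzw c by (auto simp: m_comm)
  have k3: "\<not> (y \<otimes> w = x \<otimes> z \<and> z \<otimes> w = x \<otimes> y)" using key[of w y z] mem yzw c by (auto simp: m_comm)
  have ne: "x \<otimes> y \<noteq> x \<otimes> z" "x \<otimes> y \<noteq> x \<otimes> w" "x \<otimes> z \<noteq> x \<otimes> w" "y \<otimes> z \<noteq> y \<otimes> w"
    using c yzw by auto
  have ne2: "y \<otimes> z \<noteq> z \<otimes> w" "y \<otimes> w \<noteq> z \<otimes> w" "x \<otimes> y \<noteq> y \<otimes> z" "x \<otimes> y \<noteq> y \<otimes> w"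
    "x \<otimes> z \<noteq> y \<otimes> z" "x \<otimes> z \<noteq> z \<otimes> w" "x \<otimes> w \<noteq> y \<otimes> w" "x \<otimes> w \<noteq> z \<otimes> w"
    using c yzw d by (metis m_comm r_cancel)+
  have f: "finite (rsums 2 S)" using finite_rsums[OF fS] .
  have bound: ?thesis if "Q \<subseteq> rsums 2 S" "card Q = 5" for Q
    using card_mono[OF f that(1)] that(2) by simp
  consider "y \<otimes> w \<noteq> x \<otimes> z" "z \<otimes> w \<noteq> x \<otimes> y" | "y \<otimes> z \<noteq> x \<otimes> w" "z \<otimes> w \<noteq> x \<otimes> y" | "y \<otimes> z \<noteq> x \<otimes> w" "y \<otimes> w \<noteq> x \<otimes> z"
    using k1 k2 k3 by blast
  then show ?thesis
  proof cases
    case 1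
    have "card {x \<otimes> y, x \<otimes> z, x \<otimes> w, y \<otimes> w, z \<otimes> w} = 5" using 1 ne ne2 by auto
    then show ?thesis using p mem d yzw by (intro bound[of "{x \<otimes> y, x \<otimes> z, x \<otimes> w, y \<otimes> w, z \<otimes> w}"]) auto
  next
    case 2
    have "card {x \<otimes> y, x \<otimes> z, x \<otimes> w, y \<otimes> z, z \<otimes> w} = 5" using 2 ne ne2 by auto
    then show ?thesis using p mem d yzw by (intro bound[of "{x \<otimes> y, x \<otimes> z, x \<otimes> w, y \<otimes> z, z \<otimes> w}"]) auto
  next
    case 3
    have "card {x \<otimes> y, x \<otimes> z, x \<otimes> w, y \<otimes> z, y \<otimes> w} = 5" using 3 ne ne2 by auto
    then show ?thesis using p mem d yzw by (intro bound[of "{x \<otimes> y, x \<otimes> z, x \<otimes> w, y \<otimes> z, y \<otimes> w}"]) auto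
  qed
qed

lemma rsums_card_ge_Suc:
  assumes fin: "finite (carrier G)" and H: "subgroup H G" "Factorial_Ring.prime (card H)" and v: "v \<in> carrier G"
    and S: "S \<subseteq> v <# H" "card S + 4 \<le> card H" and j: "2 \<le> j" "j + 2 \<le> card S"
  shows "card S + 1 \<le> card (rsums j S)"
proof -
  have Hc: "H \<subseteq> carrier G" using H subgroup.subset by blast
  have Sc: "S \<subseteq> carrier G" using S coset_subset[OF v Hc] by auto
  have fS: "finite S" using Sc fin finite_subset by auto
  show ?thesis
  proof (cases "card S = 4")
    case True
    have "odd (card H)" using S j by (intro prime_odd_nat H) auto
    moreover have "j = 2" using j True by simp
    ultimately show ?thesis using rsums_2_of_4[OF fin H(1) _ v S(1)] True by simp
  next
    case False
    define c where "c = card S - 2"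
    have c: "card S = c + 2" "3 \<le> c" using j False unfolding c_def by linarith+
    obtain i where i: "j = Suc i" "1 \<le> i" using j by (cases j) auto
    have IH: "c \<le> card (rsums i (S - {x,y}))" if "x \<in> S" "y \<in> S" "x \<noteq> y" for x y
    proof -
      have cc: "card (S - {x,y}) = c" using card_remove_two[OF fS that] c by simp
      have "card (S - {x,y}) \<le> card (rsums i (S - {x,y}))"
        by (rule rsums_card_ge[OF fin H v]) (use cc c i j S in auto)
      then show ?thesis using cc by simp
    qed
    have ne: "S \<noteq> {}" using c by auto
    \<comment> \<open>The room of 4 below \<open>card H\<close> allows \<open>c + 5\<close>
      differences, provided that \<open>c \<ge> 3\<close>; hence the separate treatment of four
      elements.\<close>
    have g: "card (rsums j S) + (c + 5) * c \<le> card (rsums j S) * card (rsums j S)"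
      unfolding i(1) by (rule rsums_growth[OF fin H v S(1) ne IH]) (use c S in auto)
    show ?thesis
    proof (rule ccontr)
      assume "\<not> ?thesis"
      then have t: "card (rsums j S) \<le> c + 2" using c by simp
      then have "card (rsums j S) * card (rsums j S) \<le> card (rsums j S) * (c + 2)" by (intro mult_left_mono) auto
      then have "(c + 5) * c \<le> card (rsums j S) * (c + 1)" using g by simp
      also have "\<dots> \<le> (c + 2) * (c + 1)" using t by (intro mult_right_mono) auto
      finally show False using c by (simp add: algebra_simps)
    qed
  qed
qed

lemma rsums_card_ge_Suc2:
  assumes fin: "finite (carrier G)" and H: "subgroup H G" "Factorial_Ring.prime (card H)" and v: "v \<in> carrier G"
    and S: "S \<subseteq> v <# H" "card S + 4 \<le> card H" and j: "3 \<le> j" "j + 3 \<le> card S"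
  shows "card S + 2 \<le> card (rsums j S)"
proof -
  have Hc: "H \<subseteq> carrier G" using H subgroup.subset by blast
  have Sc: "S \<subseteq> carrier G" using S coset_subset[OF v Hc] by auto
  have fS: "finite S" using Sc fin finite_subset by auto
  \<comment> \<open>With this offset the improved bound for \<open>S\<close> without two elements is
    \<open>c\<close> itself.\<close>
  define c where "c = card S - 1"
  have c: "card S = c + 1" "5 \<le> c" using j unfolding c_def by linarith+
  obtain i where i: "j = Suc i" "2 \<le> i" using j by (cases j) auto
  have IH: "c \<le> card (rsums i (S - {x,y}))" if "x \<in> S" "y \<in> S" "x \<noteq> y" for x y
  proof -
    have cc: "card (S - {x,y}) = c - 1" using card_remove_two[OF fS that] c by simp
    have "card (S - {x,y}) + 1 \<le> card (rsums i (S - {x,y}))"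
      by (rule rsums_card_ge_Suc[OF fin H v]) (use cc c i j S in auto)
    then show ?thesis using cc by simp
  qed
  have ne: "S \<noteq> {}" using c by auto
  have g: "card (rsums j S) + (c + 4) * c \<le> card (rsums j S) * card (rsums j S)"
    unfolding i(1) by (rule rsums_growth[OF fin H v S(1) ne IH]) (use c S in auto)
  show ?thesis
  proof (rule ccontr)
    assume "\<not> ?thesis"
    then have t: "card (rsums j S) \<le> c + 2" using c by simp
    then have "card (rsums j S) * card (rsums j S) \<le> card (rsums j S) * (c + 2)" by (intro mult_left_mono) auto
    then have "(c + 4) * c \<le> card (rsums j S) * (c + 1)" using g by simp
    also have "\<dots> \<le> (c + 2) * (c + 1)" using t by (intro mult_right_mono) auto
    finally show False using c by (simp add: algebra_simps)
  qed
qed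

text \<open>The number of points that a set loses under translation is subadditive.\<close>

lemma overlap_compose:
  assumes "T \<subseteq> carrier G" "finite T" "x \<in> carrier G" "y \<in> carrier G"
  shows "card (T \<inter> (\<lambda>t. x \<otimes> t) ` T) + card (T \<inter> (\<lambda>t. y \<otimes> t) ` T) \<le> card T + card (T \<inter> (\<lambda>t. (x \<otimes> y) \<otimes> t) ` T)"
proof -
  let ?A = "T \<inter> (\<lambda>t. x \<otimes> t) ` T" and ?B = "(\<lambda>t. x \<otimes> t) ` (T \<inter> (\<lambda>t. y \<otimes> t) ` T)"
  have f: "finite ?A" "finite ?B" using assms by auto
  have "card ?B = card (T \<inter> (\<lambda>t. y \<otimes> t) ` T)" using assms by (intro card_translate) auto
  moreover have "card ?A + card ?B = card (?A \<union> ?B) + card (?A \<inter> ?B)" using f by (rule card_Un_Int)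
  moreover have "card (?A \<union> ?B) \<le> card ((\<lambda>t. x \<otimes> t) ` T)" using assms by (intro card_mono) auto
  moreover have "card ((\<lambda>t. x \<otimes> t) ` T) = card T" using assms by (intro card_translate)
  moreover have "?A \<inter> ?B \<subseteq> T \<inter> (\<lambda>t. (x \<otimes> y) \<otimes> t) ` T"
  proof
    fix s assume s: "s \<in> ?A \<inter> ?B"
    then obtain t where t: "t \<in> T" "s = x \<otimes> (y \<otimes> t)" by auto
    have "t \<in> carrier G" using t assms by auto
    then have "s = (x \<otimes> y) \<otimes> t" using t assms by (simp add: m_assoc)
    then show "s \<in> T \<inter> (\<lambda>t. (x \<otimes> y) \<otimes> t) ` T" using s t by auto
  qed
  then have "card (?A \<inter> ?B) \<le> card (T \<inter> (\<lambda>t. (x \<otimes> y) \<otimes> t) ` T)" using assms by (intro card_mono) auto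
  ultimately show ?thesis by linarith
qed

lemma sums0_lower: "finite S \<Longrightarrow> S \<subseteq> carrier G - {\<one>} \<Longrightarrow> card S + 1 \<le> card (sums0 S)"
proof -
  assume S: "finite S" "S \<subseteq> carrier G - {\<one>}"
  have "insert \<one> S \<subseteq> sums0 S" unfolding sums0_eq using subset_subset_sums[of S] S by auto
  then have "card (insert \<one> S) \<le> card (sums0 S)" using finite_sums0[OF S(1)] by (intro card_mono)
  moreover have "\<one> \<notin> S" using S by auto
  ultimately show ?thesis using S by simp
qed

text \<open>If the bound fails for \<open>S\<close> but holds for all \<open>S - {x}\<close>, then the sums lose at most one element under
  translation by each \<open>x \<in> S\<close>, hence at most two under the many translations by \<open>x + y\<close>.\<close>

lemma sums0_card_ge:
  assumes fin: "finite (carrier G)" and H: "subgroup H G" "Factorial_Ring.prime (card H)"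
  shows "S \<subseteq> H - {\<one>} \<Longrightarrow> 2 * card S < card H \<Longrightarrow> 2 * card S \<le> card (sums0 S) + 1"
proof (induction "card S" arbitrary: S rule: less_induct)
  case less
  have Hc: "H \<subseteq> carrier G" using H subgroup.subset by blast
  have Sc: "S \<subseteq> carrier G" "\<one> \<notin> S" using less.prems Hc by auto
  have fS: "finite S" using Sc fin finite_subset by auto
  have low: "card S + 1 \<le> card (sums0 S)" using sums0_lower[OF fS] Sc by auto
  show ?case
  proof (cases "card S \<le> 2")
    case True then show ?thesis using low by linarith
  next
    case False
    define s where "s = card S"
    define U where "U = sums0 S"
    have s3: "3 \<le> s" using False s_def by simp
    have Uc: "U \<subseteq> carrier G" "finite U" unfolding U_def using sums0_carrier[OF Sc(1)] finite_sums0[OF fS] by auto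
    show ?thesis
    proof (rule ccontr)
      assume "\<not> ?thesis"
      then have t: "card U + 2 \<le> 2 * s" unfolding U_def s_def by simp
      have l1: "card U \<le> card (U \<inter> (\<lambda>t. x \<otimes> t) ` U) + 1" if x: "x \<in> S" for x
      proof -
        have xc: "x \<in> carrier G" using x Sc by auto
        have "2 * card (S - {x}) \<le> card (sums0 (S - {x})) + 1"
          by (rule less.hyps) (use x fS less.prems card_Diff1_less[OF fS x] in auto)
        then have IH: "2 * s \<le> card (sums0 (S - {x})) + 3" using x fS s_def by simp
        have sub: "sums0 (S - {x}) \<subseteq> U" unfolding U_def by (intro sums0_mono) auto
        have "(\<lambda>t. x \<otimes> t) ` sums0 (S - {x}) \<subseteq> U"
        proof
          fix r assume "r \<in> (\<lambda>t. x \<otimes> t) ` sums0 (S - {x})"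
          then obtain t where t: "t \<in> sums0 (S - {x})" "r = x \<otimes> t" by auto
          have "x \<in> sums0 {x}" using subset_subset_sums[of "{x}"] subset_sums_sums0[of "{x}"] xc by auto
          then have "x \<otimes> t \<in> sums0 ({x} \<union> (S - {x}))" using t Sc fS xc by (intro sums0_mult) auto
          then show "r \<in> U" using t x unfolding U_def by (simp add: insert_absorb)
        qed
        then have "(\<lambda>t. x \<otimes> t) ` sums0 (S - {x}) \<subseteq> U \<inter> (\<lambda>t. x \<otimes> t) ` U" using sub by auto
        then have "card ((\<lambda>t. x \<otimes> t) ` sums0 (S - {x})) \<le> card (U \<inter> (\<lambda>t. x \<otimes> t) ` U)"
          using Uc by (intro card_mono) auto
        moreover have "card ((\<lambda>t. x \<otimes> t) ` sums0 (S - {x})) = card (sums0 (S - {x}))"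
          using xc sub Uc by (intro card_translate) auto
        ultimately show ?thesis using IH t by linarith
      qed
      define W where "W = insert \<one> S"
      have WH: "W \<subseteq> H" unfolding W_def using less.prems subgroup.one_closed[OF H(1)] by auto
      have W: "W \<subseteq> carrier G" "finite W" "card W = s + 1" unfolding W_def s_def using Sc fS by auto
      have idU: "(\<lambda>t. \<one> \<otimes> t) ` U = U" using Uc by force
      have l1': "card U \<le> card (U \<inter> (\<lambda>t. x \<otimes> t) ` U) + 1" if "x \<in> W" for x
        using l1 that idU unfolding W_def by auto
      define D where "D = W <#> W"
      have Dc: "D \<subseteq> carrier G" unfolding D_def using W set_mult_closed by auto
      have fD: "finite D" using Dc fin finite_subset by auto
      have "W \<subseteq> \<one> <# H" using WH coset_one[OF H(1)] by auto
      then have "min (card H) (card W + card W - 1) \<le> card D"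
        unfolding D_def using W W_def by (intro cauchy_davenport[OF fin H _ _ one_closed]) auto
      then have cD: "2 * s + 1 \<le> card D" using W less.prems s_def by simp
      have "\<one> \<in> W" using W_def by auto
      then have WD: "W \<subseteq> D" unfolding D_def set_mult_def using W by force
      have l2: "card U \<le> card (U \<inter> (\<lambda>t. d \<otimes> t) ` U) + 2" if d: "d \<in> D" for d
      proof -
        obtain x y where xy: "x \<in> W" "y \<in> W" "d = x \<otimes> y" using d unfolding D_def set_mult_def by auto
        have "x \<in> carrier G" "y \<in> carrier G" using xy W by auto
        from overlap_compose[OF Uc this] show ?thesis using l1'[OF xy(1)] l1'[OF xy(2)] xy(3) by simp
      qed
      let ?f = "\<lambda>d. card (U \<inter> (\<lambda>t. d \<otimes> t) ` U)"
      \<comment> \<open>The losses are graded: none for \<open>\<one>\<close>, at most one for the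
        \<open>s\<close> elements of \<open>S\<close>, at most two for at least \<open>s\<close>
        further elements of \<open>D\<close>.\<close>
      have "(\<Sum>d\<in>D. ?f d) = (\<Sum>d\<in>D - W. ?f d) + (\<Sum>d\<in>W. ?f d)" using WD fD by (rule sum.subset_diff)
      also have "(\<Sum>d\<in>W. ?f d) = card U + (\<Sum>d\<in>S. ?f d)" unfolding W_def using fS Sc idU by simp
      finally have tot: "(\<Sum>d\<in>D - W. ?f d) + card U + (\<Sum>d\<in>S. ?f d) \<le> card U * card U"
        using overlap_sum[OF Uc Dc fD] by simp
      define t where "t = card U - 2"
      have t': "card U = t + 2" using low s3 unfolding U_def s_def t_def by linarith
      have "s * (t + 1) \<le> (\<Sum>d\<in>S. ?f d)"
        unfolding s_def using sum_mono[of S "\<lambda>_. t + 1" ?f] l1 t' by fastforce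
      moreover have "s \<le> card (D - W)" using cD card_Diff_subset[OF W(2) WD] W by simp
      then have "s * t \<le> card (D - W) * t" by (intro mult_right_mono) auto
      moreover have "card (D - W) * t \<le> (\<Sum>d\<in>D - W. ?f d)"
        using sum_mono[of "D - W" "\<lambda>_. t" ?f] l2 t' by fastforce
      ultimately have "s * t + (t + 2) + s * (t + 1) \<le> (t + 2) * (t + 2)" using tot unfolding t' by linarith
      then have e: "2 * s * t + s + t + 2 \<le> t * t + 4 * t + 4" by (simp add: algebra_simps)
      have "t + 4 \<le> 2 * s" using t t' by simp
      then have "(t + 4) * t \<le> (2 * s) * t" by (intro mult_right_mono) auto
      then have "s + t \<le> 2" using e by (simp add: algebra_simps)
      then show False using s3 by simp
    qed
  qed
qed

end

subsection \<open>Groups whose order is a product of two primes\<close>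

locale two_prime_group = comm_group G for G (structure) +
  fixes H K :: "'a set"
  assumes fin: "finite (carrier G)"
    and subgroup_H: "subgroup H G" and subgroup_K: "subgroup K G"
    and prime_H: "Factorial_Ring.prime (card H)" and prime_K: "Factorial_Ring.prime (card K)"
    and card_less: "card K < card H" and order_eq: "order G = card K * card H"
begin

section \<open>Decomposition of the group along \<open>H\<close> and \<open>K\<close>\<close>

lemma H_carrier: "H \<subseteq> carrier G" and K_carrier: "K \<subseteq> carrier G"
  using subgroup_H subgroup_K subgroup.subset by blast+

lemma finite_H: "finite H" and finite_K: "finite K"
  using fin H_carrier K_carrier finite_subset by auto

lemma H_inter_K: "H \<inter> K = {\<one>}"
proof -
  have sub: "subgroup (H \<inter> K) G" using subgroups_Inter_pair[OF subgroup_H subgroup_K] .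
  have "card (H \<inter> K) dvd card H" "card (H \<inter> K) dvd card K"
    using subgroup_card_dvd[OF fin sub] subgroup_H subgroup_K by auto
  moreover have "coprime (card H) (card K)"
    using prime_H prime_K card_less by (intro primes_coprime) auto
  ultimately have "card (H \<inter> K) = 1" by (metis coprime_common_divisor_nat)
  then show ?thesis using subgroup.one_closed[OF sub] by (metis card_1_singletonE singletonD)
qed

lemma coset_inj: "c \<in> K \<Longrightarrow> d \<in> K \<Longrightarrow> x \<in> c <# H \<Longrightarrow> x \<in> d <# H \<Longrightarrow> c = d"
proof -
  assume a: "c \<in> K" "d \<in> K" "x \<in> c <# H" "x \<in> d <# H"
  have c: "c \<in> carrier G" "d \<in> carrier G" using a K_carrier by auto
  have "(c \<otimes> inv d) \<otimes> d = c" using c by (simp add: m_assoc)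
  then have "c \<otimes> inv d \<in> H" using coset_cancel[OF subgroup_H, of "c \<otimes> inv d" d x] a c by simp
  moreover have "c \<otimes> inv d \<in> K" using a subgroup_K by (simp add: subgroup_def)
  ultimately have "c \<otimes> inv d = \<one>" using H_inter_K by auto
  then show ?thesis using c by (metis inv_closed inv_equality inv_inv)
qed

lemma carrier_cosets: "carrier G = (\<Union>c\<in>K. c <# H)"
proof (rule card_subset_eq[symmetric])
  show "finite (carrier G)" by (rule fin)
  show "(\<Union>c\<in>K. c <# H) \<subseteq> carrier G" using coset_subset[OF _ H_carrier] K_carrier by auto
  have "card (\<Union>c\<in>K. c <# H) = (\<Sum>c\<in>K. card (c <# H))"
    using finite_K finite_H coset_inj by (intro card_UN_disjoint) (auto simp: l_coset_def[of _ _ H])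
  also have "\<dots> = (\<Sum>c\<in>K. card H)"
    using coset_card[OF _ H_carrier] K_carrier by (intro sum.cong) auto
  finally show "card (\<Union>c\<in>K. c <# H) = card (carrier G)" using order_eq unfolding order_def by simp
qed

text \<open>Since \<open>card K\<close> is prime, \<open>c\<close> has order
  \<open>card K\<close>.\<close>

lemma pow_inj:
  assumes c: "c \<in> K" "c \<noteq> \<one>" and e: "c [^] (i::nat) = c [^] (j::nat)" and l: "i < j + card K" "j < i + card K"
  shows "i = j"
proof -
  have cc: "c \<in> carrier G" using c K_carrier by auto
  have *: "i = j" if "c [^] (i::nat) = c [^] (j::nat)" "i \<le> j" "j < i + card K" for i j
  proof -
    have "c [^] (j - i) \<otimes> c [^] i = c [^] (j - i + i)" using cc by (rule nat_pow_mult)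
    then have "c [^] (j - i) \<otimes> c [^] i = c [^] i" using that by simp
    then have "c [^] (j - i) = \<one>" using cc by (metis l_cancel_one nat_pow_closed m_comm r_cancel_one)
    then have dv: "ord c dvd j - i" using pow_eq_id[OF cc] by simp
    have "ord c dvd card K"
    proof -
      have "c [^] card K = \<one>"
      proof -
        interpret KG: group "G\<lparr>carrier := K\<rparr>" using subgroup_K subgroup_imp_group by blast
        have "c [^]\<^bsub>G\<lparr>carrier := K\<rparr>\<^esub> order (G\<lparr>carrier := K\<rparr>) = \<one>\<^bsub>G\<lparr>carrier := K\<rparr>\<^esub>"
          by (rule KG.pow_order_eq_1) (use c in simp)
        then show ?thesis by (simp add: order_def nat_pow_def)
      qed
      then show ?thesis using pow_eq_id[OF cc] by simp
    qed
    then have "ord c = 1 \<or> ord c = card K" using prime_K by (meson prime_nat_iff)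
    moreover have "ord c \<noteq> 1" using c cc ord_eq_1 by simp
    ultimately have "card K dvd j - i" using dv by simp
    then have "j - i = 0" using that(3) dvd_imp_le[of "card K" "j - i"] by linarith
    then show ?thesis using that by simp
  qed
  show ?thesis using *[of i j] *[of j i] e l by (cases "i \<le> j") auto
qed

text \<open>A progression in \<open>K\<close>: it represents the cosets met by sums from
  \<open>c <# H\<close> as the number of summands runs through \<open>r + 1\<close> consecutive
  values.\<close>

definition powers :: "'a \<Rightarrow> nat \<Rightarrow> nat \<Rightarrow> 'a set" where
  "powers c l r = (\<lambda>j. c [^] j) ` {l..l + r}"

lemma powers_K: "c \<in> K \<Longrightarrow> powers c l r \<subseteq> K"
proof -
  assume "c \<in> K"
  then have "c [^] j \<in> K" for j :: nat
    by (induction j) (use subgroup_K in \<open>auto simp: subgroup_def\<close>)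
  then show ?thesis unfolding powers_def by auto
qed

lemma card_powers: "c \<in> K \<Longrightarrow> c \<noteq> \<one> \<Longrightarrow> min (card K) (r + 1) \<le> card (powers c l r)"
proof -
  assume c: "c \<in> K" "c \<noteq> \<one>"
  define s where "s = min (card K - 1) r"
  have p: "card K > 1" using prime_K prime_gt_1_nat by auto
  have "inj_on (\<lambda>j. c [^] j) {l..l + s}"
    using p by (intro inj_onI pow_inj[OF c]) (auto simp: s_def)
  then have "card ((\<lambda>j. c [^] j) ` {l..l + s}) = s + 1" by (simp add: card_image)
  moreover have "(\<lambda>j. c [^] j) ` {l..l + s} \<subseteq> powers c l r" unfolding powers_def s_def by auto
  moreover have "finite (powers c l r)" unfolding powers_def by auto
  ultimately have "s + 1 \<le> card (powers c l r)" using card_mono by metis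
  then show ?thesis using p unfolding s_def by linarith
qed

text \<open>\<open>K\<close> is a transversal of the cosets of \<open>H\<close>. Both \<open>k\<close> and \<open>r\<close> below are cardinalities minus one, which makes
  them additive under Cauchy--Davenport.\<close>

definition fat :: "'a set \<Rightarrow> 'a set \<Rightarrow> nat \<Rightarrow> bool" where
  "fat R Z k \<longleftrightarrow> R \<subseteq> K \<and> Z \<subseteq> carrier G \<and> (\<forall>c\<in>R. min (card H) (k + 1) \<le> card (Z \<inter> (c <# H)))"

lemma fat_mono: "fat R Z k \<Longrightarrow> Z \<subseteq> Z' \<Longrightarrow> Z' \<subseteq> carrier G \<Longrightarrow> fat R Z' k"
proof -
  assume a: "fat R Z k" "Z \<subseteq> Z'" "Z' \<subseteq> carrier G"
  have "finite Z'" using a fin finite_subset by auto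
  then have "card (Z \<inter> (c <# H)) \<le> card (Z' \<inter> (c <# H))" for c using a by (intro card_mono) auto
  then show ?thesis using a unfolding fat_def by (meson le_trans subset_trans)
qed

text \<open>Cauchy--Davenport in \<open>H\<close>, applied to one pair of cosets
  \<open>a <# H\<close> and \<open>b <# H\<close> for each product
  \<open>a \<otimes> b\<close>.\<close>

lemma fat_mult:
  assumes "fat R Z k" "fat R' Z' k'"
  shows "fat (R <#> R') (Z <#> Z') (k + k')"
  unfolding fat_def
proof (intro conjI ballI)
  have R: "R \<subseteq> K" "R' \<subseteq> K" and Z: "Z \<subseteq> carrier G" "Z' \<subseteq> carrier G" using assms unfolding fat_def by auto
  show "R <#> R' \<subseteq> K" using R subgroup.m_closed[OF subgroup_K] unfolding set_mult_def by auto
  show ZZ: "Z <#> Z' \<subseteq> carrier G" using Z set_mult_closed by auto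
  fix c assume "c \<in> R <#> R'"
  then obtain a b where ab: "a \<in> R" "b \<in> R'" "c = a \<otimes> b" unfolding set_mult_def by auto
  have abc: "a \<in> carrier G" "b \<in> carrier G" using ab R K_carrier by auto
  let ?A = "Z \<inter> (a <# H)" and ?B = "Z' \<inter> (b <# H)"
  have q: "card H > 0" using prime_H prime_gt_0_nat by auto
  have A: "min (card H) (k + 1) \<le> card ?A" and B: "min (card H) (k' + 1) \<le> card ?B"
    using assms ab unfolding fat_def by auto
  have "card ?A \<noteq> 0" "card ?B \<noteq> 0" using A B q by linarith+
  then have "?A \<noteq> {}" "?B \<noteq> {}" using card.empty by metis+
  then have "min (card H) (card ?A + card ?B - 1) \<le> card (?A <#> ?B)"
    using Z abc by (intro cauchy_davenport[OF fin subgroup_H prime_H, of _ b]) auto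
  moreover have "?A <#> ?B \<subseteq> (Z <#> Z') \<inter> (c <# H)"
    using coset_mult[OF subgroup_H abc] ab(3) unfolding set_mult_def by auto
  then have "card (?A <#> ?B) \<le> card ((Z <#> Z') \<inter> (c <# H))"
    using ZZ fin finite_subset by (intro card_mono) auto
  ultimately show "min (card H) (k + k' + 1) \<le> card ((Z <#> Z') \<inter> (c <# H))" using A B by linarith
qed

lemma card_mult_K:
  assumes "R \<subseteq> K" "R' \<subseteq> K" "min (card K) (r + 1) \<le> card R" "min (card K) (r' + 1) \<le> card R'"
  shows "min (card K) (r + r' + 1) \<le> card (R <#> R')"
proof -
  have p: "card K > 0" using prime_K prime_gt_0_nat by auto
  have "card R \<noteq> 0" "card R' \<noteq> 0" using assms p by linarith+
  then have "R \<noteq> {}" "R' \<noteq> {}" using card.empty by metis+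
  then have "min (card K) (card R + card R' - 1) \<le> card (R <#> R')"
    using assms K_carrier coset_one[OF subgroup_K] by (intro cauchy_davenport[OF fin subgroup_K prime_K _ _ one_closed]) auto
  then show ?thesis using assms by linarith
qed

text \<open>Only a lower bound for the number of good cosets is kept, not which ones they are. This
  is all that Cauchy--Davenport in \<open>K\<close> asks for, so that both \<open>k\<close> and
  \<open>r\<close> simply add up.\<close>

definition dense :: "'a set \<Rightarrow> nat \<Rightarrow> nat \<Rightarrow> bool" where
  "dense Z k r \<longleftrightarrow> (\<exists>R. min (card K) (r + 1) \<le> card R \<and> fat R Z k)"

lemma dense_mult: "dense Z k r \<Longrightarrow> dense Z' k' r' \<Longrightarrow> dense (Z <#> Z') (k + k') (r + r')"
  unfolding dense_def using card_mult_K fat_mult by (metis fat_def)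

lemma dense_mono: "dense Z k r \<Longrightarrow> Z \<subseteq> Z' \<Longrightarrow> Z' \<subseteq> carrier G \<Longrightarrow> dense Z' k r"
  unfolding dense_def using fat_mono by blast

lemma dense_full:
  assumes "dense Z k r" "card H \<le> k + 1" "card K \<le> r + 1"
  shows "carrier G \<subseteq> Z"
proof -
  obtain R where R: "min (card K) (r + 1) \<le> card R" "fat R Z k" using assms dense_def by auto
  then have "R = K" using assms finite_K unfolding fat_def by (intro card_seteq) auto
  then have f: "card H \<le> card (Z \<inter> (c <# H))" if "c \<in> K" for c
    using R that assms unfolding fat_def by auto
  have "c <# H \<subseteq> Z" if c: "c \<in> K" for c
  proof -
    have "finite (c <# H)" using finite_H by (auto simp: l_coset_def)
    then have "Z \<inter> (c <# H) = c <# H"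
      using f[OF c] coset_card[OF _ H_carrier, of c] c K_carrier by (intro card_seteq) auto
    then show ?thesis by auto
  qed
  then show ?thesis using carrier_cosets by auto
qed

section \<open>Contributions of single cosets and their assembly\<close>

lemma finite_sub: "B \<subseteq> carrier G \<Longrightarrow> finite B"
  using finite_subset[OF _ fin] .

text \<open>Here the Cauchy--Davenport bound is improved by one, as the two progressions have different steps.\<close>

lemma card_powers_mult:
  assumes c: "c \<in> K" "c \<noteq> \<one>" and d: "d \<in> K" "d \<noteq> \<one>" and cd: "c \<noteq> d" "c \<noteq> inv d"
    and r: "1 \<le> r" "1 \<le> r'"
  shows "min (card K) (r + r' + 2) \<le> card (powers c l r <#> powers d l' r')"
proof -
  have cc: "c \<in> carrier G" "d \<in> carrier G" using c d K_carrier by auto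
  define u where "u = c [^] l \<otimes> d [^] l'"
  have uc: "u \<in> carrier G" using cc u_def by simp
  \<comment> \<open>The start of both progressions contains a translate of
    \<open>{\<one>, c, d, c \<otimes> d}\<close>, with four distinct elements as \<open>c\<close> is
    neither \<open>d\<close> nor \<open>inv d\<close>: one more than Cauchy--Davenport gives. The
    remaining lengths are added by it.\<close>
  define Q where "Q = powers c l 1 <#> powers d l' 1"
  have QK: "Q \<subseteq> K" unfolding Q_def set_mult_def
    using powers_K[OF c(1)] powers_K[OF d(1)] subgroup.m_closed[OF subgroup_K] by blast
  have "u \<otimes> \<one> \<in> Q" "u \<otimes> c \<in> Q" "u \<otimes> d \<in> Q" "u \<otimes> (c \<otimes> d) \<in> Q"
  proof -
    have *: "c [^] i \<otimes> d [^] j \<in> Q" if "i \<in> {l..l + 1}" "j \<in> {l'..l' + 1}" for i j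
      using that unfolding Q_def set_mult_def powers_def by blast
    show "u \<otimes> \<one> \<in> Q" "u \<otimes> c \<in> Q" "u \<otimes> d \<in> Q" "u \<otimes> (c \<otimes> d) \<in> Q"
      using *[of l l'] *[of "l + 1" l'] *[of l "l' + 1"] *[of "l + 1" "l' + 1"] cc
      unfolding u_def by (simp_all add: m_ac)
  qed
  then have sub: "{u \<otimes> \<one>, u \<otimes> c, u \<otimes> d, u \<otimes> (c \<otimes> d)} \<subseteq> Q" by auto
  have "c \<otimes> d \<noteq> \<one>" using cd cc by (metis inv_equality inv_inv)
  then have "card {\<one>, c, d, c \<otimes> d} = 4" using c d cd cc by auto
  moreover have "card ((\<lambda>x. u \<otimes> x) ` {\<one>, c, d, c \<otimes> d}) = card {\<one>, c, d, c \<otimes> d}"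
    using cc uc by (intro card_translate) auto
  ultimately have "card {u \<otimes> \<one>, u \<otimes> c, u \<otimes> d, u \<otimes> (c \<otimes> d)} = 4" by simp
  then have cQ: "min (card K) (3 + 1) \<le> card Q"
    using card_mono[OF finite_subset[OF QK finite_K] sub] by linarith
  let ?P = "powers c 0 (r - 1)" and ?R = "powers d 0 (r' - 1)"
  have "min (card K) (3 + (r - 1) + 1) \<le> card (Q <#> ?P)"
    using card_mult_K[OF QK powers_K[OF c(1)] cQ card_powers[OF c]] .
  moreover have QP: "Q <#> ?P \<subseteq> K" unfolding set_mult_def
    using powers_K[OF c(1)] QK subgroup.m_closed[OF subgroup_K] by blast
  ultimately have "min (card K) (3 + (r - 1) + (r' - 1) + 1) \<le> card ((Q <#> ?P) <#> ?R)"
    using card_mult_K[OF QP powers_K[OF d(1)] _ card_powers[OF d]] by blast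
  moreover have "(Q <#> ?P) <#> ?R \<subseteq> powers c l r <#> powers d l' r'"
  proof
    fix x assume "x \<in> (Q <#> ?P) <#> ?R"
    then obtain i j i' j' where x: "x = ((c [^] i \<otimes> d [^] j) \<otimes> c [^] i') \<otimes> d [^] j'"
      "i \<in> {l..l + 1}" "j \<in> {l'..l' + 1}" "i' \<in> {0..r - 1}" "j' \<in> {0..r' - 1}"
      unfolding Q_def set_mult_def powers_def by auto
    have "x = (c [^] i \<otimes> c [^] i') \<otimes> (d [^] j \<otimes> d [^] j')" unfolding x(1) using cc by (simp add: m_ac)
    also have "\<dots> = c [^] (i + i') \<otimes> d [^] (j + j')" using cc by (simp add: nat_pow_mult)
    finally have xx: "x = c [^] (i + i') \<otimes> d [^] (j + j')" .
    have "i + i' \<in> {l..l + r}" "j + j' \<in> {l'..l' + r'}" using x(2-5) r by auto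
    then have "c [^] (i + i') \<in> powers c l r" "d [^] (j + j') \<in> powers d l' r'" unfolding powers_def by blast+
    then show "x \<in> powers c l r <#> powers d l' r'" unfolding xx set_mult_def by blast
  qed
  then have "card ((Q <#> ?P) <#> ?R) \<le> card (powers c l r <#> powers d l' r')"
    unfolding set_mult_def powers_def by (intro card_mono) auto
  ultimately show ?thesis using r by simp
qed

text \<open>The parameter \<open>l\<close> says that only \<open>j\<close>-fold sums with \<open>l \<le> j \<le> a - l\<close> of the \<open>a\<close> elements in
  one coset are used.\<close>

definition gain :: "nat \<Rightarrow> nat \<Rightarrow> nat" where
  "gain l a = (if l = 0 then 0 else a - 2 + l)"

text \<open>The requirements of \<open>rsums_card_ge\<close>, \<open>rsums_card_ge_Suc\<close> and
  \<open>rsums_card_ge_Suc2\<close> for \<open>l\<close> equal to 1, 2 and 3;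
  \<open>2 * l \<le> a\<close> keeps the range of \<open>j\<close> nonempty.\<close>

definition admissible :: "nat \<Rightarrow> nat \<Rightarrow> bool" where
  "admissible l a \<longleftrightarrow> l \<le> 3 \<and> 2 * l \<le> a \<and> (l = 1 \<longrightarrow> a < card H) \<and> (2 \<le> l \<longrightarrow> a + 4 \<le> card H)"

text \<open>Each \<open>j\<close> in the range contributes one coset. For \<open>l = 0\<close> the
  range contains \<open>j = 0\<close>, so the empty sum has to be allowed.\<close>

lemma fat_coset_sums:
  assumes c: "c \<in> K" "c \<noteq> \<one>" and S: "S \<subseteq> c <# H" and l: "admissible l (card S)"
  shows "fat (powers c l (card S - 2 * l)) (if l = 0 then sums0 S else subset_sums G S) (gain l (card S))"
    (is "fat ?R ?Z ?k")
  unfolding fat_def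
proof (intro conjI ballI)
  have cc: "c \<in> carrier G" using c K_carrier by auto
  have Sc: "S \<subseteq> carrier G" using S coset_subset[OF cc H_carrier] by auto
  have fS: "finite S" using Sc fin finite_subset by auto
  show "?R \<subseteq> K" using powers_K[OF c(1)] .
  show Zc: "?Z \<subseteq> carrier G" using sums0_carrier[OF Sc] subset_sums_carrier[OF Sc] by auto
  fix d assume "d \<in> ?R"
  then obtain j where j: "d = c [^] j" "l \<le> j" "j + l \<le> card S"
    using l unfolding powers_def admissible_def by auto
  have "rsums j S \<subseteq> ?Z"
  proof (cases "l = 0")
    case True then show ?thesis using rsums_sums0 by auto
  next
    case False then show ?thesis using rsums_subset_sums[of j S] j by auto
  qed
  then have "rsums j S \<subseteq> ?Z \<inter> (d <# H)" using rsums_coset[OF subgroup_H cc fS S, of j] j by auto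
  then have le: "card (rsums j S) \<le> card (?Z \<inter> (d <# H))"
    using finite_sub[OF Zc] by (intro card_mono finite_Int) auto
  consider "l = 0" | "l = 1" | "l = 2" | "l = 3" using l unfolding admissible_def by linarith
  then have "?k + 1 \<le> card (rsums j S)"
  proof cases
    case 1
    obtain B where "B \<subseteq> S" "card B = j" using obtain_subset_with_card_n[of j S] j by auto
    then have "rsums j S \<noteq> {}" unfolding rsums_def by auto
    then have "card (rsums j S) > 0" using finite_rsums[OF fS] card_gt_0_iff by auto
    then show ?thesis using 1 unfolding gain_def by simp
  next
    case 2
    then show ?thesis using rsums_card_ge[OF fin subgroup_H prime_H cc S, of j] l j
      unfolding admissible_def gain_def by simp
  next
    case 3
    then show ?thesis using rsums_card_ge_Suc[OF fin subgroup_H prime_H cc S, of j] l j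
      unfolding admissible_def gain_def by simp
  next
    case 4
    then show ?thesis using rsums_card_ge_Suc2[OF fin subgroup_H prime_H cc S, of j] l j
      unfolding admissible_def gain_def by simp
  qed
  then show "min (card H) (?k + 1) \<le> card (?Z \<inter> (d <# H))" using le by linarith
qed

lemma dense_coset_sums:
  assumes c: "c \<in> K" "c \<noteq> \<one>" and S: "S \<subseteq> c <# H" and l: "admissible l (card S)"
  shows "dense (sums0 S) (gain l (card S)) (card S - 2 * l)"
    and "1 \<le> l \<Longrightarrow> dense (subset_sums G S) (gain l (card S)) (card S - 2 * l)"
proof -
  have "c \<in> carrier G" using c K_carrier by auto
  then have Sc: "S \<subseteq> carrier G" using S coset_subset[OF _ H_carrier] by blast
  have d: "dense (if l = 0 then sums0 S else subset_sums G S) (gain l (card S)) (card S - 2 * l)"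
    unfolding dense_def using fat_coset_sums[OF assms] card_powers[OF c] by blast
  then show "dense (sums0 S) (gain l (card S)) (card S - 2 * l)"
    using dense_mono[OF d, of "sums0 S"] subset_sums_sums0 sums0_carrier[OF Sc] by auto
  show "1 \<le> l \<Longrightarrow> dense (subset_sums G S) (gain l (card S)) (card S - 2 * l)" using d by simp
qed

lemma dense_union:
  assumes "S \<subseteq> carrier G" "T \<subseteq> carrier G" "S \<inter> T = {}" "dense (subset_sums G S) k r" "dense (sums0 T) k' r'"
  shows "dense (subset_sums G (S \<union> T)) (k + k') (r + r')"
proof (rule dense_mono[OF dense_mult[OF assms(4,5)]])
  have "finite S" "finite T" using assms finite_sub by auto
  then show "subset_sums G S <#> sums0 T \<subseteq> subset_sums G (S \<union> T)"
    using subset_sums_mult[OF assms(1,2)] assms(3) unfolding set_mult_def by auto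
  show "subset_sums G (S \<union> T) \<subseteq> carrier G" using assms by (intro subset_sums_carrier) auto
qed

text \<open>The sums \<open>\<one>\<close> and \<open>x\<close> lie in two different cosets of
  \<open>H\<close>.\<close>

lemma dense_singleton:
  assumes "x \<in> carrier G" "x \<notin> H"
  shows "dense (sums0 {x}) 0 1"
proof -
  obtain c where c: "c \<in> K" "x \<in> c <# H" using assms carrier_cosets by auto
  have "c \<noteq> \<one>" using c assms coset_one[OF subgroup_H] by auto
  then show ?thesis using dense_coset_sums(1)[of c "{x}" 0] c unfolding admissible_def gain_def by simp
qed

text \<open>Taken one at a time, elements outside \<open>H\<close> are worth one coset each, however
  they are distributed.\<close>

lemma dense_outside:
  assumes "finite T" "T \<subseteq> carrier G - H" "S \<subseteq> carrier G" "S \<inter> T = {}" "dense (subset_sums G S) k r"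
  shows "dense (subset_sums G (S \<union> T)) k (r + card T)"
  using assms
proof (induction T rule: finite_induct)
  case empty then show ?case by simp
next
  case (insert x T)
  have "dense (subset_sums G ((S \<union> T) \<union> {x})) (k + 0) ((r + card T) + 1)"
    using insert dense_singleton[of x] by (intro dense_union) auto
  then show ?case using insert by simp
qed

lemma dense_cosets:
  assumes A: "A \<subseteq> carrier G" and C: "finite C" "C \<subseteq> K - {\<one>}" and S: "S \<subseteq> carrier G" "\<And>c. c \<in> C \<Longrightarrow> S \<inter> (c <# H) = {}"
    and l: "\<And>c. c \<in> C \<Longrightarrow> admissible (l c) (card (A \<inter> (c <# H)))" and d: "dense (subset_sums G S) k r"
  shows "dense (subset_sums G (S \<union> (\<Union>c\<in>C. A \<inter> (c <# H))))
    (k + (\<Sum>c\<in>C. gain (l c) (card (A \<inter> (c <# H))))) (r + (\<Sum>c\<in>C. card (A \<inter> (c <# H)) - 2 * l c))"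
  using C S(2) l
proof (induction C rule: finite_induct)
  case empty then show ?case using d by simp
next
  case (insert c C)
  let ?S = "S \<union> (\<Union>c\<in>C. A \<inter> (c <# H))" and ?T = "A \<inter> (c <# H)"
  have "?S \<inter> ?T = {}"
  proof -
    have "x \<notin> ?T" if "x \<in> A \<inter> (b <# H)" "b \<in> C" for x b
      using coset_inj[of b c x] that insert by auto
    moreover have "S \<inter> ?T = {}" using insert.prems(2)[of c] by auto
    ultimately show ?thesis by auto
  qed
  moreover have "dense (sums0 ?T) (gain (l c) (card ?T)) (card ?T - 2 * l c)"
    using insert by (intro dense_coset_sums(1)[of c]) auto
  moreover have "dense (subset_sums G ?S)
    (k + (\<Sum>c\<in>C. gain (l c) (card (A \<inter> (c <# H))))) (r + (\<Sum>c\<in>C. card (A \<inter> (c <# H)) - 2 * l c))"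
    using insert by (intro insert.IH) auto
  ultimately have "dense (subset_sums G (?S \<union> ?T))
    (k + (\<Sum>c\<in>C. gain (l c) (card (A \<inter> (c <# H)))) + gain (l c) (card ?T))
    (r + (\<Sum>c\<in>C. card (A \<inter> (c <# H)) - 2 * l c) + (card ?T - 2 * l c))"
    by (intro dense_union[of ?S ?T]) (use A S(1) in auto)
  moreover have "?S \<union> ?T = S \<union> (\<Union>c\<in>insert c C. A \<inter> (c <# H))" by auto
  ultimately show ?case using insert by (simp add: algebra_simps)
qed

lemma dense_in_H:
  assumes "S \<subseteq> H" "k + 1 \<le> card (sums0 S)"
  shows "dense (sums0 S) k 0"
proof -
  have "finite S" using assms finite_H finite_subset by auto
  then have "sums0 S \<subseteq> H" unfolding sums0_eq
    using subset_sums_subgroup[OF subgroup_H _ assms(1)] subgroup.one_closed[OF subgroup_H] by auto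
  then have "fat {\<one>} (sums0 S) k"
    unfolding fat_def using assms H_carrier coset_one[OF subgroup_H] subgroup.one_closed[OF subgroup_K]
    by (auto simp: Int_absorb2)
  moreover have "card {\<one>} = 1" by simp
  ultimately show ?thesis unfolding dense_def by (metis add_0 min.cobounded2)
qed

lemma disjoint_H: "c \<in> K \<Longrightarrow> c \<noteq> \<one> \<Longrightarrow> H \<inter> (c <# H) = {}"
  using coset_inj[of \<one> c] coset_one[OF subgroup_H] subgroup.one_closed[OF subgroup_K] by blast

text \<open>Contributions add up over disjoint parts of \<open>A\<close>, and
  \<open>dense_full\<close> asks for totals of \<open>card H - 1\<close> and
  \<open>card K - 1\<close>. The cosets in \<open>C\<close> are treated beforehand, because their
  part has to supply nonempty sums and possibly an improved number of cosets.\<close>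

lemma assemble_core:
  assumes A: "A \<subseteq> carrier G" and C: "C \<subseteq> K - {\<one>}" and d: "dense (subset_sums G (\<Union>c\<in>C. A \<inter> (c <# H))) k r"
    and l: "\<And>c. c \<in> K - {\<one>} - C \<Longrightarrow> admissible (l c) (card (A \<inter> (c <# H)))"
    and e: "e + 1 \<le> card (sums0 (A \<inter> H))"
    and k: "card H \<le> e + k + (\<Sum>c\<in>K - {\<one>} - C. gain (l c) (card (A \<inter> (c <# H)))) + 1"
    and r: "card K \<le> r + (\<Sum>c\<in>K - {\<one>} - C. card (A \<inter> (c <# H)) - 2 * l c) + 1"
  shows "carrier G \<subseteq> subset_sums G A"
proof -
  let ?S = "\<Union>c\<in>C. A \<inter> (c <# H)" and ?T = "\<Union>c\<in>K - {\<one>} - C. A \<inter> (c <# H)"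
  have "dense (subset_sums G (?S \<union> ?T)) (k + (\<Sum>c\<in>K - {\<one>} - C. gain (l c) (card (A \<inter> (c <# H)))))
    (r + (\<Sum>c\<in>K - {\<one>} - C. card (A \<inter> (c <# H)) - 2 * l c))"
  proof (rule dense_cosets[OF A _ _ _ _ l d])
    fix c assume c: "c \<in> K - {\<one>} - C"
    have "x \<notin> c <# H" if "x \<in> b <# H" "b \<in> C" for x b using coset_inj[of b c x] that c C by auto
    then show "?S \<inter> (c <# H) = {}" by auto
  qed (use A finite_K in auto)
  moreover have "(?S \<union> ?T) \<inter> (A \<inter> H) = {}" using disjoint_H C by auto
  ultimately have "dense (subset_sums G ((?S \<union> ?T) \<union> (A \<inter> H)))
    (k + (\<Sum>c\<in>K - {\<one>} - C. gain (l c) (card (A \<inter> (c <# H)))) + e)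
    (r + (\<Sum>c\<in>K - {\<one>} - C. card (A \<inter> (c <# H)) - 2 * l c) + 0)"
    by (intro dense_union[of "?S \<union> ?T" "A \<inter> H"]) (use A e dense_in_H[of "A \<inter> H" e] in auto)
  then have "carrier G \<subseteq> subset_sums G ((?S \<union> ?T) \<union> (A \<inter> H))" by (rule dense_full) (use k r in auto)
  also have "\<dots> \<subseteq> subset_sums G A" by (intro subset_sums_mono) auto
  finally show ?thesis .
qed

text \<open>The coset of \<open>c0\<close>, where \<open>l c0\<close> is positive, is the factor
  that guarantees nonempty sums.\<close>

lemma assemble:
  assumes A: "A \<subseteq> carrier G" and c: "c0 \<in> K - {\<one>}" "1 \<le> l c0"
    and l: "\<And>c. c \<in> K - {\<one>} \<Longrightarrow> admissible (l c) (card (A \<inter> (c <# H)))"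
    and e: "e + 1 \<le> card (sums0 (A \<inter> H))"
    and k: "card H \<le> e + (\<Sum>c\<in>K - {\<one>}. gain (l c) (card (A \<inter> (c <# H)))) + 1"
    and r: "card K \<le> (\<Sum>c\<in>K - {\<one>}. card (A \<inter> (c <# H)) - 2 * l c) + 1"
  shows "carrier G \<subseteq> subset_sums G A"
proof -
  let ?S = "A \<inter> (c0 <# H)"
  have D: "dense (subset_sums G (\<Union>c\<in>{c0}. A \<inter> (c <# H))) (gain (l c0) (card ?S)) (card ?S - 2 * l c0)"
    using dense_coset_sums(2)[of c0 ?S "l c0"] c l by simp
  have s1: "sum F (K - {\<one>}) = F c0 + sum F (K - {\<one>} - {c0})" for F :: "'a \<Rightarrow> nat"
    using sum.remove[of "K - {\<one>}" c0 F] finite_K c by simp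
  show ?thesis
  proof (rule assemble_core[OF A _ D _ e])
    show "{c0} \<subseteq> K - {\<one>}" using c by auto
    show "admissible (l b) (card (A \<inter> (b <# H)))" if "b \<in> K - {\<one>} - {c0}" for b using l that by auto
    show "card H \<le> e + gain (l c0) (card ?S) +
        (\<Sum>b\<in>K - {\<one>} - {c0}. gain (l b) (card (A \<inter> (b <# H)))) + 1"
      using k s1[of "\<lambda>b. gain (l b) (card (A \<inter> (b <# H)))"] by linarith
    show "card K \<le> (card ?S - 2 * l c0) +
        (\<Sum>b\<in>K - {\<one>} - {c0}. card (A \<inter> (b <# H)) - 2 * l b) + 1"
      using r s1[of "\<lambda>b. card (A \<inter> (b <# H)) - 2 * l b"] by linarith
  qed
qed

text \<open>The pair \<open>c\<close>, \<open>d\<close> brings one coset more by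
  \<open>card_powers_mult\<close>, so the ledger of \<open>K\<close> may be short by one. The strict
  inequalities give both progressions positive length.\<close>

lemma assemble_pair:
  assumes A: "A \<subseteq> carrier G" and c: "c \<in> K - {\<one>}" "d \<in> K - {\<one>}" "c \<noteq> d" "c \<noteq> inv d"
    and lc: "1 \<le> l c" "2 * l c < card (A \<inter> (c <# H))" "2 * l d < card (A \<inter> (d <# H))"
    and l: "\<And>c. c \<in> K - {\<one>} \<Longrightarrow> admissible (l c) (card (A \<inter> (c <# H)))"
    and e: "e + 1 \<le> card (sums0 (A \<inter> H))"
    and k: "card H \<le> e + (\<Sum>c\<in>K - {\<one>}. gain (l c) (card (A \<inter> (c <# H)))) + 1"
    and r: "card K \<le> (\<Sum>c\<in>K - {\<one>}. card (A \<inter> (c <# H)) - 2 * l c) + 2"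
  shows "carrier G \<subseteq> subset_sums G A"
proof -
  let ?S = "A \<inter> (c <# H)" and ?T = "A \<inter> (d <# H)"
  let ?R = "powers c (l c) (card ?S - 2 * l c)" and ?Q = "powers d (l d) (card ?T - 2 * l d)"
  have fS: "finite ?S" "finite ?T" using A fin finite_subset by auto
  have dis: "?S \<inter> ?T = {}" using coset_inj[of c d] c by auto
  have c1: "fat ?R (subset_sums G ?S) (gain (l c) (card ?S))"
    using fat_coset_sums[of c ?S "l c"] c l lc by simp
  have "fat ?Q (if l d = 0 then sums0 ?T else subset_sums G ?T) (gain (l d) (card ?T))"
    using fat_coset_sums[of d ?T "l d"] c l by simp
  then have c2: "fat ?Q (sums0 ?T) (gain (l d) (card ?T))"
    by (rule fat_mono) (use subset_sums_sums0[of ?T] sums0_carrier[of ?T] A in auto)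
  have "fat (?R <#> ?Q) (subset_sums G ?S <#> sums0 ?T) (gain (l c) (card ?S) + gain (l d) (card ?T))"
    using fat_mult[OF c1 c2] .
  then have "fat (?R <#> ?Q) (subset_sums G (?S \<union> ?T)) (gain (l c) (card ?S) + gain (l d) (card ?T))"
  proof (rule fat_mono)
    show "subset_sums G ?S <#> sums0 ?T \<subseteq> subset_sums G (?S \<union> ?T)"
      using subset_sums_mult[of ?S ?T] A fS dis unfolding set_mult_def by auto
    show "subset_sums G (?S \<union> ?T) \<subseteq> carrier G" using A by (intro subset_sums_carrier) auto
  qed
  moreover have "min (card K) ((card ?S - 2 * l c) + (card ?T - 2 * l d) + 2) \<le> card (?R <#> ?Q)"
    using c lc by (intro card_powers_mult) auto
  ultimately have D: "dense (subset_sums G (\<Union>b\<in>{c,d}. A \<inter> (b <# H)))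
    (gain (l c) (card ?S) + gain (l d) (card ?T)) ((card ?S - 2 * l c) + (card ?T - 2 * l d) + 1)"
    unfolding dense_def by auto
  have s2: "sum F (K - {\<one>}) = F c + F d + sum F (K - {\<one>} - {c,d})" for F :: "'a \<Rightarrow> nat"
  proof -
    have "K - {\<one>} - {c} - {d} = K - {\<one>} - {c,d}" by auto
    then show ?thesis
      using sum.remove[of "K - {\<one>}" c F] sum.remove[of "K - {\<one>} - {c}" d F] finite_K c by simp
  qed
  show ?thesis
  proof (rule assemble_core[OF A _ D _ e])
    show "{c,d} \<subseteq> K - {\<one>}" using c by auto
    show "admissible (l b) (card (A \<inter> (b <# H)))" if "b \<in> K - {\<one>} - {c,d}" for b using l that by auto
    show "card H \<le> e + (gain (l c) (card ?S) + gain (l d) (card ?T)) +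
        (\<Sum>b\<in>K - {\<one>} - {c,d}. gain (l b) (card (A \<inter> (b <# H)))) + 1"
      using k s2[of "\<lambda>b. gain (l b) (card (A \<inter> (b <# H)))"] by linarith
    show "card K \<le> (card ?S - 2 * l c) + (card ?T - 2 * l d) + 1 +
        (\<Sum>b\<in>K - {\<one>} - {c,d}. card (A \<inter> (b <# H)) - 2 * l b) + 1"
      using r s2[of "\<lambda>b. card (A \<inter> (b <# H)) - 2 * l b"] by linarith
  qed
qed

lemma card_cosets:
  assumes "A \<subseteq> carrier G"
  shows "card A = card (A \<inter> H) + (\<Sum>c\<in>K - {\<one>}. card (A \<inter> (c <# H)))"
proof -
  have fA: "finite A" using assms fin finite_subset by auto
  have "A = (\<Union>c\<in>K. A \<inter> (c <# H))" using assms carrier_cosets by auto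
  then have "card A = card (\<Union>c\<in>K. A \<inter> (c <# H))" by simp
  also have "\<dots> = (\<Sum>c\<in>K. card (A \<inter> (c <# H)))"
    using finite_K fA coset_inj by (intro card_UN_disjoint) auto
  also have "\<dots> = card (A \<inter> (\<one> <# H)) + (\<Sum>c\<in>K - {\<one>}. card (A \<inter> (c <# H)))"
    using finite_K subgroup.one_closed[OF subgroup_K] by (intro sum.remove)
  finally show ?thesis using coset_one[OF subgroup_H] by simp
qed

text \<open>Once all of \<open>H\<close> is reached, each element outside \<open>H\<close> adds a
  coset, so \<open>card K - 1\<close> of them would complete \<open>A\<close>. With
  \<open>card K - 2\<close> of them, two elements whose cosets are neither equal nor inverse
  complete it as well: their sums meet four cosets where three are counted.\<close>

lemma large_H_part:
  assumes A: "A \<subseteq> carrier G - {\<one>}" "subset_sums G A \<noteq> carrier G"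
    and full: "S \<subseteq> A \<inter> H" "subset_sums G S = H"
  shows "card (A - H) + 2 \<le> card K"
    and "x \<in> A - H \<Longrightarrow> y \<in> A - H \<Longrightarrow> card K \<le> card (A - H) + 2 \<Longrightarrow> y \<in> (x <# H) \<union> (inv x <# H)"
proof -
  have Ac: "A \<subseteq> carrier G" using A by auto
  have fA: "finite A" using Ac fin finite_subset by auto
  have nsub: "\<not> carrier G \<subseteq> subset_sums G A" using A subset_sums_carrier[OF Ac] by auto
  have Sc: "S \<subseteq> carrier G" using full H_carrier by auto
  have q: "card H > 0" and p: "card K > 1" using prime_H prime_gt_0_nat prime_K prime_gt_1_nat by auto
  have "fat {\<one>} (subset_sums G S) (card H - 1)"
    unfolding fat_def full(2) using H_carrier coset_one[OF subgroup_H] subgroup.one_closed[OF subgroup_K] by auto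
  then have d: "dense (subset_sums G S) (card H - 1) 0" unfolding dense_def by (intro exI[of _ "{\<one>}"]) auto
  have "dense (subset_sums G (S \<union> (A - H))) (card H - 1) (0 + card (A - H))"
    using Sc fA Ac full by (intro dense_outside d) auto
  moreover have "subset_sums G (S \<union> (A - H)) \<subseteq> subset_sums G A" using full by (intro subset_sums_mono) auto
  ultimately have "\<not> card K \<le> card (A - H) + 1"
    using dense_full[of "subset_sums G (S \<union> (A - H))" "card H - 1" "card (A - H)"] nsub q by auto
  then show "card (A - H) + 2 \<le> card K" by simp
  assume xy: "x \<in> A - H" "y \<in> A - H" and pc: "card K \<le> card (A - H) + 2"
  show "y \<in> (x <# H) \<union> (inv x <# H)"
  proof (rule ccontr)
    assume n: "y \<notin> (x <# H) \<union> (inv x <# H)"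
    have xc: "x \<in> carrier G" "y \<in> carrier G" using xy Ac by auto
    obtain c d where cd: "c \<in> K" "x \<in> c <# H" "d \<in> K" "y \<in> d <# H" using xc carrier_cosets by auto
    have cdc: "c \<in> carrier G" "d \<in> carrier G" using cd K_carrier by auto
    have one: "c \<noteq> \<one>" "d \<noteq> \<one>" using cd xy coset_one[OF subgroup_H] by auto
    have xH: "x <# H = c <# H" using coset_eq[OF subgroup_H cdc(1) cd(2)] .
    have ne: "c \<noteq> d" using n cd xH by auto
    have "c \<noteq> inv d"
    proof
      assume "c = inv d"
      then have "d = inv c" using cdc by simp
      moreover have "\<one> \<in> (inv c \<otimes> c) <# H"
        using coset_one[OF subgroup_H] subgroup.one_closed[OF subgroup_H] cdc by simp
      then have "\<one> \<otimes> inv x \<in> inv c <# H" using coset_div[OF subgroup_H _ cdc(1) _ cd(2)] cdc by simp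
      ultimately have "inv x \<in> d <# H" using xc by simp
      then have "inv x <# H = d <# H" using coset_eq[OF subgroup_H cdc(2)] by simp
      then show False using n cd by simp
    qed
    then have "min (card K) (1 + 1 + 2) \<le> card (powers c 0 1 <#> powers d 0 1)"
      using cd one ne by (intro card_powers_mult) auto
    moreover have "1 + 1 + 2 = 3 + (1::nat)" by simp
    moreover have "fat (powers c 0 1) (sums0 {x}) 0" "fat (powers d 0 1) (sums0 {y}) 0"
      using fat_coset_sums[of c "{x}" 0] fat_coset_sums[of d "{y}" 0] cd one
      unfolding admissible_def gain_def by auto
    then have "fat (powers c 0 1 <#> powers d 0 1) (sums0 {x} <#> sums0 {y}) (0 + 0)" by (rule fat_mult)
    ultimately have "dense (sums0 {x} <#> sums0 {y}) 0 3" unfolding dense_def by (metis add_0)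
    then have "dense (sums0 ({x} \<union> {y})) 0 3"
    proof (rule dense_mono)
      have "x \<noteq> y" using n coset_self[OF subgroup_H xc(1)] by auto
      then show "sums0 {x} <#> sums0 {y} \<subseteq> sums0 ({x} \<union> {y})"
        using sums0_mult[of "{x}" "{y}"] xc unfolding set_mult_def by auto
      show "sums0 ({x} \<union> {y}) \<subseteq> carrier G" using xc by (intro sums0_carrier) auto
    qed
    then have "dense (subset_sums G (S \<union> ({x} \<union> {y}))) (card H - 1 + 0) (0 + 3)"
      using Sc xc full xy d by (intro dense_union) auto
    then have "dense (subset_sums G ((S \<union> ({x} \<union> {y})) \<union> (A - H - {x,y}))) (card H - 1 + 0) (0 + 3 + card (A - H - {x,y}))"
      using fA Ac full Sc xc by (intro dense_outside) auto
    then have "carrier G \<subseteq> subset_sums G ((S \<union> ({x} \<union> {y})) \<union> (A - H - {x,y}))"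
    proof (rule dense_full)
      have "x \<noteq> y" using n coset_self[OF subgroup_H xc(1)] by auto
      then have "card (A - H - {x,y}) + 2 = card (A - H)"
        using xy fA card_Diff_subset[of "{x,y}" "A - H"] card_mono[of "A - H" "{x,y}"] by simp
      then show "card K \<le> 0 + 3 + card (A - H - {x,y}) + 1" using pc by linarith
    qed (use q in auto)
    also have "\<dots> \<subseteq> subset_sums G A" using full xy by (intro subset_sums_mono) auto
    finally show False using nsub by simp
  qed
qed

end

subsection \<open>Choosing the number of summands in each coset\<close>

text \<open>Dropping an element of least weight never lowers the average.\<close>

lemma heavy_subset:
  fixes g :: "'b \<Rightarrow> nat"
  assumes "finite C"
  shows "L \<le> card C \<Longrightarrow> \<exists>D\<subseteq>C. card D = L \<and> L * sum g C \<le> card C * sum g D"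
  using assms
proof (induction "card C" arbitrary: C)
  case 0
  then show ?case by auto
next
  case (Suc n)
  show ?case
  proof (cases "L = card C")
    case True then show ?thesis by auto
  next
    case False
    have ne: "C \<noteq> {}" using Suc by auto
    obtain x where x: "x \<in> C" "\<And>y. y \<in> C \<Longrightarrow> g x \<le> g y"
      using ex_min_if_finite[of "g ` C"] Suc.prems(2) ne
      by (metis (no_types, lifting) empty_is_image finite_imageI image_iff linorder_not_le)
    have cx: "card (C - {x}) = n" using x Suc by simp
    then have "L \<le> card (C - {x})" using False Suc by simp
    then obtain D where D: "D \<subseteq> C - {x}" "card D = L" "L * sum g (C - {x}) \<le> n * sum g D"
      using Suc.hyps(1)[of "C - {x}"] cx Suc.prems by auto
    have "L * g x = (\<Sum>y\<in>D. g x)" using D by simp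
    also have "\<dots> \<le> sum g D" using D x by (intro sum_mono) auto
    finally have "L * sum g C \<le> (n + 1) * sum g D"
      using D(3) sum.remove[OF Suc.prems(2) x(1), of g] by (simp add: algebra_simps)
    then show ?thesis using D Suc(2) by (intro exI[of _ D]) auto
  qed
qed

context two_prime_group begin

section \<open>Impossibility of an incomplete set that meets less than half of
  \<open>H\<close>\<close>

context
  fixes A :: "'a set"
  assumes A: "A \<subseteq> carrier G - {\<one>}" and cA: "card A + 3 = card K + card H"
    and large: "2 * card K + 3 \<le> card H" "order G \<noteq> 14"
    and incomplete: "\<not> carrier G \<subseteq> subset_sums G A"
    and small: "2 * card (A \<inter> H) < card H"
begin

abbreviation sz :: "'a \<Rightarrow> nat" where "sz c \<equiv> card (A \<inter> (c <# H))"
abbreviation h :: nat where "h \<equiv> card (A \<inter> H)"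
abbreviation C :: "'a set" where "C \<equiv> K - {\<one>}"

lemma Ac: "A \<subseteq> carrier G" using A by auto

lemma card_C: "card C + 1 = card K" "finite C"
  using finite_K subgroup.one_closed[OF subgroup_K] card_Suc_Diff1[of K \<one>] by auto

lemma card_K_ge: "2 \<le> card K" using prime_K prime_ge_2_nat by auto

lemma odd_H: "odd (card H)" using prime_odd_nat[OF prime_H] large card_K_ge by linarith

text \<open>For \<open>card K\<close> equal to 2 and 3 the bound \<open>2 * card K + 3\<close> is 7
  and 9. The first is excluded by the order 14, the second is not prime.\<close>

lemma card_H_ge: "11 \<le> card H" "card H = 2 * card K + 3 \<Longrightarrow> 5 \<le> card K"
proof -
  have "card H \<noteq> 9"
  proof
    assume "card H = 9"
    have "9 = 3 * (3::nat)" by simp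
    then have "(3::nat) dvd card H" using \<open>card H = 9\<close> by (metis dvd_triv_left)
    moreover have "\<And>m. m dvd card H \<Longrightarrow> m = 1 \<or> m = card H" using prime_H prime_nat_iff by blast
    ultimately have "(3::nat) = 1 \<or> (3::nat) = card H" by blast
    then show False using \<open>card H = 9\<close> by simp
  qed
  moreover have "card K = 2 \<Longrightarrow> card H \<noteq> 7" using large(2) order_eq by auto
  moreover have "card K \<noteq> 4"
  proof
    assume "card K = 4"
    then have "(2::nat) dvd card K" by simp
    then show False using prime_K \<open>card K = 4\<close> prime_odd_nat by auto
  qed
  moreover have "card K = 2 \<or> card K = 3 \<or> 4 \<le> card K" using card_K_ge by linarith
  ultimately show "11 \<le> card H" "card H = 2 * card K + 3 \<Longrightarrow> 5 \<le> card K"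
    using odd_H large(1) by presburger+
qed

lemma sum_sz: "h + sum sz C + 3 = card K + card H"
  using card_cosets[OF Ac] cA by simp

lemma sz_le: "c \<in> C \<Longrightarrow> h + sz c + 3 \<le> card K + card H"
  using sum_sz member_le_sum[of c C sz] card_C by simp

text \<open>Slightly more than half of a coset of \<open>H\<close> has a full coset of two-element
  sums. The hypothesis on \<open>h\<close> says that enough elements outside \<open>H\<close> remain
  to carry it through all cosets, one each.\<close>

lemma sz_half: "c \<in> C \<Longrightarrow> 2 * h + 7 \<le> card H \<Longrightarrow> 2 * sz c \<le> card H + 1"
proof (rule ccontr)
  assume c: "c \<in> C" and hh: "2 * h + 7 \<le> card H" and n: "\<not> 2 * sz c \<le> card H + 1"
  \<comment> \<open>As \<open>card H\<close> is odd, this is the least size to which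
    \<open>rsums_2_full_odd\<close> applies.\<close>
  define t where "t = (card H + 3) div 2"
  have t: "2 * t = card H + 3" using odd_H unfolding t_def by presburger
  have "t \<le> sz c" using t n odd_H by presburger
  then obtain S where S: "S \<subseteq> A \<inter> (c <# H)" "card S = t" using obtain_subset_with_card_n by metis
  have cc: "c \<in> carrier G" "c \<in> K" using c K_carrier by auto
  have Sc: "S \<subseteq> carrier G" using S Ac by auto
  have "(c \<otimes> c) <# H \<subseteq> rsums 2 S"
    using rsums_2_full_odd[OF fin subgroup_H odd_H cc(1), of S] S t by auto
  then have "(c \<otimes> c) <# H \<subseteq> subset_sums G S" using rsums_subset_sums[of 2 S] by auto
  then have "subset_sums G S \<inter> ((c \<otimes> c) <# H) = (c \<otimes> c) <# H" by auto
  then have "fat {c \<otimes> c} (subset_sums G S) (card H - 1)"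
    unfolding fat_def using cc subgroup.m_closed[OF subgroup_K] subset_sums_carrier[OF Sc]
      coset_card[of "c \<otimes> c" H] H_carrier by simp
  then have d: "dense (subset_sums G S) (card H - 1) 0" unfolding dense_def by (intro exI[of _ "{c \<otimes> c}"]) auto
  let ?T = "A - H - S"
  have fA: "finite A" using finite_sub[OF Ac] .
  have "S \<subseteq> A - H" using S disjoint_H[of c] c by auto
  then have "card ?T + t = card (A - H)" using S fA finite_subset
    by (metis card_Diff_subset card_mono finite_Diff le_add_diff_inverse2)
  moreover have "card (A - H) + h = card A" using card_Int_Diff[OF fA, of H] by simp
  ultimately have cT: "card K \<le> card ?T + 1" using t hh cA by linarith
  have "dense (subset_sums G (S \<union> ?T)) (card H - 1) (0 + card ?T)"
    using fA Ac Sc d by (intro dense_outside) auto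
  then have "carrier G \<subseteq> subset_sums G (S \<union> ?T)" by (rule dense_full) (use cT in auto)
  also have "\<dots> \<subseteq> subset_sums G A" using S by (intro subset_sums_mono) auto
  finally show False using incomplete by simp
qed

lemma sz_less: "c \<in> C \<Longrightarrow> sz c < card H"
proof (cases "2 * h + 7 \<le> card H")
  case True
  then show "c \<in> C \<Longrightarrow> sz c < card H" using sz_half[of c] card_H_ge by linarith
next
  case False
  then show "c \<in> C \<Longrightarrow> sz c < card H" using sz_le[of c] large by linarith
qed

text \<open>For \<open>h \<ge> 3\<close> the sums of \<open>A \<inter> H\<close> are worth
  \<open>2 * h - 2\<close>, and \<open>l = 1\<close> on the heaviest cosets, as many as
  \<open>K\<close> can afford, supplies the rest.\<close>

lemma h_small: "h < 3"
proof (rule ccontr)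
  assume h3: "\<not> h < 3"
  \<comment> \<open>The cosets other than \<open>H\<close> hold \<open>P + N\<close> elements in
    total, so \<open>K\<close> can afford \<open>l = 1\<close> on up to \<open>N div 2\<close> of
    them; \<open>g\<close> is what such a coset gives to \<open>H\<close>.\<close>
  define P N where "P = card C" and "N = card H - 2 - h"
  have N: "N + 2 + h = card H" using small h3 unfolding N_def by linarith
  define g where "g c = sz c - 1" for c
  have "sum sz C \<le> (\<Sum>c\<in>C. g c + 1)" unfolding g_def by (intro sum_mono) auto
  then have "sum sz C \<le> sum g C + P" unfolding P_def sum.distrib by simp
  then have gN: "N \<le> sum g C" using sum_sz N card_C P_def by linarith
  define L where "L = min P (N div 2)"
  obtain D where D: "D \<subseteq> C" "card D = L" "L * sum g C \<le> P * sum g D"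
    using heavy_subset[of C L g] card_C unfolding L_def P_def by auto
  have P0: "P \<ge> 1" using card_C card_K_ge P_def by linarith
  have W: "N + 3 \<le> sum g D + h"
  proof (cases "L = P")
    case True
    then have "sum g C \<le> sum g D" using D(3) P0 by simp
    then show ?thesis using gN h3 by linarith
  next
    case False
    then have "L = N div 2" "N < 2 * P" unfolding L_def by linarith+
    then have L: "N \<le> 2 * L + 1" "N < 2 * P" by linarith+
    have "int L * int N \<le> int P * int (sum g D)"
      using D(3) mult_left_mono[OF gN, of L] by (metis le_trans of_nat_le_iff of_nat_mult le0)
    moreover have "(int N - 1) * int N \<le> (2 * int L) * int N" using L by (intro mult_right_mono) auto
    ultimately have 1: "(int N - 1) * int N \<le> 2 * int P * int (sum g D)" by linarith
    \<comment> \<open>The chosen cosets carry at least their average share, which is at least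
      \<open>N * (N - 1) / (2 * P)\<close>. A smaller integer would make
      \<open>(N - 2 * P)^2 + (2 * P - N)\<close> nonpositive. The hypothesis on
      \<open>card H\<close> then turns \<open>2 * N - 2 * P\<close> into the demand
      \<open>N + 3 - h\<close>.\<close>
    have "2 * int N - 2 * int P \<le> int (sum g D)"
    proof (rule ccontr)
      assume "\<not> ?thesis"
      then have "int (sum g D) \<le> 2 * int N - 2 * int P - 1" by linarith
      then have "2 * int P * int (sum g D) \<le> 2 * int P * (2 * int N - 2 * int P - 1)"
        by (intro mult_left_mono) auto
      then have "(int N - 1) * int N \<le> 2 * int P * (2 * int N - 2 * int P - 1)" using 1 by linarith
      then have "(int N - 2 * int P) * (int N - 2 * int P) + (2 * int P - int N) \<le> 0"
        by (simp add: algebra_simps)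
      moreover have "(int N - 2 * int P) * (int N - 2 * int P) \<ge> 0" by simp
      ultimately show False using L by linarith
    qed
    then show ?thesis using N large card_C P_def by linarith
  qed
  define l where "l c = (if c \<in> D \<and> 2 \<le> sz c then 1 else 0 :: nat)" for c
  have "sum g D \<noteq> 0" using W N small by linarith
  then obtain c0 where c0: "c0 \<in> D" "g c0 \<noteq> 0" by (meson sum.neutral)
  have "carrier G \<subseteq> subset_sums G A"
  proof (rule assemble[OF Ac, of c0 l])
    show "c0 \<in> C" using c0 D by auto
    show "1 \<le> l c0" using c0 unfolding l_def g_def by auto
    show "admissible (l c) (sz c)" if "c \<in> C" for c
      using sz_less[OF that] unfolding admissible_def l_def by auto
    have "A \<inter> H \<subseteq> H - {\<one>}" using A by auto
    then show "(2 * h - 2) + 1 \<le> card (sums0 (A \<inter> H))"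
      using sums0_card_ge[OF fin subgroup_H prime_H, of "A \<inter> H"] small h3 by linarith
    have "(\<Sum>c\<in>C. gain (l c) (sz c)) = (\<Sum>c\<in>C. if c \<in> D then g c else 0)"
      unfolding gain_def l_def g_def by (intro sum.cong) auto
    also have "\<dots> = sum g D" using D card_C by (simp add: sum.inter_restrict[symmetric] Int_absorb1)
    finally show "card H \<le> (2 * h - 2) + (\<Sum>c\<in>C. gain (l c) (sz c)) + 1" using W N h3 by linarith
    have "sum sz C \<le> (\<Sum>c\<in>C. (sz c - 2 * l c) + (if c \<in> D then 2 else 0))"
      unfolding l_def by (intro sum_mono) auto
    also have "\<dots> = (\<Sum>c\<in>C. sz c - 2 * l c) + (\<Sum>c\<in>C. if c \<in> D then 2 else 0)" by (rule sum.distrib)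
    also have "(\<Sum>c\<in>C. if c \<in> D then 2 else 0) = (\<Sum>c\<in>D. 2::nat)"
      using D card_C by (simp add: sum.inter_restrict[symmetric] Int_absorb1)
    also have "\<dots> \<le> N" using D(2) unfolding L_def by simp
    finally show "card K \<le> (\<Sum>c\<in>C. sz c - 2 * l c) + 1" using sum_sz N card_C by linarith
  qed
  then show False using incomplete by simp
qed

lemma admissible_small: "c \<in> C \<Longrightarrow> l \<le> 3 \<Longrightarrow> 2 * l \<le> sz c \<Longrightarrow> admissible l (sz c)"
  using sz_half[of c] h_small card_H_ge unfolding admissible_def by linarith

lemma sums0_h: "h + 1 \<le> card (sums0 (A \<inter> H))"
  using sums0_lower[of "A \<inter> H"] A finite_sub[OF Ac] by auto

text \<open>Take \<open>l = 2\<close> on one coset, \<open>l = 1\<close> on the others with at least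
  two elements, and \<open>l = 0\<close> elsewhere. This meets the demand in \<open>H\<close>, and
  the demand in \<open>K\<close> unless \<open>card H < 2 * s + 4 + h\<close>. As
  \<open>s < card K\<close> and \<open>h < 3\<close>, only the stated values survive.\<close>

lemma special_form: "card H = 2 * card K + 3" "h = 2" "c \<in> C \<Longrightarrow> 2 \<le> sz c"
proof -
  define s where "s = card {c \<in> C. 2 \<le> sz c}"
  have "card H < 2 * s + 4 + h"
  proof (rule ccontr)
    assume n: "\<not> card H < 2 * s + 4 + h"
    \<comment> \<open>\<open>l = 2\<close> takes four elements; with at most three per coset,
      \<open>A\<close> would be too small.\<close>
    have "\<exists>c0\<in>C. 4 \<le> sz c0"
    proof (rule ccontr)
      assume n4: "\<not> ?thesis"
      have "sz c \<le> 3" if "c \<in> C" for c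
      proof -
        have "\<not> 4 \<le> sz c" using n4 that by blast
        then show ?thesis by simp
      qed
      then have "sum sz C \<le> (\<Sum>c\<in>C. 3)" by (intro sum_mono) auto
      then have "sum sz C \<le> 3 * card C" by simp
      then show False using sum_sz h_small large card_C by linarith
    qed
    then obtain c0 where c0: "c0 \<in> C" "4 \<le> sz c0" by auto
    define l where "l c = (if c = c0 then 2 else if 2 \<le> sz c then 1 else 0 :: nat)" for c
    have "carrier G \<subseteq> subset_sums G A"
    proof (rule assemble[OF Ac c0(1), of l])
      show "1 \<le> l c0" unfolding l_def by simp
      show "admissible (l c) (sz c)" if "c \<in> C" for c
        using that c0 unfolding l_def by (intro admissible_small) auto
      show "h + 1 \<le> card (sums0 (A \<inter> H))" by (rule sums0_h)
      have "sum sz C + 1 = (\<Sum>c\<in>C. sz c + (if c = c0 then 1 else 0))"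
        unfolding sum.distrib using c0 card_C by simp
      also have "\<dots> \<le> (\<Sum>c\<in>C. gain (l c) (sz c) + 1)"
        unfolding gain_def l_def using c0 by (intro sum_mono) auto
      also have "\<dots> = (\<Sum>c\<in>C. gain (l c) (sz c)) + card C" unfolding sum.distrib by simp
      finally show "card H \<le> h + (\<Sum>c\<in>C. gain (l c) (sz c)) + 1" using sum_sz card_C by linarith
      have "sum sz C \<le> (\<Sum>c\<in>C. (sz c - 2 * l c) + ((if 2 \<le> sz c then 2 else 0) + (if c = c0 then 2 else 0)))"
        unfolding l_def by (intro sum_mono) auto
      also have "\<dots> = (\<Sum>c\<in>C. sz c - 2 * l c) + ((\<Sum>c\<in>C. if 2 \<le> sz c then 2 else 0) + 2)"
        unfolding sum.distrib using c0 card_C by simp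
      also have "(\<Sum>c\<in>C. if 2 \<le> sz c then 2 else 0) = 2 * s"
        unfolding s_def using card_C by (simp add: sum.inter_filter[symmetric])
      finally show "card K \<le> (\<Sum>c\<in>C. sz c - 2 * l c) + 1" using sum_sz n card_C by linarith
    qed
    then show False using incomplete by simp
  qed
  moreover have "s \<le> card C" unfolding s_def using card_C by (intro card_mono) auto
  ultimately have "card H = 2 * card K + 3 \<and> h = 2 \<and> s = card C"
    using h_small large card_C odd_H by presburger
  moreover have "{c \<in> C. 2 \<le> sz c} = C" if "s = card C"
    using that card_C unfolding s_def by (intro card_subset_eq) auto
  ultimately show "card H = 2 * card K + 3" "h = 2" "c \<in> C \<Longrightarrow> 2 \<le> sz c" by auto
qed

text \<open>In the remaining case \<open>l = 1\<close> everywhere falls one short in \<open>H\<close>, and one more step makes it fall one short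
  in \<open>K\<close>, which two cosets \<open>c \<noteq> \<plusminus>d\<close> with some freedom left make up for. The function \<open>e\<close> records the change of
  the gain with respect to \<open>l = 1\<close>.\<close>

lemma no_special_pair:
  assumes c: "c \<in> C" "d \<in> C" "c \<noteq> d" "c \<noteq> inv d"
    and lc: "1 \<le> l c" "2 * l c < sz c" "2 * l d < sz d"
    and l: "\<And>c. c \<in> C \<Longrightarrow> l c \<le> 3 \<and> 2 * l c \<le> sz c"
    and k: "\<And>c. c \<in> C \<Longrightarrow> int (gain (l c) (sz c)) = int (sz c) - 1 + e c"
    and r: "(\<Sum>c\<in>C. int (l c)) = int (card C) + 1" and e: "sum e C = 1"
  shows False
proof -
  have "int (\<Sum>c\<in>C. gain (l c) (sz c)) = (\<Sum>c\<in>C. int (sz c) - 1 + e c)"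
    using k by (simp add: sum.distrib)
  also have "\<dots> = int (sum sz C) - int (card C) + 1" using e by (simp add: sum.distrib sum_subtractf)
  finally have g: "int (\<Sum>c\<in>C. gain (l c) (sz c)) = int (sum sz C) - int (card C) + 1" .
  have "int (\<Sum>c\<in>C. sz c - 2 * l c) = (\<Sum>c\<in>C. int (sz c) - 2 * int (l c))"
    using l by (simp add: of_nat_diff)
  also have "\<dots> = int (sum sz C) - 2 * (int (card C) + 1)"
    using r by (simp add: sum_subtractf sum_distrib_left[symmetric])
  finally have s: "int (\<Sum>c\<in>C. sz c - 2 * l c) = int (sum sz C) - 2 * (int (card C) + 1)" .
  have "carrier G \<subseteq> subset_sums G A"
  proof (rule assemble_pair[OF Ac c lc])
    show "admissible (l c) (sz c)" if "c \<in> C" for c using admissible_small l that by blast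
    show "h + 1 \<le> card (sums0 (A \<inter> H))" by (rule sums0_h)
    show "card H \<le> h + (\<Sum>c\<in>C. gain (l c) (sz c)) + 1" using g sum_sz card_C by linarith
    \<comment> \<open>The cosets hold \<open>3 * card K - 2\<close> elements, so \<open>u\<close> is
      \<open>card K - 2\<close>: short by one, as \<open>assemble_pair\<close> permits.\<close>
    define u w where "u = (\<Sum>c\<in>C. sz c - 2 * l c)" and "w = sum sz C"
    have "int u = int w - 2 * (int (card C) + 1)" using s unfolding u_def w_def .
    moreover have "int (card C) + 1 = int (card K)" using card_C by linarith
    ultimately have "int u = int w - 2 * int (card K)" by simp
    moreover have "2 + w + 3 = card K + (2 * card K + 3)"
      using sum_sz[folded w_def] unfolding special_form(1,2) .
    ultimately have "card K \<le> u + 2" by linarith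
    then show "card K \<le> (\<Sum>c\<in>C. sz c - 2 * l c) + 2" unfolding u_def .
  qed
  then show False using incomplete by simp
qed

text \<open>The extra step is \<open>l = 2\<close> at \<open>c0\<close>. Members of the pair must
  satisfy \<open>2 * l < sz\<close> strictly, so a member equal to \<open>c0\<close> takes five
  elements and any other takes three.\<close>

lemma no_double_step:
  assumes c0: "c0 \<in> C" "4 \<le> sz c0" and c: "c \<in> C" "d \<in> C" "c \<noteq> d" "c \<noteq> inv d" "3 \<le> sz c" "3 \<le> sz d"
    and n: "c \<noteq> c0 \<or> 5 \<le> sz c0" "d \<noteq> c0 \<or> 5 \<le> sz c0"
  shows False
proof (rule no_special_pair[OF c(1-4), of "\<lambda>b. if b = c0 then 2 else 1" "\<lambda>b. if b = c0 then 1 else 0"])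
  show "(\<Sum>b\<in>C. int (if b = c0 then 2 else 1)) = int (card C) + 1"
  proof -
    have "(\<Sum>b\<in>C. int (if b = c0 then 2 else 1)) = (\<Sum>b\<in>C. 1 + (if b = c0 then 1 else 0))"
      by (intro sum.cong) auto
    then show ?thesis using c0 card_C unfolding sum.distrib by simp
  qed
  show "(\<Sum>b\<in>C. if b = c0 then 1 else 0 :: int) = 1" using c0 card_C by simp
  show "int (gain (if b = c0 then 2 else 1) (sz b)) = int (sz b) - 1 + (if b = c0 then 1 else 0)" if "b \<in> C" for b
    using special_form(3)[OF that] c0 unfolding gain_def by (auto simp: of_nat_diff)
  show "(if b = c0 then 2 else 1) \<le> (3::nat) \<and> 2 * (if b = c0 then 2 else 1) \<le> sz b" if "b \<in> C" for b
    using special_form(3)[OF that] c0 by auto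
qed (use c n in auto)

text \<open>The position of the excess over two elements per coset decides. If it occurs in two
  cosets that are not inverse to each other, \<open>no_double_step\<close> applies. If it is
  confined to one coset and its inverse, a coset of size 2 can take \<open>l = 0\<close> to pay for
  further steps.\<close>

lemma incomplete_imp_False: False
proof -
  define P where "P = card C"
  have K5: "5 \<le> card K" and P: "4 \<le> P" "P + 1 = card K"
    using card_H_ge special_form card_C P_def by auto
  have odd_K: "odd (card K)" using prime_odd_nat[OF prime_K] K5 by simp
  \<comment> \<open>The excess over the two elements that every coset has; it adds up to
    \<open>card K\<close>, one more than the number of cosets.\<close>
  define x where "x c = sz c - 2" for c
  have xs: "sz c = x c + 2" if "c \<in> C" for c using special_form(3)[OF that] unfolding x_def by simp
  have "sum sz C = (\<Sum>c\<in>C. x c + 2)" using xs by (intro sum.cong) auto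
  then have "sum sz C = sum x C + 2 * P" unfolding sum.distrib P_def by simp
  then have sx: "sum x C = P + 1" using sum_sz special_form card_C P_def by linarith
  have inv_C: "inv c \<in> C" "inv c \<noteq> c" "inv (inv c) = c" if "c \<in> C" for c
  proof -
    have cc: "c \<in> carrier G" "c \<in> K" "c \<noteq> \<one>" using that K_carrier by auto
    then show "inv c \<in> C" using subgroup.m_inv_closed[OF subgroup_K] by auto
    show "inv c \<noteq> c"
    proof
      assume "inv c = c"
      then have "c \<otimes> c = \<one>" using cc by (metis r_inv)
      then show False using square_one_odd[OF fin subgroup_K odd_K] cc by auto
    qed
    show "inv (inv c) = c" using cc by simp
  qed
  have pos: "\<exists>c\<in>C. 1 \<le> x c"
  proof (rule ccontr)
    assume "\<not> ?thesis"
    then have "sum x C = 0" by (auto simp: not_le)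
    then show False using sx by simp
  qed
  show False
  proof (cases "\<exists>c\<in>C. \<exists>d\<in>C. c \<noteq> d \<and> c \<noteq> inv d \<and> 1 \<le> x c \<and> 1 \<le> x d")
    case True
    then obtain c d where cd: "c \<in> C" "d \<in> C" "c \<noteq> d" "c \<noteq> inv d" "1 \<le> x c" "1 \<le> x d" by auto
    show False
    proof (cases "\<exists>c0\<in>C. 3 \<le> x c0")
      case True
      then obtain c0 where "c0 \<in> C" "3 \<le> x c0" by auto
      then show False using no_double_step[of c0 c d] xs cd by auto
    next
      case F: False
      have x2: "x c \<le> 2" if "c \<in> C" for c
      proof -
        have "\<not> 3 \<le> x c" using F that by blast
        then show ?thesis by simp
      qed
      have "\<exists>c0\<in>C. 2 \<le> x c0"
      proof (rule ccontr)
        assume n2: "\<not> ?thesis"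
        have "x c \<le> 1" if "c \<in> C" for c
        proof -
          have "\<not> 2 \<le> x c" using n2 that by blast
          then show ?thesis by simp
        qed
        then have "sum x C \<le> (\<Sum>c\<in>C. 1)" by (intro sum_mono) auto
        then show False using sx unfolding P_def by simp
      qed
      then obtain c0 where c0: "c0 \<in> C" "x c0 = 2" using x2 by (metis le_antisym)
      \<comment> \<open>A coset of excess 2 has exactly the four elements for \<open>l = 2\<close>
        and no freedom left, so the pair has to avoid it.\<close>
      have nodb: False if "a \<in> C" "b \<in> C" "a \<noteq> b" "a \<noteq> inv b" "1 \<le> x a" "1 \<le> x b" "e \<in> C" "x e = 2" "a \<noteq> e" "b \<noteq> e" for a b e
        using no_double_step[of e a b] xs that by auto
      have s0: "sum x (C - {c0}) = P - 1" using sum.remove[OF card_C(2) c0(1), of x] sx c0 by simp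
      have "\<exists>a\<in>C - {c0}. 1 \<le> x a"
      proof (rule ccontr)
        assume "\<not> ?thesis"
        then have "sum x (C - {c0}) = 0" by (auto simp: not_le)
        then show False using s0 P by simp
      qed
      then obtain a where a: "a \<in> C" "a \<noteq> c0" "1 \<le> x a" by auto
      define b where "b = inv a"
      have b: "b \<in> C" "b \<noteq> a" "inv b = a" using inv_C[OF a(1)] b_def by auto
      \<comment> \<open>Any further coset with positive excess would form such a pair with
        \<open>a\<close>. So apart from \<open>c0\<close> all excess sits on \<open>a\<close> and
        its inverse; it is at least 3, and one of the two has excess 2 and can take over the role of
        \<open>c0\<close>.\<close>
      have zero: "x e = 0" if "e \<in> C - {c0} - {a,b}" for e
        using nodb[of e a c0] that a c0 b_def inv_C by (metis DiffE insertCI le0 less_one linorder_not_le singletonI)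
      have "b \<noteq> c0"
      proof
        assume "b = c0"
        then have "sum x (C - {c0}) = x a + sum x (C - {c0} - {a})" "sum x (C - {c0} - {a}) = 0"
          using sum.remove[of "C - {c0}" a x] a card_C zero by (auto intro!: sum.neutral)
        then show False using s0 P x2[OF a(1)] by linarith
      qed
      have "sum x (C - {c0}) = x a + sum x (C - {c0} - {a})"
        using sum.remove[of "C - {c0}" a x] a card_C by auto
      also have "sum x (C - {c0} - {a}) = x b + sum x (C - {c0} - {a} - {b})"
        using sum.remove[of "C - {c0} - {a}" b x] b \<open>b \<noteq> c0\<close> card_C by auto
      also have "sum x (C - {c0} - {a} - {b}) = 0" using zero by (intro sum.neutral) auto
      finally have ab: "3 \<le> x a + x b" using s0 P by linarith
      have c0ab: "c0 \<noteq> inv b" "c0 \<noteq> inv a" using a b \<open>b \<noteq> c0\<close> b_def by auto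
      show False
      proof (cases "x a = 2")
        case True
        then show False using nodb[of c0 b a] c0 a b ab \<open>b \<noteq> c0\<close> c0ab x2[OF b(1)] by auto
      next
        case False
        then have "x a = 1" "x b = 2" using a x2[OF a(1)] x2[OF b(1)] ab by linarith+
        then show False using nodb[of c0 a b] c0 a b \<open>b \<noteq> c0\<close> c0ab by auto
      qed
    qed
  next
    case False
    have "finite (x ` C)" "x ` C \<noteq> {}" using card_C pos by auto
    then obtain e where e: "e \<in> C" "x e = Max (x ` C)" using Max_in by (metis (no_types, lifting) imageE)
    have emax: "x c \<le> x e" if "c \<in> C" for c using e that card_C by auto
    have e1: "1 \<le> x e" using pos emax by (meson le_trans)
    define f where "f = inv e"
    have f: "f \<in> C" "f \<noteq> e" "inv f = e" using inv_C[OF e(1)] f_def by auto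
    have zero: "x c = 0" if "c \<in> C - {e} - {f}" for c
    proof (rule ccontr)
      assume "x c \<noteq> 0"
      then have "1 \<le> x c" "c \<in> C" "c \<noteq> e" "c \<noteq> inv e" using that f_def by auto
      then show False using False e(1) e1 by blast
    qed
    have "sum x C = x e + sum x (C - {e})" using sum.remove[OF card_C(2) e(1)] .
    also have "sum x (C - {e}) = x f + sum x (C - {e} - {f})"
      using sum.remove[of "C - {e}" f x] f card_C by auto
    also have "sum x (C - {e} - {f}) = 0" using zero by (intro sum.neutral) auto
    finally have ef: "x e + x f = P + 1" using sx by simp
    \<comment> \<open>A third coset \<open>k\<close> has size 2. Setting \<open>l = 0\<close> there
      frees 2 in \<open>K\<close> at a loss of 1 in \<open>H\<close>, and \<open>2 * 0 < 2\<close>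
      lets \<open>k\<close> join the pair.\<close>
    have "card (C - {e,f}) = P - 2" using card_remove_two[OF card_C(2) e(1) f(1)] f P_def by auto
    then have "card (C - {e,f}) \<noteq> 0" using P by linarith
    then have "C - {e,f} \<noteq> {}" using card.empty by metis
    then obtain k where k: "k \<in> C" "k \<noteq> e" "k \<noteq> f" by auto
    have kz: "sz k = 2" using zero[of k] k xs by simp
    have kinv: "e \<noteq> inv k" "f \<noteq> inv k" using k f f_def inv_C by metis+
    have ind: "(\<Sum>c\<in>C. if c = a then t else 0) = t" if "a \<in> C" for a and t :: int
      using that card_C by simp
    show False
    proof (cases "2 \<le> x f")
      case True
      have "3 \<le> x e" using ef emax[OF f(1)] P by linarith
      \<comment> \<open>Both \<open>e\<close> and \<open>f\<close> rise to \<open>l = 2\<close>,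
        paid for by \<open>k\<close>; \<open>e\<close> has at least five elements and so keeps its
        freedom.\<close>
      let ?l = "\<lambda>c. if c = e then 2 else if c = f then 2 else if c = k then 0 else 1 :: nat"
      let ?e = "\<lambda>c. (if c = e then 1 else 0) + (if c = f then 1 else 0) - (if c = k then 1 else 0) :: int"
      show False
      proof (rule no_special_pair[OF e(1) k(1) _ kinv(1), of ?l ?e])
        show "sum ?e C = 1" unfolding sum_subtractf sum.distrib using ind e f k by simp
        have "(\<Sum>c\<in>C. int (?l c)) = (\<Sum>c\<in>C. 1 + ?e c)" using k f by (intro sum.cong) auto
        then show "(\<Sum>c\<in>C. int (?l c)) = int (card C) + 1"
          unfolding sum.distrib sum_subtractf using ind e f k by simp
        show "int (gain (?l c) (sz c)) = int (sz c) - 1 + ?e c" if "c \<in> C" for c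
          using xs[OF that] kz k f True \<open>3 \<le> x e\<close> unfolding gain_def by (auto simp: of_nat_diff)
        show "?l c \<le> 3 \<and> 2 * ?l c \<le> sz c" if "c \<in> C" for c
          using xs[OF that] True \<open>3 \<le> x e\<close> by auto
      qed (use k kz xs[OF e(1)] \<open>3 \<le> x e\<close> in auto)
    next
      case F: False
      then have xe: "4 \<le> x e" using ef P by linarith
      \<comment> \<open>With at most three elements \<open>f\<close> cannot rise, so
        \<open>e\<close> alone rises to \<open>l = 3\<close>.\<close>
      let ?l = "\<lambda>c. if c = e then 3 else if c = k then 0 else 1 :: nat"
      let ?e = "\<lambda>c. (if c = e then 2 else 0) - (if c = k then 1 else 0) :: int"
      have s: "sum ?e C = 1" unfolding sum_subtractf using ind e k by simp
      have "(\<Sum>c\<in>C. int (?l c)) = (\<Sum>c\<in>C. 1 + ?e c)" using k by (intro sum.cong) auto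
      then have sl: "(\<Sum>c\<in>C. int (?l c)) = int (card C) + 1"
        unfolding sum.distrib sum_subtractf using ind e k by simp
      have g: "int (gain (?l c) (sz c)) = int (sz c) - 1 + ?e c" if "c \<in> C" for c
        using xs[OF that] kz k xe unfolding gain_def by (auto simp: of_nat_diff)
      have b: "?l c \<le> 3 \<and> 2 * ?l c \<le> sz c" if "c \<in> C" for c
        using xs[OF that] xe by auto
      show False
      proof (cases "5 \<le> x e")
        case True
        then show False
          using no_special_pair[OF e(1) k(1) _ kinv(1), of ?l ?e] k kz xs[OF e(1)] b g sl s by auto
      next
        case False
        \<comment> \<open>Six elements just permit \<open>l = 3\<close> but leave \<open>e\<close>
          no freedom. Then \<open>f\<close> has three elements and takes its place in the
          pair.\<close>
        then have "1 \<le> x f" using ef P xe by linarith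
        then show False
          using no_special_pair[OF f(1) k(1) _ kinv(2), of ?l ?e] k kz f xs[OF f(1)] b g sl s by auto
      qed
    qed
  qed
qed

end

end

context comm_group begin

subsection \<open>The inverse theorem\<close>

text \<open>Every incomplete set bounds the critical number from below. Nothing else about that
  number enters, and its value is never computed.\<close>

lemma card_le_critical_number:
  assumes fin: "finite (carrier G)" and B: "B \<subseteq> carrier G - {\<one>}" "subset_sums G B \<noteq> carrier G"
  shows "card B \<le> critical_number G - 1"
proof -
  let ?P = "\<lambda>l. 0 < l \<and> (\<forall>A. A \<subseteq> carrier G - {\<one>} \<and> l \<le> card A \<longrightarrow> subset_sums G A = carrier G)"
  have "\<not> order G \<le> card A" if "A \<subseteq> carrier G - {\<one>}" for A
  proof -
    have "card A \<le> card (carrier G - {\<one>})" using that fin by (intro card_mono) auto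
    also have "\<dots> < order G" using fin unfolding order_def by (intro psubset_card_mono) auto
    finally show ?thesis by simp
  qed
  moreover have "0 < order G" using fin unfolding order_def by (auto simp: card_gt_0_iff)
  ultimately have "?P (order G)" by blast
  then have "?P (critical_number G)" unfolding critical_number_def by (rule LeastI[of ?P])
  then have "\<not> critical_number G \<le> card B" using B by blast
  then show ?thesis by simp
qed

text \<open>\<open>H - {\<one>}\<close> is incomplete, so \<open>A\<close> has a subset of the size
  treated in \<open>even_case\<close>. That subset is some \<open>K - {\<one>}\<close>, has all of
  \<open>K\<close> as sums, and would be completed by any further element of
  \<open>A\<close>.\<close>

lemma even_inverse:
  assumes fin: "finite (carrier G)" and ev: "even (order G)" "36 \<le> order G"
    and A: "A \<subseteq> carrier G - {\<one>}" "card A = critical_number G - 1" "subset_sums G A \<noteq> carrier G"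
  shows "\<exists>K. subgroup K G \<and> card K = order G div 2 \<and> A = K - {\<one>}"
proof -
  obtain H where H: "subgroup H G" "order G = 2 * card H" using index_two_subgroup[OF fin ev(1)] by auto
  have H18: "18 \<le> card H" using H ev by simp
  have Hc: "H \<subseteq> carrier G" using H subgroup.subset by blast
  have fH: "finite H" using Hc fin finite_subset by auto
  have "subset_sums G (H - {\<one>}) \<subseteq> H" using fH by (intro subset_sums_subgroup[OF H(1)]) auto
  moreover have "\<not> carrier G \<subseteq> H"
    using H(2) H18 card_mono[OF fH, of "carrier G"] unfolding order_def by linarith
  ultimately have "subset_sums G (H - {\<one>}) \<noteq> carrier G" by auto
  then have "card (H - {\<one>}) \<le> critical_number G - 1"
    using Hc by (intro card_le_critical_number[OF fin]) auto
  then have "card H - 1 \<le> card A" using A subgroup.one_closed[OF H(1)] by simp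
  then obtain B where B: "B \<subseteq> A" "card B = card H - 1" using obtain_subset_with_card_n by metis
  have Ac: "A \<subseteq> carrier G" using A by auto
  have nsub: "\<not> carrier G \<subseteq> subset_sums G A" using A subset_sums_carrier[OF Ac] by auto
  have "subset_sums G B \<noteq> carrier G" using nsub subset_sums_mono[OF B(1)] by auto
  then obtain K where K: "subgroup K G" "card K = card H" "B = K - {\<one>}"
    using even_case[OF fin H H18, of B] B A by auto
  have Kc: "K \<subseteq> carrier G" using K subgroup.subset by blast
  have full: "subset_sums G (K - {\<one>}) = K"
    using K H18 B by (intro subset_sums_full[OF fin]) auto
  have "A \<subseteq> B"
  proof
    fix x assume x: "x \<in> A"
    show "x \<in> B"
    proof (rule ccontr)
      assume "x \<notin> B"
      then have xK: "x \<notin> K" "x \<in> carrier G" using x K A by auto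
      have G: "carrier G = K \<union> (x <# K)"
        using coset_union_full[OF K(1) subgroup_self fin Kc xK(2,1)] H K unfolding order_def by simp
      have "carrier G \<subseteq> subset_sums G (B \<union> {x})"
      proof
        fix t assume "t \<in> carrier G"
        then consider "t \<in> K" | "t \<in> x <# K" using G by auto
        then show "t \<in> subset_sums G (B \<union> {x})"
        proof cases
          case 1
          then show ?thesis using full K(3) subset_sums_mono[of B "B \<union> {x}"] by auto
        next
          case 2
          then obtain k where k: "k \<in> K" "t = x \<otimes> k" unfolding l_coset_def by auto
          have "x \<in> sums0 {x}" using subset_subset_sums[of "{x}"] subset_sums_sums0[of "{x}"] xK by auto
          moreover have "finite B" using K Kc fin finite_subset by auto
          ultimately have "k \<otimes> x \<in> subset_sums G (B \<union> {x})"
            using k full K(3) xK Kc by (intro subset_sums_mult) auto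
          then show ?thesis using k xK Kc by (auto simp: m_comm subset_iff)
        qed
      qed
      also have "\<dots> \<subseteq> subset_sums G A" using B x by (intro subset_sums_mono) auto
      finally show False using nsub by simp
    qed
  qed
  then show ?thesis using K B H by auto
qed

end

context two_prime_group begin

text \<open>A sum with \<open>j\<close> summands in \<open>T\<close> lies in
  \<open>c [^] j <# H\<close>. As \<open>j\<close> is at most \<open>card K - 2\<close>, the coset
  of \<open>c [^] (card K - 1)\<close> is missed.\<close>

lemma large_incomplete_set:
  "\<exists>B \<subseteq> carrier G - {\<one>}. card B + 3 = card K + card H \<and> subset_sums G B \<noteq> carrier G"
proof -
  have p: "2 \<le> card K" using prime_K prime_ge_2_nat by auto
  then have "K \<noteq> {\<one>}" by auto
  then obtain c where c: "c \<in> K" "c \<noteq> \<one>" using subgroup.one_closed[OF subgroup_K] by auto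
  have cc: "c \<in> carrier G" using c K_carrier by auto
  have "card K - 2 \<le> card (c <# H)" using card_less coset_card[OF cc H_carrier] by simp
  then obtain T where T: "T \<subseteq> c <# H" "card T = card K - 2" using obtain_subset_with_card_n by metis
  have Tc: "T \<subseteq> carrier G" using T coset_subset[OF cc H_carrier] by auto
  have fT: "finite T" using finite_sub[OF Tc] .
  have dis: "H \<inter> T = {}" using disjoint_H[OF c] T by auto
  let ?B = "(H - {\<one>}) \<union> T"
  have "card ?B = card (H - {\<one>}) + card T" using finite_H fT dis by (intro card_Un_disjoint) auto
  then have cB: "card ?B + 3 = card K + card H"
    using T p card_less subgroup.one_closed[OF subgroup_H] by simp
  let ?z = "c [^] (card K - 1)"
  have "?z \<notin> subset_sums G ?B"
  proof
    assume "?z \<in> subset_sums G ?B"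
    then obtain S where S: "S \<subseteq> ?B" "?z = finprod G (\<lambda>x. x) S" unfolding subset_sums_def by auto
    have fS: "finite S" using S finite_H fT finite_subset[of S ?B] by simp
    let ?P = "S \<inter> H" and ?Q = "S \<inter> T"
    have PQ: "S = ?P \<union> ?Q" using S by auto
    have "finprod G (\<lambda>x. x) (?P \<union> ?Q) = finprod G (\<lambda>x. x) ?P \<otimes> finprod G (\<lambda>x. x) ?Q"
      using fS dis H_carrier Tc by (intro finprod_Un_disjoint) auto
    moreover have "finprod G (\<lambda>x. x) ?P \<in> (\<one> [^] card ?P) <# H"
      using fS coset_one[OF subgroup_H] by (intro finprod_coset[OF subgroup_H]) auto
    moreover have "finprod G (\<lambda>x. x) ?Q \<in> (c [^] card ?Q) <# H"
      using fS T by (intro finprod_coset[OF subgroup_H cc]) auto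
    ultimately have "?z \<in> (\<one> \<otimes> c [^] card ?Q) <# H"
      unfolding S(2) using PQ coset_mult[OF subgroup_H one_closed, of "c [^] card ?Q"] cc by simp
    then have z1: "?z \<in> (c [^] card ?Q) <# H" using cc by simp
    have pw: "c [^] (j::nat) \<in> K" for j using powers_K[OF c(1), of j 0] unfolding powers_def by auto
    have "?z \<in> ?z <# H" using coset_self[OF subgroup_H] cc by simp
    then have "c [^] card ?Q = ?z" using coset_inj[OF pw pw z1] by simp
    moreover have "card ?Q \<le> card K - 2" using card_mono[OF fT, of ?Q] T by simp
    ultimately have "card ?Q = card K - 1" using p by (intro pow_inj[OF c]) auto
    then show False using \<open>card ?Q \<le> card K - 2\<close> p by linarith
  qed
  moreover have "?z \<in> carrier G" using cc by simp
  ultimately have "subset_sums G ?B \<noteq> carrier G" by auto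
  moreover have "\<one> \<notin> T" using dis subgroup.one_closed[OF subgroup_H] by auto
  then have "?B \<subseteq> carrier G - {\<one>}" using H_carrier Tc by auto
  ultimately show ?thesis using cB by blast
qed

text \<open>A subset \<open>B\<close> of the exact size locates \<open>H - {\<one>}\<close>. Then
  \<open>large_H_part\<close> is applied once more, to \<open>A\<close> itself, whose size is so far
  only bounded below.\<close>

lemma two_prime_inverse:
  assumes large: "2 * card K + 3 \<le> card H" "order G \<noteq> 14"
    and A: "A \<subseteq> carrier G - {\<one>}" "card A = critical_number G - 1" "subset_sums G A \<noteq> carrier G"
  shows "H - {\<one>} \<subseteq> A" "card (A - H) + 2 = card K"
    and "x \<in> A - H \<Longrightarrow> y \<in> A - H \<Longrightarrow> y \<in> (x <# H) \<union> (inv x <# H)"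
proof -
  have Ac: "A \<subseteq> carrier G" using A by auto
  have nsub: "\<not> carrier G \<subseteq> subset_sums G A" using A subset_sums_carrier[OF Ac] by auto
  obtain B where B: "B \<subseteq> carrier G - {\<one>}" "card B + 3 = card K + card H" "subset_sums G B \<noteq> carrier G"
    using large_incomplete_set by auto
  have cA: "card K + card H \<le> card A + 3" using card_le_critical_number[OF fin B(1,3)] A(2) B(2) by linarith
  then have "card K + card H - 3 \<le> card A" by simp
  then obtain B where B: "B \<subseteq> A" "card B = card K + card H - 3" using obtain_subset_with_card_n by metis
  have p: "2 \<le> card K" using prime_K prime_ge_2_nat by auto
  have B3: "card B + 3 = card K + card H" using B large p by linarith
  have nB: "\<not> carrier G \<subseteq> subset_sums G B" using nsub subset_sums_mono[OF B(1)] by auto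
  have BG: "B \<subseteq> carrier G - {\<one>}" using A B by auto
  have "card H < 2 * card (B \<inter> H)"
  proof (rule ccontr)
    assume "\<not> card H < 2 * card (B \<inter> H)"
    moreover have "odd (card H)" using prime_odd_nat[OF prime_H] large p by linarith
    ultimately have "2 * card (B \<inter> H) < card H" by presburger
    then show False using incomplete_imp_False[OF BG B3 large nB] by simp
  qed
  then have full: "subset_sums G (B \<inter> H) = H"
    using BG by (intro subset_sums_full[OF fin subgroup_H]) auto
  have fB: "finite B" using BG finite_sub by auto
  have "card (B - H) + 2 \<le> card K"
    using nB by (intro large_H_part(1)[OF BG _ _ full]) auto
  then have "card H - 1 \<le> card (B \<inter> H)" using card_Int_Diff[OF fB, of H] B3 by linarith
  moreover have "card (H - {\<one>}) = card H - 1" using subgroup.one_closed[OF subgroup_H] by simp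
  moreover have "B \<inter> H \<subseteq> H - {\<one>}" using BG by auto
  ultimately have "B \<inter> H = H - {\<one>}" using finite_H by (intro card_seteq) auto
  then show HA: "H - {\<one>} \<subseteq> A" using B by auto
  have "2 * card (H - {\<one>}) > card H" using large p subgroup.one_closed[OF subgroup_H] by simp
  then have fullH: "subset_sums G (H - {\<one>}) = H" by (intro subset_sums_full[OF fin subgroup_H]) auto
  have HS: "H - {\<one>} \<subseteq> A \<inter> H" using HA by auto
  have "A \<inter> H = H - {\<one>}" using HA A by auto
  then have "card (A \<inter> H) + 1 = card H" using subgroup.one_closed[OF subgroup_H] large by simp
  then have "card K \<le> card (A - H) + 2" using card_Int_Diff[OF finite_sub[OF Ac], of H] cA by linarith
  moreover note large_H_part[OF A(1,3) HS fullH]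
  ultimately show "card (A - H) + 2 = card K"
    "x \<in> A - H \<Longrightarrow> y \<in> A - H \<Longrightarrow> y \<in> (x <# H) \<union> (inv x <# H)"
    by simp_all
qed

end

theorem theorem1p1:
  fixes G :: "('a, 'b) monoid_scheme" (structure) and p :: nat and A :: "'a set"
  assumes "comm_group G" and "finite (carrier G)"
    and "Factorial_Ring.prime p" and "p dvd order G"
    and "\<And>q::nat. Factorial_Ring.prime q \<Longrightarrow> q dvd order G \<Longrightarrow> p \<le> q"
    and "(p = 2 \<and> order G \<ge> 36) \<or> (Factorial_Ring.prime (order G div p) \<and> order G div p \<ge> 2 * p + 3)"
    and "order G \<noteq> 14"
    and "A \<subseteq> carrier G - {\<one>}"
    and "card A = critical_number G - 1"
    and "subset_sums G A \<noteq> carrier G"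
  shows "\<exists>H. subgroup H G \<and> card H = order G div p \<and>
           (p = 2 \<longrightarrow> A = H - {\<one>}) \<and>
           (p \<ge> 3 \<longrightarrow> (\<exists>g \<in> carrier G - H.
              A \<subseteq> H \<union> (g <# H) \<union> (inv g <# H) \<and> H - {\<one>} \<subseteq> A))"
proof -
  interpret comm_group G by fact
  show ?thesis
  proof (cases "p = 2 \<and> order G \<ge> 36")
    case True
    then show ?thesis using even_inverse[OF assms(2) _ _ assms(8-10)] assms(4) by auto
  next
    case False
    \<comment> \<open>Here \<open>p = 2\<close> is still possible, with \<open>q\<close> equal to
      11, 13 or 17; then \<open>card (A - H) + 2 = 2\<close> leaves nothing outside
      \<open>H\<close>.\<close>
    define q where "q = order G div p"
    have q: "Factorial_Ring.prime q" "2 * p + 3 \<le> q" using False assms(6) q_def by auto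
    have ord: "order G = p * q" using assms(4) q_def by simp
    obtain H where H: "subgroup H G" "card H = q"
      using sylow_prime_subgroup[OF assms(2) q(1)] ord by auto
    obtain K where K: "subgroup K G" "card K = p"
      using sylow_prime_subgroup[OF assms(2,3,4)] by auto
    interpret two_prime_group G H K
    proof (rule two_prime_group.intro)
      show "two_prime_group_axioms G H K"
        by (rule two_prime_group_axioms.intro) (use assms(2,3) H K q ord in simp_all)
    qed (rule assms(1))
    have large: "2 * card K + 3 \<le> card H" using H K q by simp
    note inverse = two_prime_inverse[OF large assms(7-10)]
    have one: "\<one> \<notin> A" using assms(8) by auto
    have fA: "finite (A - H)" using finite_sub assms(8) by auto
    have "A = H - {\<one>}" if "p = 2"
    proof -
      have "A - H = {}" using inverse(2) that K fA by simp
      then show ?thesis using inverse(1) one by auto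
    qed
    moreover have "\<exists>g \<in> carrier G - H. A \<subseteq> H \<union> (g <# H) \<union> (inv g <# H) \<and> H - {\<one>} \<subseteq> A" if "3 \<le> p"
    proof -
      have "card (A - H) \<noteq> 0" using inverse(2) that K by linarith
      then have "A - H \<noteq> {}" using card.empty by metis
      then obtain g where g: "g \<in> A - H" by auto
      then have "A \<subseteq> H \<union> (g <# H) \<union> (inv g <# H)" using inverse(3)[OF g] by auto
      then show ?thesis using g inverse(1) assms(8) by blast
    qed
    ultimately show ?thesis using H q_def by blast
  qed
qed

end
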